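(* Let $(\mathrm M,\mathsf d,\mathfrak m)$ be a complete separable metric space equipped with a non-negative Radon measure. Let $(f_n)\subset S^2(\mathrm M)$ converge $\mathfrak m$-a.e. to some $f\in L^0(\mathfrak m)$ and be such that $(\mathrm df_n)$ converges to some $\omega\in L^2(T^*\mathrm M)$ in the $L^2(T^*\mathrm M)$-norm. Then $f\in S^2(\mathrm M)$ and $\mathrm df=\omega$. In particular, if $(f_n)\subset W^{1,2}(\mathrm M)$ is such that $f_n\rightharpoonup f$ and $\mathrm df_n\rightharpoonup\omega$ for some $f\in L^2(\mathfrak m)$ and $\omega\in L^2(T^*\mathrm M)$ in the weak topologies of $L^2(\mathfrak m)$ and $L^2(T^*\mathrm M)$ respectively, then $f\in W^{1,2}(\mathrm M)$ and $\mathrm df=\omega$.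
   Context: Functions and Borel sets are identified up to $\mathfrak m$-a.e. equality; $L^0(\mathfrak m)$ is the space of (classes of) real valued Borel functions. Sobolev class. For an absolutely continuous curve $\gamma\in C([0,1],\mathrm M)$, $|\dot\gamma_t|$ is its metric speed (the a.e. minimal $f\in L^1(0,1)$ with $\mathsf d(\gamma_t,\gamma_s)\le\int_t^sf(r)\,dr$ for $t<s$); $\int_0^1|\dot\gamma_t|^2dt:=+\infty$ if $\gamma$ is not absolutely continuous; $\mathrm e_t(\gamma):=\gamma_t$. A test plan is a Borel probability measure $\pi$ on $C([0,1],\mathrm M)$ such that for some $C$ one has $(\mathrm e_t)_*\pi\le C\mathfrak m$ for all $t\in[0,1]$, and $\iint_0^1|\dot\gamma_t|^2\,dt\,d\pi(\gamma)<\infty$. $S^2(\mathrm M)$ is the set of $f\in L^0(\mathfrak m)$ for which there is a non-negative $G\in L^2(\mathfrak m)$ with $\int|f(\gamma_1)-f(\gamma_0)|\,d\pi\le\iint_0^1G(\gamma_t)|\dot\gamma_t|\,dt\,d\pi$ for every test plan $\pi$; $|\mathrm Df|$ denotes the $\mathfrak m$-a.e. minimal such $G$. $W^{1,2}(\mathrm M):=L^2(\mathfrak m)\cap S^2(\mathrm M)$ with $\|f\|^2_{W^{1,2}}:=\|f\|_{L^2}^2+\||\mathrm Df|\|_{L^2}^2$. Modules. An $L^2(\mathfrak m)$-normed module is a Banach space $\mathscr M$ with a bilinear multiplication $L^\infty(\mathfrak m)\times\mathscr M\to\mathscr M$ with $(fg)v=f(gv)$, $\mathbf 1v=v$, and a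 pointwise norm $|\cdot|:\mathscr M\to L^2(\mathfrak m)$ with non-negative values such that $\||v|\|_{L^2(\mathfrak m)}=\|v\|_{\mathscr M}$ and $|fv|=|f||v|$ $\mathfrak m$-a.e. Cotangent module. Consider countable families $\{(f_i,A_i)\}_i$ with $(A_i)$ a Borel partition of $\mathrm M$, $f_i\in S^2(\mathrm M)$, $\sum_i\int_{A_i}|\mathrm Df_i|^2d\mathfrak m<\infty$, modulo the relation $\{(f_i,A_i)\}\sim\{(g_j,B_j)\}$ iff $|\mathrm D(f_i-g_j)|=0$ $\mathfrak m$-a.e. on $A_i\cap B_j$ for all $i,j$. On classes set $[(f_i,A_i)]+[(g_j,B_j)]:=[(f_i+g_j,A_i\cap B_j)]$, $\lambda[(f_i,A_i)]:=[(\lambda f_i,A_i)]$, $(\sum_ja_j\chi_{B_j})[(f_i,A_i)]:=[(a_jf_i,A_i\cap B_j)]$ for finite Borel partitions $(B_j)$, pointwise norm $|[(f_i,A_i)]|:=|\mathrm Df_i|$ on $A_i$, and norm equal to the $L^2(\mathfrak m)$-norm of the pointwise norm. The completion, with operations extended by continuity, is the $L^2(\mathfrak m)$-normed module $L^2(T^*\mathrm M)$. The differential of $f\in S^2(\mathrm M)$ is $\mathrm df:=[(f,\mathrm M)]\in L^2(T^*\mathrm M)$; thus $|\mathrm df|=|\mathrm Df|$. *)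

theory Defs
  imports "HOL-Probability.Probability"
begin

section \<open>Metric measure spaces and test plans\<close>

definition radon_measure :: "'a::polish_space measure \<Rightarrow> bool" where
  "radon_measure m \<longleftrightarrow>
     sets m = sets borel \<and>
     (\<forall>x. \<exists>U. open U \<and> x \<in> U \<and> emeasure m U < \<infinity>) \<and>
     (\<forall>A\<in>sets borel. emeasure m A = (SUP K\<in>{K. compact K \<and> K \<subseteq> A}. emeasure m K))"

text \<open>
  Elements of the following metric space are curves \<open>real \<Rightarrow> 'a\<close> that are continuous on \<open>{0..1}\<close>
  and take the value \<open>undefined\<close> elsewhere, with the supremum distance.
\<close>

definition curves :: "(real \<Rightarrow> 'a::polish_space) metric" where
  "curves = cfunspace (top_of_set {0..1}) euclidean_metric"

definition curve_borel :: "(real \<Rightarrow> 'a::polish_space) measure" where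
  "curve_borel = sigma (mspace curves) {U. openin (mtopology_of curves) U}"

definition speed_bound :: "(real \<Rightarrow> 'a::polish_space) \<Rightarrow> (real \<Rightarrow> real) \<Rightarrow> bool" where
  "speed_bound \<gamma> g \<longleftrightarrow>
     set_integrable lborel {0..1} g \<and>
     (\<forall>t s. 0 \<le> t \<longrightarrow> t < s \<longrightarrow> s \<le> 1 \<longrightarrow> dist (\<gamma> t) (\<gamma> s) \<le> (LINT r:{t..s}|lborel. g r))"

definition abs_cont_curve :: "(real \<Rightarrow> 'a::polish_space) \<Rightarrow> bool" where
  "abs_cont_curve \<gamma> \<longleftrightarrow> (\<exists>g. speed_bound \<gamma> g)"

text \<open>A representative of the metric speed; it is meaningful for absolutely continuous curves.\<close>

definition metric_speed :: "(real \<Rightarrow> 'a::polish_space) \<Rightarrow> real \<Rightarrow> real" where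
  "metric_speed \<gamma> = (SOME g. speed_bound \<gamma> g \<and>
     (\<forall>h. speed_bound \<gamma> h \<longrightarrow> (AE t in lborel. t \<in> {0..1} \<longrightarrow> g t \<le> h t)))"

definition curve_energy :: "(real \<Rightarrow> 'a::polish_space) \<Rightarrow> ennreal" where
  "curve_energy \<gamma> =
     (if abs_cont_curve \<gamma> then (\<integral>\<^sup>+t\<in>{0..1}. ennreal ((metric_speed \<gamma> t)\<^sup>2) \<partial>lborel) else \<infinity>)"

definition test_plan :: "'a::polish_space measure \<Rightarrow> (real \<Rightarrow> 'a) measure \<Rightarrow> bool" where
  "test_plan m \<pi> \<longleftrightarrow>
     prob_space \<pi> \<and> sets \<pi> = sets curve_borel \<and>
     (\<exists>C>0. \<forall>t\<in>{0..1}. \<forall>A\<in>sets borel.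
        emeasure (distr \<pi> borel (\<lambda>\<gamma>. \<gamma> t)) A \<le> ennreal C * emeasure m A) \<and>
     (\<integral>\<^sup>+\<gamma>. curve_energy \<gamma> \<partial>\<pi>) < \<infinity>"


section \<open>Sobolev class\<close>

text \<open>Classes of functions modulo a.e. equality are represented by Borel functions.\<close>

definition L2 :: "'a measure \<Rightarrow> ('a \<Rightarrow> real) set" where
  "L2 m = {f \<in> borel_measurable m. integrable m (\<lambda>x. (f x)\<^sup>2)}"

definition weak_upper_gradient ::
    "'a::polish_space measure \<Rightarrow> ('a \<Rightarrow> real) \<Rightarrow> ('a \<Rightarrow> real) \<Rightarrow> bool" where
  "weak_upper_gradient m f G \<longleftrightarrow>
     G \<in> L2 m \<and> (\<forall>x. 0 \<le> G x) \<and>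
     (\<forall>\<pi>. test_plan m \<pi> \<longrightarrow>
        (\<integral>\<^sup>+\<gamma>. ennreal \<bar>f (\<gamma> 1) - f (\<gamma> 0)\<bar> \<partial>\<pi>) \<le>
        (\<integral>\<^sup>+\<gamma>. (\<integral>\<^sup>+t\<in>{0..1}. ennreal (G (\<gamma> t) * metric_speed \<gamma> t) \<partial>lborel) \<partial>\<pi>))"

definition S2 :: "'a::polish_space measure \<Rightarrow> ('a \<Rightarrow> real) set" where
  "S2 m = {f \<in> borel_measurable m. \<exists>G. weak_upper_gradient m f G}"

definition W12 :: "'a::polish_space measure \<Rightarrow> ('a \<Rightarrow> real) set" where
  "W12 m = L2 m \<inter> S2 m"

text \<open>A representative of \<open>|Df|\<close>; it is meaningful for \<open>f\<close> in \<^term>\<open>S2 m\<close>.\<close>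

definition min_wug :: "'a::polish_space measure \<Rightarrow> ('a \<Rightarrow> real) \<Rightarrow> 'a \<Rightarrow> real" where
  "min_wug m f = (SOME G. weak_upper_gradient m f G \<and>
     (\<forall>H. weak_upper_gradient m f H \<longrightarrow> (AE x in m. G x \<le> H x)))"


section \<open>Normed spaces on a carrier\<close>

text \<open>
  The cotangent module depends on the measure, which is a term, so the normed spaces below are
  given by records instead of type class instances.
\<close>

record 'v nspace =
  vecs :: "'v set"
  vadd :: "'v \<Rightarrow> 'v \<Rightarrow> 'v"
  vscale :: "real \<Rightarrow> 'v \<Rightarrow> 'v"
  vnorm :: "'v \<Rightarrow> real"

definition vdist :: "'v nspace \<Rightarrow> 'v \<Rightarrow> 'v \<Rightarrow> real" where
  "vdist V u v = vnorm V (vadd V u (vscale V (-1) v))"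

definition norm_converges :: "'v nspace \<Rightarrow> (nat \<Rightarrow> 'v) \<Rightarrow> 'v \<Rightarrow> bool" where
  "norm_converges V u l \<longleftrightarrow> (\<lambda>n. vdist V (u n) l) \<longlonglongrightarrow> 0"

definition bounded_functional :: "'v nspace \<Rightarrow> ('v \<Rightarrow> real) \<Rightarrow> bool" where
  "bounded_functional V L \<longleftrightarrow>
     (\<forall>u\<in>vecs V. \<forall>v\<in>vecs V. L (vadd V u v) = L u + L v) \<and>
     (\<forall>c. \<forall>u\<in>vecs V. L (vscale V c u) = c * L u) \<and>
     (\<exists>C. \<forall>u\<in>vecs V. \<bar>L u\<bar> \<le> C * vnorm V u)"

definition weakly_converges :: "'v nspace \<Rightarrow> (nat \<Rightarrow> 'v) \<Rightarrow> 'v \<Rightarrow> bool" where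
  "weakly_converges V u l \<longleftrightarrow> (\<forall>L. bounded_functional V L \<longrightarrow> (\<lambda>n. L (u n)) \<longlonglongrightarrow> L l)"

definition cauchy_seqs :: "'v nspace \<Rightarrow> (nat \<Rightarrow> 'v) set" where
  "cauchy_seqs V = {u. (\<forall>n. u n \<in> vecs V) \<and>
     (\<forall>e>0. \<exists>N. \<forall>k\<ge>N. \<forall>n\<ge>N. vdist V (u k) (u n) < e)}"

definition cauchy_rel :: "'v nspace \<Rightarrow> ((nat \<Rightarrow> 'v) \<times> (nat \<Rightarrow> 'v)) set" where
  "cauchy_rel V = {(u, v). u \<in> cauchy_seqs V \<and> v \<in> cauchy_seqs V \<and>
     (\<lambda>n. vdist V (u n) (v n)) \<longlonglongrightarrow> 0}"

definition nspace_completion :: "'v nspace \<Rightarrow> (nat \<Rightarrow> 'v) set nspace" where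
  "nspace_completion V =
     \<lparr>vecs = cauchy_seqs V // cauchy_rel V,
      vadd = (\<lambda>P Q. \<Union>u\<in>P. \<Union>v\<in>Q. cauchy_rel V `` {\<lambda>n. vadd V (u n) (v n)}),
      vscale = (\<lambda>c P. \<Union>u\<in>P. cauchy_rel V `` {\<lambda>n. vscale V c (u n)}),
      vnorm = (\<lambda>P. THE r. \<forall>u\<in>P. (\<lambda>n. vnorm V (u n)) \<longlonglongrightarrow> r)\<rparr>"

definition completion_embed :: "'v nspace \<Rightarrow> 'v \<Rightarrow> (nat \<Rightarrow> 'v) set" where
  "completion_embed V v = cauchy_rel V `` {\<lambda>_. v}"

text \<open>The norm of this space is a seminorm on functions, vanishing exactly on a.e. null functions.\<close>

definition L2_space :: "'a measure \<Rightarrow> ('a \<Rightarrow> real) nspace" where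
  "L2_space m =
     \<lparr>vecs = L2 m,
      vadd = (\<lambda>f g x. f x + g x),
      vscale = (\<lambda>c f x. c * f x),
      vnorm = (\<lambda>f. sqrt (\<integral>x. (f x)\<^sup>2 \<partial>m))\<rparr>"


section \<open>Cotangent module\<close>

text \<open>
  A countable family \<open>{(f\<^sub>i, A\<^sub>i)}\<^sub>i\<close> is the set of its members. Only pairs with empty second
  component can coincide for different indices, and these carry no information.
\<close>

type_synonym 'a cot_family = "(('a \<Rightarrow> real) \<times> 'a set) set"

definition cot_families :: "'a::polish_space measure \<Rightarrow> 'a cot_family set" where
  "cot_families m = {F.
     countable F \<and>
     (\<forall>(f, A)\<in>F. f \<in> S2 m \<and> A \<in> sets m) \<and>
     (\<forall>p\<in>F. \<forall>q\<in>F. p \<noteq> q \<longrightarrow> snd p \<inter> snd q = {}) \<and>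
     \<Union>(snd ` F) = space m \<and>
     (\<integral>\<^sup>+(f, A). (\<integral>\<^sup>+x\<in>A. ennreal ((min_wug m f x)\<^sup>2) \<partial>m) \<partial>count_space F) < \<infinity>}"

definition cot_rel :: "'a::polish_space measure \<Rightarrow> ('a cot_family \<times> 'a cot_family) set" where
  "cot_rel m = {(F, H). F \<in> cot_families m \<and> H \<in> cot_families m \<and>
     (\<forall>(f, A)\<in>F. \<forall>(h, B)\<in>H. AE x in m. x \<in> A \<inter> B \<longrightarrow> min_wug m (\<lambda>y. f y - h y) x = 0)}"

definition cot_add :: "'a cot_family \<Rightarrow> 'a cot_family \<Rightarrow> 'a cot_family" where
  "cot_add F H = (\<lambda>((f, A), (h, B)). (\<lambda>x. f x + h x, A \<inter> B)) ` (F \<times> H)"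

definition cot_scale :: "real \<Rightarrow> 'a cot_family \<Rightarrow> 'a cot_family" where
  "cot_scale c F = (\<lambda>(f, A). (\<lambda>x. c * f x, A)) ` F"

definition cot_pointwise_norm :: "'a::polish_space measure \<Rightarrow> 'a cot_family \<Rightarrow> 'a \<Rightarrow> real" where
  "cot_pointwise_norm m F x = min_wug m (fst (THE p. p \<in> F \<and> x \<in> snd p)) x"

definition pre_cotangent :: "'a::polish_space measure \<Rightarrow> 'a cot_family set nspace" where
  "pre_cotangent m =
     \<lparr>vecs = cot_families m // cot_rel m,
      vadd = (\<lambda>P Q. \<Union>F\<in>P. \<Union>H\<in>Q. cot_rel m `` {cot_add F H}),
      vscale = (\<lambda>c P. \<Union>F\<in>P. cot_rel m `` {cot_scale c F}),
      vnorm = (\<lambda>P. THE r. \<forall>F\<in>P. r = sqrt (\<integral>x. (cot_pointwise_norm m F x)\<^sup>2 \<partial>m))\<rparr>"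

type_synonym 'a covector = "(nat \<Rightarrow> 'a cot_family set) set"

definition cotangent_module :: "'a::polish_space measure \<Rightarrow> 'a covector nspace" where
  "cotangent_module m = nspace_completion (pre_cotangent m)"

definition differential :: "'a::polish_space measure \<Rightarrow> ('a \<Rightarrow> real) \<Rightarrow> 'a covector" where
  "differential m f = completion_embed (pre_cotangent m) (cot_rel m `` {{(f, space m)}})"

end

theory Submission
  imports Defs
begin

text \<open>
  The differentials of a convergent sequence are Cauchy, so for fixed \<open>n\<close> the functions
  \<open>|D(f\<^sub>n - f\<^sub>k)|\<close> converge in \<open>L\<^sup>2\<close> as \<open>k \<rightarrow> \<infinity>\<close>, and by the stability of weak upper gradients under a.e.
  convergence of functions and \<open>L\<^sup>2\<close> convergence of gradients their limit is a weak upper gradient of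
  \<open>f\<^sub>n - f\<close>, with norm tending to \<open>0\<close> in \<open>n\<close>. The weak version reduces to the strong one by Mazur's lemma
  for the pairs \<open>(f\<^sub>n, df\<^sub>n)\<close>.

  Two facts have to be supplied for minimal gradients to make sense. The metric speed of a curve of finite
  energy is the \<open>L\<^sup>2\<close> limit of its dyadic difference quotients, which makes the energy Borel and yields a
  jointly measurable version of the speed along a test plan. And the minimum of two weak upper gradients is
  a weak upper gradient: the defining inequality localises to almost every curve and all dyadic times by
  restricting test plans, and then two bounds on increments combine by Henstock's lemma.
\<close>

section \<open>Square-integrable functions\<close>

text \<open>\<open>metric_speed\<close> and \<open>min_wug\<close> are choices, made curve by curve
  and function by function. They carry no information before a minimal object is known to exist, and
  even then the chosen speed need not depend measurably on the curve; integrals over a test plan are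
  therefore computed with a substitute that agrees with it a.e. along almost every curve. A second
  obstacle is that a weak upper gradient controls only averages of end-point increments, of a
  function that is merely Borel: along a curve there is neither continuity nor a null set common to
  all times, so pointwise bounds are within reach for countably many times only. Minimality a.e.,
  not just minimality of the norm, makes the gradient subadditive and homogeneous a.e., and the
  relation between families, their sums and their norms are well defined only through these
  properties. In the weak statement one sequence of convex combinations has to serve functions and
  differentials simultaneously; this is why pairs enter, and with them a Hahn-Banach theorem for
  spaces given by a carrier.\<close>

definition l2norm :: "'a measure \<Rightarrow> ('a \<Rightarrow> real) \<Rightarrow> real" where
  "l2norm m f = sqrt (\<integral>x. (f x)\<^sup>2 \<partial>m)"

lemma L2_measurable [measurable_dest]: "f \<in> L2 m \<Longrightarrow> f \<in> borel_measurable m"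
  by (simp add: L2_def)

lemma L2_square_integrable: "f \<in> L2 m \<Longrightarrow> integrable m (\<lambda>x. (f x)\<^sup>2)"
  by (simp add: L2_def)

lemma L2_mult_integrable:
  assumes "f \<in> L2 m" "g \<in> L2 m"
  shows "integrable m (\<lambda>x. f x * g x)"
proof (rule Bochner_Integration.integrable_bound)
  show "integrable m (\<lambda>x. (f x)\<^sup>2 + (g x)\<^sup>2)"
    using assms by (simp add: L2_def)
  show "(\<lambda>x. f x * g x) \<in> borel_measurable m"
    using assms by (auto simp: L2_def intro: borel_measurable_times)
  have "\<bar>a * b\<bar> \<le> a\<^sup>2 + b\<^sup>2" for a b :: real
  proof -
    have "0 \<le> (\<bar>a\<bar> - \<bar>b\<bar>)\<^sup>2" by simp
    then have "2 * (\<bar>a\<bar> * \<bar>b\<bar>) \<le> a\<^sup>2 + b\<^sup>2" by (simp add: power2_diff)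
    moreover have "0 \<le> \<bar>a\<bar> * \<bar>b\<bar>" by simp
    ultimately show ?thesis unfolding abs_mult by linarith
  qed
  then show "AE x in m. norm (f x * g x) \<le> norm ((f x)\<^sup>2 + (g x)\<^sup>2)"
    by auto
qed

lemma L2_add: "f \<in> L2 m \<Longrightarrow> g \<in> L2 m \<Longrightarrow> (\<lambda>x. f x + g x) \<in> L2 m"
  using L2_mult_integrable[of f m g]
  by (auto simp: L2_def power2_sum mult.assoc)

lemma L2_cmult: "f \<in> L2 m \<Longrightarrow> (\<lambda>x. c * f x) \<in> L2 m"
  by (auto simp: L2_def power_mult_distrib)

lemma L2_diff: "f \<in> L2 m \<Longrightarrow> g \<in> L2 m \<Longrightarrow> (\<lambda>x. f x - g x) \<in> L2 m"
  using L2_add[of f m "\<lambda>x. - 1 * g x"] L2_cmult[of g m "- 1"] by simp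

lemma L2_abs: "f \<in> L2 m \<Longrightarrow> (\<lambda>x. \<bar>f x\<bar>) \<in> L2 m"
  by (auto simp: L2_def)

lemma L2_zero: "(\<lambda>x. 0) \<in> L2 m"
  by (auto simp: L2_def)

lemma L2_bound:
  assumes "g \<in> L2 m" "f \<in> borel_measurable m" "AE x in m. \<bar>f x\<bar> \<le> \<bar>g x\<bar>"
  shows "f \<in> L2 m"
proof -
  have "integrable m (\<lambda>x. (f x)\<^sup>2)"
    by (rule Bochner_Integration.integrable_bound[OF L2_square_integrable[OF assms(1)]])
       (use assms in \<open>auto elim!: eventually_mono simp: abs_le_square_iff\<close>)
  then show ?thesis using assms by (simp add: L2_def)
qed

lemma l2norm_nonneg [simp]: "0 \<le> l2norm m f"
  by (simp add: l2norm_def)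

lemma l2norm_power2: "(l2norm m f)\<^sup>2 = (\<integral>x. (f x)\<^sup>2 \<partial>m)"
  by (simp add: l2norm_def)

lemma l2norm_cong_AE:
  assumes "f \<in> borel_measurable m" "g \<in> borel_measurable m" "AE x in m. \<bar>f x\<bar> = \<bar>g x\<bar>"
  shows "l2norm m f = l2norm m g"
proof -
  have "(\<integral>x. (f x)\<^sup>2 \<partial>m) = (\<integral>x. (g x)\<^sup>2 \<partial>m)"
    by (rule integral_cong_AE) (use assms in \<open>auto elim!: eventually_mono simp: power2_eq_iff abs_eq_iff\<close>)
  then show ?thesis by (simp add: l2norm_def)
qed

lemma l2norm_mono_AE:
  assumes "g \<in> L2 m" "f \<in> borel_measurable m" "AE x in m. \<bar>f x\<bar> \<le> \<bar>g x\<bar>"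
  shows "l2norm m f \<le> l2norm m g"
  unfolding l2norm_def
  by (intro real_sqrt_le_mono integral_mono_AE)
     (use assms L2_bound[OF assms] in \<open>auto elim!: eventually_mono simp: L2_def abs_le_square_iff\<close>)

lemma l2norm_cmult: "l2norm m (\<lambda>x. c * f x) = \<bar>c\<bar> * l2norm m f"
  by (simp add: l2norm_def power_mult_distrib real_sqrt_mult)

lemma l2norm_minus_commute: "l2norm m (\<lambda>x. f x - g x) = l2norm m (\<lambda>x. g x - f x)"
  by (simp add: l2norm_def power2_commute)

text \<open>The integral of the square of \<open>t * f x + g x\<close> is a quadratic in
  \<open>t\<close> that is nowhere negative.\<close>

lemma l2_Cauchy_Schwarz:
  assumes "f \<in> L2 m" "g \<in> L2 m"
  shows "\<bar>\<integral>x. f x * g x \<partial>m\<bar> \<le> l2norm m f * l2norm m g"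
proof -
  let ?A = "\<integral>x. (f x)\<^sup>2 \<partial>m" and ?B = "\<integral>x. (g x)\<^sup>2 \<partial>m" and ?C = "\<integral>x. f x * g x \<partial>m"
  note i = L2_square_integrable[OF assms(1)] L2_square_integrable[OF assms(2)]
    L2_mult_integrable[OF assms]
  have q: "0 \<le> ?A * t\<^sup>2 + 2 * t * ?C + ?B" for t
  proof -
    have "0 \<le> (\<integral>x. (t * f x + g x)\<^sup>2 \<partial>m)" by simp
    also have "\<dots> = (\<integral>x. t\<^sup>2 * (f x)\<^sup>2 + 2 * t * (f x * g x) + (g x)\<^sup>2 \<partial>m)"
      by (intro Bochner_Integration.integral_cong) (auto simp: power2_sum power_mult_distrib algebra_simps)
    also have "\<dots> = ?A * t\<^sup>2 + 2 * t * ?C + ?B"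
      using i by simp
    finally show ?thesis .
  qed
  have A0: "0 \<le> ?A" and B0: "0 \<le> ?B" by simp_all
  have "?C\<^sup>2 \<le> ?A * ?B"
  proof (cases "?A = 0")
    case True
    have "?C = 0"
    proof (rule ccontr)
      assume "?C \<noteq> 0"
      \<comment> \<open>The quadratic has become affine in \<open>t\<close>; at this
        \<open>t\<close> its value is -1.\<close>
      then show False using q[of "- (?B + 1) / (2 * ?C)"] True by (simp add: field_simps)
    qed
    then show ?thesis using True by simp
  next
    case False
    then have "0 < ?A" using A0 by (metis order_le_less)
    \<comment> \<open>The minimiser of the quadratic.\<close>
    then show ?thesis using q[of "- ?C / ?A"]
      by (simp add: field_simps power2_eq_square)
  qed
  then have "sqrt (?C\<^sup>2) \<le> sqrt (?A * ?B)" by (rule real_sqrt_le_mono)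
  then show ?thesis by (simp add: l2norm_def real_sqrt_mult)
qed

lemma l2norm_triangle:
  assumes "f \<in> L2 m" "g \<in> L2 m"
  shows "l2norm m (\<lambda>x. f x + g x) \<le> l2norm m f + l2norm m g"
proof (rule power2_le_imp_le)
  have "(l2norm m (\<lambda>x. f x + g x))\<^sup>2 = (\<integral>x. (f x)\<^sup>2 + (g x)\<^sup>2 + 2 * (f x * g x) \<partial>m)"
    by (simp add: l2norm_power2 power2_sum mult.assoc)
  also have "\<dots> = (l2norm m f)\<^sup>2 + (l2norm m g)\<^sup>2 + 2 * (\<integral>x. f x * g x \<partial>m)"
    using L2_mult_integrable[OF assms] assms by (simp add: l2norm_power2 L2_square_integrable)
  also have "\<dots> \<le> (l2norm m f + l2norm m g)\<^sup>2"
    using l2_Cauchy_Schwarz[OF assms] by (simp add: power2_sum)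
  finally show "(l2norm m (\<lambda>x. f x + g x))\<^sup>2 \<le> (l2norm m f + l2norm m g)\<^sup>2" .
qed simp

lemma l2norm_triangle_diff:
  assumes "f \<in> L2 m" "g \<in> L2 m"
  shows "l2norm m f \<le> l2norm m g + l2norm m (\<lambda>x. f x - g x)"
  using l2norm_triangle[OF assms(2) L2_diff[OF assms]] by simp

lemma l2norm_nn:
  assumes "f \<in> L2 m"
  shows "(\<integral>\<^sup>+x. ennreal ((f x)\<^sup>2) \<partial>m) = ennreal ((l2norm m f)\<^sup>2)"
  using assms by (simp add: l2norm_power2 nn_integral_eq_integral L2_square_integrable)

lemma L2_nn_iff:
  assumes "f \<in> borel_measurable m"
  shows "f \<in> L2 m \<longleftrightarrow> (\<integral>\<^sup>+x. ennreal ((f x)\<^sup>2) \<partial>m) < \<infinity>"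
  using assms by (auto simp: L2_def integrable_iff_bounded)

text \<open>Membership and norm bound are drawn together from an extended integral, because Fatou
  and Tonelli supply such bounds before integrability is known.\<close>

lemma l2norm_le_nn:
  assumes "f \<in> borel_measurable m" "(\<integral>\<^sup>+x. ennreal ((f x)\<^sup>2) \<partial>m) \<le> ennreal (e\<^sup>2)" "0 \<le> e"
  shows "f \<in> L2 m" "l2norm m f \<le> e"
proof -
  show f: "f \<in> L2 m"
    using assms by (subst L2_nn_iff) (auto intro: le_less_trans)
  have "(l2norm m f)\<^sup>2 \<le> e\<^sup>2"
    using assms(2) unfolding l2norm_nn[OF f] by simp
  then show "l2norm m f \<le> e" using assms(3) by (rule power2_le_imp_le)
qed

lemma L2_AE_subseq:
  assumes "\<And>n. f n \<in> L2 m" "g \<in> L2 m" "(\<lambda>n. l2norm m (\<lambda>x. f n x - g x)) \<longlonglongrightarrow> 0"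
  obtains r where "strict_mono r" "AE x in m. (\<lambda>n. f (r n) x) \<longlonglongrightarrow> g x"
proof -
  let ?u = "\<lambda>n x. (f n x - g x)\<^sup>2"
  have i: "integrable m (?u n)" for n
    using L2_diff[OF assms(1) assms(2)] by (rule L2_square_integrable)
  have "(\<lambda>n. (l2norm m (\<lambda>x. f n x - g x))\<^sup>2) \<longlonglongrightarrow> 0\<^sup>2"
    by (intro tendsto_intros assms)
  then have "(\<lambda>n. \<integral>x. norm (?u n x) \<partial>m) \<longlonglongrightarrow> 0"
    by (simp add: l2norm_power2)
  from tendsto_L1_AE_subseq[OF i this]
  obtain r where r: "strict_mono r" "AE x in m. (\<lambda>n. ?u (r n) x) \<longlonglongrightarrow> 0" by blast
  have "AE x in m. (\<lambda>n. f (r n) x) \<longlonglongrightarrow> g x"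
    using r(2)
  proof eventually_elim
    case (elim x)
    then have "(\<lambda>n. sqrt (?u (r n) x)) \<longlonglongrightarrow> sqrt 0" by (rule tendsto_real_sqrt)
    then have "(\<lambda>n. \<bar>f (r n) x - g x\<bar>) \<longlonglongrightarrow> 0" by simp
    then have "(\<lambda>n. f (r n) x - g x) \<longlonglongrightarrow> 0" by (simp add: tendsto_rabs_zero_iff)
    then show ?case by (simp add: LIM_zero_iff)
  qed
  with r(1) show thesis by (rule that)
qed

text \<open>A subsequence converges a.e. to the norm limit, and pointwise limits are unique.\<close>

lemma L2_limit_unique_AE:
  assumes "\<And>n. f n \<in> L2 m" "g \<in> L2 m" "(\<lambda>n. l2norm m (\<lambda>x. f n x - g x)) \<longlonglongrightarrow> 0"
    and "AE x in m. (\<lambda>n. f n x) \<longlonglongrightarrow> h x"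
  shows "AE x in m. g x = h x"
proof -
  obtain r where r: "strict_mono r" "AE x in m. (\<lambda>n. f (r n) x) \<longlonglongrightarrow> g x"
    using L2_AE_subseq[OF assms(1-3)] .
  from r(2) assms(4) show ?thesis
  proof eventually_elim
    case (elim x)
    from LIMSEQ_subseq_LIMSEQ[OF elim(2) r(1)] elim(1) show ?case
      by (auto simp: o_def dest: LIMSEQ_unique)
  qed
qed

text \<open>A subsequence with geometrically small increments converges a.e. Fatou's lemma then
  carries the Cauchy bounds of the whole sequence over to the pointwise limit.\<close>

lemma L2_complete:
  assumes f: "\<And>n. f n \<in> L2 m"
    and cauchy: "\<And>e. 0 < e \<Longrightarrow> \<exists>N. \<forall>k\<ge>N. \<forall>n\<ge>N. l2norm m (\<lambda>x. f k x - f n x) < e"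
  obtains g where "g \<in> L2 m" "(\<lambda>n. l2norm m (\<lambda>x. f n x - g x)) \<longlonglongrightarrow> 0"
proof -
  have [measurable]: "f n \<in> borel_measurable m" for n using f by (rule L2_measurable)
  have "\<exists>r. \<forall>j. (\<forall>k\<ge>r j. \<forall>n\<ge>r j. l2norm m (\<lambda>x. f k x - f n x) < (1/4)^j) \<and> r j < r (Suc j)"
  proof (rule dependent_nat_choice)
    show "\<exists>N. \<forall>k\<ge>N. \<forall>n\<ge>N. l2norm m (\<lambda>x. f k x - f n x) < (1/4)^0"
      using cauchy[of 1] by simp
  next
    fix N j
    obtain M where M: "\<forall>k\<ge>M. \<forall>n\<ge>M. l2norm m (\<lambda>x. f k x - f n x) < (1/4)^Suc j"
      using cauchy[of "(1/4)^Suc j"] by auto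
    show "\<exists>M. (\<forall>k\<ge>M. \<forall>n\<ge>M. l2norm m (\<lambda>x. f k x - f n x) < (1/4)^Suc j) \<and> N < M"
      by (rule exI[of _ "max M (Suc N)"]) (use M in auto)
  qed
  then obtain r where r: "\<And>j k n. k \<ge> r j \<Longrightarrow> n \<ge> r j \<Longrightarrow> l2norm m (\<lambda>x. f k x - f n x) < (1/4)^j"
    and "\<And>j. r j < r (Suc j)" by blast
  then have mono: "strict_mono r" by (simp add: strict_mono_Suc_iff)
  define d where "d = (\<lambda>j x. f (r (Suc j)) x - f (r j) x)"
  have d: "d j \<in> L2 m" for j unfolding d_def by (intro L2_diff f)
  have [measurable]: "d j \<in> borel_measurable m" for j using d by (rule L2_measurable)
  \<comment> \<open>The bound \<open>(1/4)^j\<close> on the norm of an increment squares to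
    \<open>(1/16)^j\<close>, which leaves room for the weight \<open>4^j\<close> and still a
    convergent series. Where the weighted series is finite, \<open>d j x\<close> is bounded by a
    multiple of \<open>(1/2)^j\<close>.\<close>
  have dn: "(\<integral>\<^sup>+x. ennreal (4^j * (d j x)\<^sup>2) \<partial>m) \<le> ennreal ((1/4)^j)" for j
  proof -
    have "l2norm m (d j) \<le> (1/4)^j"
      unfolding d_def using r[of j "r (Suc j)" "r j"] mono by (simp add: less_imp_le strict_mono_less_eq)
    then have "(l2norm m (d j))\<^sup>2 \<le> ((1/4)^j)\<^sup>2" by (intro power_mono) auto
    then have "4^j * (l2norm m (d j))\<^sup>2 \<le> 4^j * ((1/4)^j)\<^sup>2" by (intro mult_left_mono) auto
    also have "\<dots> = (1/4)^j" by (simp add: power2_eq_square power_mult_distrib[symmetric] field_simps)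
    finally have "4^j * (l2norm m (d j))\<^sup>2 \<le> (1/4)^j" .
    moreover have "(\<integral>\<^sup>+x. ennreal (4^j * (d j x)\<^sup>2) \<partial>m) = ennreal (4^j) * (\<integral>\<^sup>+x. ennreal ((d j x)\<^sup>2) \<partial>m)"
      by (subst nn_integral_cmult[symmetric]) (auto simp: ennreal_mult)
    ultimately show ?thesis
      by (simp add: l2norm_nn[OF d] ennreal_mult[symmetric] del: power_mult_distrib)
  qed
  have "(\<integral>\<^sup>+x. (\<Sum>j. ennreal (4^j * (d j x)\<^sup>2)) \<partial>m) = (\<Sum>j. \<integral>\<^sup>+x. ennreal (4^j * (d j x)\<^sup>2) \<partial>m)"
    by (rule nn_integral_suminf) auto
  also have "\<dots> \<le> (\<Sum>j. ennreal ((1/4)^j))"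
    by (intro suminf_le dn) auto
  also have "\<dots> = ennreal (\<Sum>j. (1/4)^j)"
    by (rule suminf_ennreal2) (auto intro: summable_geometric)
  finally have "(\<integral>\<^sup>+x. (\<Sum>j. ennreal (4^j * (d j x)\<^sup>2)) \<partial>m) \<noteq> \<infinity>"
    by (auto simp: top_unique)
  then have "AE x in m. (\<Sum>j. ennreal (4^j * (d j x)\<^sup>2)) \<noteq> \<infinity>"
    by (intro nn_integral_PInf_AE) auto
  then have conv: "AE x in m. convergent (\<lambda>j. f (r j) x)"
  proof eventually_elim
    case (elim x)
    define K where "K = enn2real (\<Sum>j. ennreal (4^j * (d j x)\<^sup>2))"
    have K: "4^j * (d j x)\<^sup>2 \<le> K" for j
    proof -
      have "ennreal (4^j * (d j x)\<^sup>2) = (\<Sum>i\<in>{j}. ennreal (4^i * (d i x)\<^sup>2))" by simp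
      also have "\<dots> \<le> (\<Sum>j. ennreal (4^j * (d j x)\<^sup>2))"
        by (rule sum_le_suminf) auto
      also have "\<dots> = ennreal K" using elim by (simp add: K_def top.not_eq_extremum)
      finally show ?thesis by (simp add: K_def)
    qed
    have "norm (d j x) \<le> sqrt K * (1/2)^j" for j
    proof -
      have "(2^j * \<bar>d j x\<bar>)\<^sup>2 \<le> K"
      proof -
        have "(2^j)\<^sup>2 = ((2\<^sup>2)^j :: real)" by (metis power_mult mult.commute)
        then have "(2^j)\<^sup>2 = (4^j :: real)" by simp
        then show ?thesis using K[of j] by (simp add: power_mult_distrib)
      qed
      then have "2^j * \<bar>d j x\<bar> \<le> sqrt K" by (rule real_le_rsqrt)
      then show ?thesis by (simp add: field_simps power_divide)
    qed
    moreover have "summable (\<lambda>j. sqrt K * (1/2::real)^j)"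
      by (rule summable_mult, rule summable_geometric) simp
    ultimately have "summable (\<lambda>j. d j x)"
      by (rule summable_comparison_test'[of _ 0, rotated])
    then have "convergent (\<lambda>n. \<Sum>j<n. d j x)" by (simp add: summable_iff_convergent)
    moreover have "(\<Sum>j<n. d j x) = f (r n) x - f (r 0) x" for n
      unfolding d_def by (rule sum_lessThan_telescope)
    ultimately have "convergent (\<lambda>n. (f (r n) x - f (r 0) x) + f (r 0) x)"
      by (intro convergent_add convergent_const) simp
    then show ?case by simp
  qed
  define g where "g = (\<lambda>x. lim (\<lambda>j. f (r j) x))"
  have g[measurable]: "g \<in> borel_measurable m" unfolding g_def by measurable
  have lim: "AE x in m. (\<lambda>j. f (r j) x) \<longlonglongrightarrow> g x"
    using conv by eventually_elim (simp add: g_def convergent_LIMSEQ_iff)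
  \<comment> \<open>Fatou's lemma along the subsequence shows at once that \<open>f n - g\<close> is
    square-integrable and that it is small; that \<open>g\<close> lies in \<open>L2 m\<close> is
    then a consequence.\<close>
  have est: "(\<lambda>x. f n x - g x) \<in> L2 m \<and> l2norm m (\<lambda>x. f n x - g x) \<le> (1/4)^j" if "n \<ge> r j" for j n
  proof -
    have "(\<integral>\<^sup>+x. ennreal ((f n x - g x)\<^sup>2) \<partial>m) = (\<integral>\<^sup>+x. liminf (\<lambda>i. ennreal ((f n x - f (r i) x)\<^sup>2)) \<partial>m)"
    proof (rule nn_integral_cong_AE, use lim in eventually_elim)
      case (elim x)
      have "(\<lambda>i. ennreal ((f n x - f (r i) x)\<^sup>2)) \<longlonglongrightarrow> ennreal ((f n x - g x)\<^sup>2)"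
        by (intro tendsto_intros tendsto_ennrealI elim)
      from lim_imp_Liminf[OF sequentially_bot this] show ?case by (rule sym)
    qed
    also have "\<dots> \<le> liminf (\<lambda>i. \<integral>\<^sup>+x. ennreal ((f n x - f (r i) x)\<^sup>2) \<partial>m)"
      by (rule nn_integral_liminf) auto
    also have "\<dots> \<le> liminf (\<lambda>i. ennreal (((1/4)^j)\<^sup>2))"
    proof (rule Liminf_mono, rule eventually_sequentiallyI)
      fix i assume "j \<le> i"
      then have "r i \<ge> r j" using mono by (simp add: strict_mono_less_eq)
      then have "l2norm m (\<lambda>x. f n x - f (r i) x) \<le> (1/4)^j" using r that by (simp add: less_imp_le)
      then show "(\<integral>\<^sup>+x. ennreal ((f n x - f (r i) x)\<^sup>2) \<partial>m) \<le> ennreal (((1/4)^j)\<^sup>2)"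
        unfolding l2norm_nn[OF L2_diff[OF f f]] by (intro ennreal_leI power_mono) auto
    qed
    also have "\<dots> = ennreal (((1/4)^j)\<^sup>2)" by (simp add: Liminf_const)
    finally show ?thesis using l2norm_le_nn[of "\<lambda>x. f n x - g x" m "(1/4)^j"] by auto
  qed
  show thesis
  proof (rule that)
    show "g \<in> L2 m"
      using L2_diff[OF f[of "r 0"] est[of 0 "r 0", THEN conjunct1]] by simp
    show "(\<lambda>n. l2norm m (\<lambda>x. f n x - g x)) \<longlonglongrightarrow> 0"
    proof (rule LIMSEQ_I)
      fix e :: real assume "0 < e"
      obtain j where j: "(1/4::real)^j < e" using real_arch_pow_inv[OF \<open>0 < e\<close>, of "1/4"] by auto
      show "\<exists>N. \<forall>n\<ge>N. norm (l2norm m (\<lambda>x. f n x - g x) - 0) < e"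
        by (rule exI[of _ "r j"]) (use est j in \<open>auto intro: le_less_trans\<close>)
    qed
  qed
qed


text \<open>The inequality makes \<open>A\<close> increasing, boundedness turns it into a Cauchy
  sequence, and the squared distances inherit this. It serves the dyadic speeds of a single curve
  and, after integration over a test plan, those of almost all curves at once.\<close>

lemma L2_limit_of_monotone_energy:
  assumes g: "\<And>n. g n \<in> L2 M"
    and le: "\<And>n k. n \<le> k \<Longrightarrow> (l2norm M (\<lambda>x. g k x - g n x))\<^sup>2 \<le> A k - A n"
    and bdd: "\<And>n. A n \<le> (K :: real)"
  obtains h where "h \<in> L2 M" "(\<lambda>n. l2norm M (\<lambda>x. g n x - h x)) \<longlonglongrightarrow> 0"
proof -
  have "A n \<le> A k" if "n \<le> k" for n k using le[OF that] by (smt (verit) zero_le_power2)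
  then have "incseq A" unfolding incseq_def by blast
  then have "convergent A" using incseq_convergent[of A K] bdd by (metis convergentI)
  then have "Cauchy A" by (rule convergent_Cauchy)
  have "\<exists>N. \<forall>k\<ge>N. \<forall>n\<ge>N. l2norm M (\<lambda>x. g k x - g n x) < e" if "0 < e" for e
  proof -
    obtain N where N: "\<And>k n. k \<ge> N \<Longrightarrow> n \<ge> N \<Longrightarrow> \<bar>A k - A n\<bar> < e\<^sup>2"
      using CauchyD[OF \<open>Cauchy A\<close> zero_less_power[OF \<open>0 < e\<close>, of 2]] unfolding real_norm_def by blast
    have *: "l2norm M (\<lambda>x. g k x - g n x) < e" if "N \<le> n" "n \<le> k" for k n
    proof (rule power2_less_imp_less)
      show "(l2norm M (\<lambda>x. g k x - g n x))\<^sup>2 < e\<^sup>2"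
        using le[OF that(2)] N[of k n] that by (simp add: abs_less_iff)
    qed (use \<open>0 < e\<close> in simp)
    then have "l2norm M (\<lambda>x. g k x - g n x) < e" if "N \<le> n" "N \<le> k" for k n
      using *[of n k] *[of k n] that l2norm_minus_commute[of M "g k" "g n"] by (cases "n \<le> k") auto
    then show ?thesis by blast
  qed
  from L2_complete[OF g this] show thesis using that by blast
qed

section \<open>Metric speed\<close>

lemma set_integrable_min:
  fixes g h :: "'a \<Rightarrow> real"
  assumes "set_integrable M A g" "set_integrable M A h"
  shows "set_integrable M A (\<lambda>r. min (g r) (h r))"
proof -
  have "integrable M (\<lambda>x. min (indicator A x *\<^sub>R g x) (indicator A x *\<^sub>R h x))"
    using assms by (simp add: set_integrable_def)
  moreover have "min (indicator A x *\<^sub>R g x) (indicator A x *\<^sub>R h x) = indicator A x *\<^sub>R min (g x) (h x)" for x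
    by (simp add: indicator_def)
  ultimately show ?thesis by (simp add: set_integrable_def)
qed

text \<open>The tags of a division on which Henstock's lemma controls \<open>g\<close>, \<open>h\<close> and \<open>min g h\<close> decide which
  of the two bounds is used on each piece.\<close>

lemma dist_le_integral_min:
  fixes \<phi> :: "real \<Rightarrow> 'a::metric_space"
  assumes g: "set_integrable lborel {a..b} g" and h: "set_integrable lborel {a..b} h" and "a \<le> b"
    and bg: "\<And>t s. a \<le> t \<Longrightarrow> t < s \<Longrightarrow> s \<le> b \<Longrightarrow> dist (\<phi> t) (\<phi> s) \<le> (LINT r:{t..s}|lborel. g r)"
    and bh: "\<And>t s. a \<le> t \<Longrightarrow> t < s \<Longrightarrow> s \<le> b \<Longrightarrow> dist (\<phi> t) (\<phi> s) \<le> (LINT r:{t..s}|lborel. h r)"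
  shows "dist (\<phi> a) (\<phi> b) \<le> (LINT r:{a..b}|lborel. min (g r) (h r))"
proof -
  let ?m = "\<lambda>r. min (g r) (h r)"
  have m: "set_integrable lborel {a..b} ?m" by (rule set_integrable_min[OF g h])
  note int = set_borel_integral_eq_integral(1)[OF g] set_borel_integral_eq_integral(1)[OF h]
    set_borel_integral_eq_integral(1)[OF m]
  have "dist (\<phi> a) (\<phi> b) \<le> integral {a..b} ?m + e" if "0 < e" for e
  proof -
    have e: "0 < e / 3" using that by simp
    obtain d1 where d1: "gauge d1" "\<And>p. p tagged_partial_division_of cbox a b \<Longrightarrow> d1 fine p \<Longrightarrow>
        (\<Sum>(x,k)\<in>p. norm (measure lborel k *\<^sub>R g x - integral k g)) < e / 3"
      using Henstock_lemma[of g a b, OF int(1)[folded box_real] e] by blast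
    obtain d2 where d2: "gauge d2" "\<And>p. p tagged_partial_division_of cbox a b \<Longrightarrow> d2 fine p \<Longrightarrow>
        (\<Sum>(x,k)\<in>p. norm (measure lborel k *\<^sub>R h x - integral k h)) < e / 3"
      using Henstock_lemma[of h a b, OF int(2)[folded box_real] e] by blast
    obtain d3 where d3: "gauge d3" "\<And>p. p tagged_partial_division_of cbox a b \<Longrightarrow> d3 fine p \<Longrightarrow>
        (\<Sum>(x,k)\<in>p. norm (measure lborel k *\<^sub>R ?m x - integral k ?m)) < e / 3"
      using Henstock_lemma[of ?m a b, OF int(3)[folded box_real] e] by blast
    have "gauge (\<lambda>x. d1 x \<inter> d2 x \<inter> d3 x)" by (intro gauge_Int d1 d2 d3)
    from fine_division_exists_real[OF this, of a b] obtain p where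
      p: "p tagged_division_of {a..b}" and fine: "(\<lambda>x. d1 x \<inter> d2 x \<inter> d3 x) fine p" by blast
    have f: "d1 fine p" "d2 fine p" "d3 fine p" using fine by (auto simp: fine_def)
    have pp: "p tagged_partial_division_of cbox a b" using p by (simp add: tagged_division_of_def)
    \<comment> \<open>Distances from the fixed point \<open>\<phi> a\<close> have additive
      increments, so the sum over the division telescopes.\<close>
    have "dist (\<phi> a) (\<phi> b) = (\<Sum>(x,K)\<in>p. dist (\<phi> a) (\<phi> (Sup K)) - dist (\<phi> a) (\<phi> (Inf K)))"
      using additive_tagged_division_1[OF \<open>a \<le> b\<close> p, of "\<lambda>u. dist (\<phi> a) (\<phi> u)"] by simp
    \<comment> \<open>All three errors are charged on every piece, because which of \<open>g\<close>
      and \<open>h\<close> realises the minimum varies with the tag.\<close>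
    also have "\<dots> \<le> (\<Sum>(x,K)\<in>p. integral K ?m + (norm (measure lborel K *\<^sub>R g x - integral K g)
       + norm (measure lborel K *\<^sub>R h x - integral K h) + norm (measure lborel K *\<^sub>R ?m x - integral K ?m)))"
    proof (rule sum_mono, clarify)
      fix x K assume xK: "(x, K) \<in> p"
      obtain u v where K: "K = cbox u v" using tagged_division_ofD(4)[OF p xK] by blast
      have uv: "u \<le> v" "a \<le> u" "v \<le> b"
        using tagged_division_ofD(2,3)[OF p xK] unfolding K by auto
      have sub: "{u..v} \<subseteq> {a..b}" using uv by auto
      note i = set_borel_integral_eq_integral(2)[OF set_integrable_subset[OF g _ sub]]
         set_borel_integral_eq_integral(2)[OF set_integrable_subset[OF h _ sub]]
      have "dist (\<phi> u) (\<phi> v) \<le> integral {u..v} g \<and> dist (\<phi> u) (\<phi> v) \<le> integral {u..v} h"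
        using bg[of u v] bh[of u v] uv i by (cases "u = v") auto
      moreover have "dist (\<phi> a) (\<phi> v) - dist (\<phi> a) (\<phi> u) \<le> dist (\<phi> u) (\<phi> v)"
        using dist_triangle[of "\<phi> a" "\<phi> v" "\<phi> u"] by simp
      \<comment> \<open>If the minimum at the tag is \<open>g x\<close>, the increment is at most
        \<open>integral K g\<close>, and this lies within the errors of \<open>g\<close> and of
        \<open>?m\<close> from \<open>integral K ?m\<close>; likewise for \<open>h\<close>.\<close>
      moreover have "measure lborel K *\<^sub>R ?m x = measure lborel K *\<^sub>R g x \<or> measure lborel K *\<^sub>R ?m x = measure lborel K *\<^sub>R h x"
        by (simp add: min_def)
      ultimately show "dist (\<phi> a) (\<phi> (Sup K)) - dist (\<phi> a) (\<phi> (Inf K)) \<le>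
         integral K ?m + (norm (measure lborel K *\<^sub>R g x - integral K g)
       + norm (measure lborel K *\<^sub>R h x - integral K h) + norm (measure lborel K *\<^sub>R ?m x - integral K ?m))"
        using uv by (auto simp: K)
    qed
    also have "\<dots> = (\<Sum>(x,K)\<in>p. integral K ?m) + ((\<Sum>(x,K)\<in>p. norm (measure lborel K *\<^sub>R g x - integral K g))
       + (\<Sum>(x,K)\<in>p. norm (measure lborel K *\<^sub>R h x - integral K h))
       + (\<Sum>(x,K)\<in>p. norm (measure lborel K *\<^sub>R ?m x - integral K ?m)))"
      by (simp add: split_def sum.distrib)
    also have "\<dots> \<le> integral {a..b} ?m + (e / 3 + e / 3 + e / 3)"
      using integral_combine_tagged_division_topdown[of ?m a b p] int p
        d1(2)[OF pp f(1)] d2(2)[OF pp f(2)] d3(2)[OF pp f(3)] by simp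
    finally show ?thesis by simp
  qed
  then have "dist (\<phi> a) (\<phi> b) \<le> integral {a..b} ?m" by (rule field_le_epsilon)
  then show ?thesis by (simp add: set_borel_integral_eq_integral(2)[OF m])
qed

lemma speed_bound_min:
  assumes "speed_bound \<gamma> g" "speed_bound \<gamma> h"
  shows "speed_bound \<gamma> (\<lambda>r. min (g r) (h r))"
  unfolding speed_bound_def
proof (intro conjI allI impI)
  show "set_integrable lborel {0..1} (\<lambda>r. min (g r) (h r))"
    using assms unfolding speed_bound_def by (intro set_integrable_min) auto
next
  fix t s :: real assume ts: "0 \<le> t" "t < s" "s \<le> 1"
  then have sub: "{t..s} \<subseteq> {0..1}" by auto
  show "dist (\<gamma> t) (\<gamma> s) \<le> (LINT r:{t..s}|lborel. min (g r) (h r))"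
  proof (rule dist_le_integral_min)
    show "set_integrable lborel {t..s} g" "set_integrable lborel {t..s} h"
      using assms set_integrable_subset[OF _ _ sub, of lborel] unfolding speed_bound_def by auto
  qed (use ts assms in \<open>auto simp: speed_bound_def\<close>)
qed

text \<open>The increments of a constant curve are bounded by the integrals of \<open>g\<close> as
  well as of 0, so \<open>dist_le_integral_min\<close> gives a non-negative integral to
  \<open>min (g r) 0\<close>, a function that is nowhere positive.\<close>

lemma speed_bound_nonneg_AE:
  assumes "speed_bound \<gamma> g"
  shows "AE t in lborel. t \<in> {0..1} \<longrightarrow> 0 \<le> g t"
proof -
  have g: "set_integrable lborel {0..1} g" using assms by (simp add: speed_bound_def)
  have z: "set_integrable lborel {0..1} (\<lambda>_. 0 :: real)" by (simp add: set_integrable_def)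
  let ?f = "\<lambda>x. indicator {0..1} x *\<^sub>R min (g x) 0 :: real"
  have "dist (0::real) 0 \<le> (LINT r:{0..1}|lborel. min (g r) 0)"
  proof (rule dist_le_integral_min[OF g z, of "\<lambda>_. 0"])
    fix t s :: real assume "0 \<le> t" "t < s" "s \<le> 1"
    then show "dist (0::real) 0 \<le> (LINT r:{t..s}|lborel. g r)"
      using assms unfolding speed_bound_def by (metis dist_self order_trans zero_le_dist)
  qed (auto simp: set_lebesgue_integral_def)
  then have "0 \<le> (\<integral>x. ?f x \<partial>lborel)" by (simp add: set_lebesgue_integral_def)
  moreover have i: "integrable lborel (\<lambda>x. - ?f x)"
    using set_integrable_min[OF g z] by (simp add: set_integrable_def)
  ultimately have "(\<integral>x. - ?f x \<partial>lborel) = 0"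
    using Bochner_Integration.integral_nonneg[of lborel "\<lambda>x. - ?f x"] by (auto simp: indicator_def min_def split: if_splits)
  then have "AE x in lborel. - ?f x = 0"
    by (subst (asm) integral_nonneg_eq_0_iff_AE[OF i]) (auto simp: indicator_def)
  then show ?thesis by eventually_elim (auto simp: indicator_def min_def split: if_splits)
qed

text \<open>Running minima of a minimising sequence for the integral decrease to a speed bound of
  least integral. A competitor \<open>h\<close> cannot be smaller on a set of positive measure,
  since \<open>min (g r) (h r)\<close> is a speed bound too and would have a smaller
  integral.\<close>

lemma ex_minimal_speed:
  fixes \<gamma> :: "real \<Rightarrow> 'a::polish_space"
  assumes "speed_bound \<gamma> g0"
  shows "\<exists>g. speed_bound \<gamma> g \<and> (\<forall>h. speed_bound \<gamma> h \<longrightarrow> (AE t in lborel. t \<in> {0..1} \<longrightarrow> g t \<le> h t))"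
proof -
  let ?I = "\<lambda>g. (LINT r:{0..1}|lborel. g r) :: real"
  let ?X = "?I ` {g. speed_bound \<gamma> g}"
  have ge0: "0 \<le> ?I g" if "speed_bound \<gamma> g" for g
    using that unfolding speed_bound_def
    by (metis zero_less_one order_refl order_trans zero_le_dist)
  have bdd: "bdd_below ?X" by (rule bdd_belowI[of _ 0]) (use ge0 in auto)
  have ne: "?X \<noteq> {}" using assms by auto
  have "\<exists>g. speed_bound \<gamma> g \<and> ?I g < Inf ?X + 1 / real (Suc k)" for k
    using cInf_lessD[OF ne, of "Inf ?X + 1 / real (Suc k)"] by auto
  then obtain u where u: "\<And>k. speed_bound \<gamma> (u k)" "\<And>k. ?I (u k) < Inf ?X + 1 / real (Suc k)"
    by metis
  define G where "G = rec_nat (u 0) (\<lambda>k v r. min (v r) (u (Suc k) r))"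
  have G0: "G 0 = u 0" and GS: "G (Suc k) = (\<lambda>r. min (G k r) (u (Suc k) r))" for k
    by (simp_all add: G_def)
  have sb: "speed_bound \<gamma> (G k)" for k
    by (induction k) (simp_all add: G0 GS u speed_bound_min)
  then have int: "integrable lborel (\<lambda>x. indicator {0..1} x * G k x)" for k
    by (simp add: speed_bound_def set_integrable_def)
  have dec: "decseq (\<lambda>k. G k r)" for r
    by (rule decseq_SucI) (simp add: GS)
  have Gle: "G k r \<le> u k r" for k r by (cases k) (simp_all add: G0 GS)
  \<comment> \<open>The cut-off makes the limit 0 outside the unit interval. On the null set where
    the decreasing sequence may diverge, \<open>lim\<close> is an arbitrary value.\<close>
  define g where "g = (\<lambda>r. lim (\<lambda>k. indicator {0..1} r * G k r))"
  have gm: "g \<in> borel_measurable lborel"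
    unfolding g_def using int by (intro borel_measurable_lim_metric) auto
  have "AE r in lborel. \<forall>k. r \<in> {0..1} \<longrightarrow> 0 \<le> G k r"
    unfolding AE_all_countable using speed_bound_nonneg_AE[OF sb] by blast
  then have ae: "AE r in lborel. (\<forall>k. \<bar>indicator {0..1} r * G k r\<bar> \<le> \<bar>indicator {0..1} r * G 0 r\<bar>) \<and>
      (\<lambda>k. indicator {0..1} r * G k r) \<longlonglongrightarrow> g r \<and> (\<forall>k. r \<in> {0..1} \<longrightarrow> g r \<le> G k r)"
  proof eventually_elim
    case (elim r)
    show ?case
    proof (cases "r \<in> {0..1}")
      case True
      have "\<And>k. 0 \<le> G k r" using elim True by blast
      then have "convergent (\<lambda>k. G k r)"
        using decseq_convergent[OF dec[of r], of 0] by (metis convergentI)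
      then have l: "(\<lambda>k. G k r) \<longlonglongrightarrow> g r" using True by (simp add: g_def convergent_LIMSEQ_iff)
      then show ?thesis
        using True elim dec[of r] decseq_ge[OF dec l] by (auto simp: decseq_def)
    qed (auto simp: g_def)
  qed
  have lim: "(\<lambda>k. \<integral>r. indicator A r * (indicator {0..1} r * G k r) \<partial>lborel) \<longlonglongrightarrow> (\<integral>r. indicator A r * g r \<partial>lborel)"
    and gi: "integrable lborel (\<lambda>r. indicator A r * g r)" if [measurable]: "A \<in> sets borel" for A
  proof -
    have *: "(\<lambda>r. indicator A r * g r) \<in> borel_measurable lborel"
       "\<And>k. (\<lambda>r. indicator A r * (indicator {0..1} r * G k r)) \<in> borel_measurable lborel"
       "integrable lborel (\<lambda>r. \<bar>indicator {0..1} r * G 0 r\<bar>)"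
       "AE r in lborel. (\<lambda>k. indicator A r * (indicator {0..1} r * G k r)) \<longlonglongrightarrow> indicator A r * g r"
       "\<And>k. AE r in lborel. norm (indicator A r * (indicator {0..1} r * G k r)) \<le> \<bar>indicator {0..1} r * G 0 r\<bar>"
    proof -
      show "AE r in lborel. (\<lambda>k. indicator A r * (indicator {0..1} r * G k r)) \<longlonglongrightarrow> indicator A r * g r"
        using ae by eventually_elim (auto intro!: tendsto_intros)
      show "AE r in lborel. norm (indicator A r * (indicator {0..1} r * G k r)) \<le> \<bar>indicator {0..1} r * G 0 r\<bar>" for k
        using ae by eventually_elim (auto simp: abs_mult split: split_indicator)
    qed (use gm int in \<open>auto intro: integrable_abs borel_measurable_times borel_measurable_integrable\<close>)
    show "(\<lambda>k. \<integral>r. indicator A r * (indicator {0..1} r * G k r) \<partial>lborel) \<longlonglongrightarrow> (\<integral>r. indicator A r * g r \<partial>lborel)"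
      by (rule integral_dominated_convergence[OF *])
    show "integrable lborel (\<lambda>r. indicator A r * g r)"
      by (rule integrable_dominated_convergence[OF *])
  qed
  have mult: "indicator {t..s} r * (indicator {0..1} r * x) = indicator {t..s} r * x"
    if "0 \<le> t" "s \<le> 1" for t s r x :: real
    using that by (auto simp: indicator_def)
  have lim': "(\<lambda>k. LINT r:{t..s}|lborel. G k r) \<longlonglongrightarrow> (LINT r:{t..s}|lborel. g r)" if "0 \<le> t" "s \<le> 1" for t s
    using lim[of "{t..s}"] that by (simp add: mult set_lebesgue_integral_def)
  have sg: "speed_bound \<gamma> g"
    unfolding speed_bound_def
  proof (intro conjI allI impI)
    show "set_integrable lborel {0..1} g" using gi[of "{0..1}"] by (simp add: set_integrable_def)
  next
    fix t s :: real assume ts: "0 \<le> t" "t < s" "s \<le> 1"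
    show "dist (\<gamma> t) (\<gamma> s) \<le> (LINT r:{t..s}|lborel. g r)"
      by (rule LIMSEQ_le_const[OF lim'[OF ts(1,3)]]) (use sb ts in \<open>auto simp: speed_bound_def\<close>)
  qed
  have "?I g \<le> Inf ?X"
  proof (rule LIMSEQ_le)
    show "(\<lambda>k. ?I (G k)) \<longlonglongrightarrow> ?I g" by (rule lim') auto
    show "(\<lambda>k. Inf ?X + 1 / real (Suc k)) \<longlonglongrightarrow> Inf ?X"
      using tendsto_add[OF tendsto_const LIMSEQ_inverse_real_of_nat] by (simp add: inverse_eq_divide)
    have "?I (G k) \<le> ?I (u k)" for k
      unfolding set_lebesgue_integral_def
      by (rule integral_mono) (use sb[of k] u(1)[of k] Gle in \<open>auto simp: speed_bound_def set_integrable_def split: split_indicator\<close>)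
    then show "\<exists>N. \<forall>k\<ge>N. ?I (G k) \<le> Inf ?X + 1 / real (Suc k)"
      using u(2) by (meson less_imp_le order_trans)
  qed
  have "AE t in lborel. t \<in> {0..1} \<longrightarrow> g t \<le> h t" if h: "speed_bound \<gamma> h" for h
  proof -
    note m = speed_bound_min[OF sg h]
    have i: "integrable lborel (\<lambda>x. indicator {0..1} x * g x)"
        "integrable lborel (\<lambda>x. indicator {0..1} x * min (g x) (h x))"
      using sg m by (simp_all add: speed_bound_def set_integrable_def)
    let ?f = "\<lambda>x. indicator {0..1} x * g x - indicator {0..1} x * min (g x) (h x)"
    have if': "integrable lborel ?f" using i by (rule Bochner_Integration.integrable_diff)
    have pos: "0 \<le> ?f x" for x by (auto split: split_indicator)
    \<comment> \<open>Least integral meets the opposite pointwise inequality: the non-negative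
      difference integrates to 0 and so vanishes a.e.\<close>
    have "?I g \<le> ?I (\<lambda>r. min (g r) (h r))"
      using \<open>?I g \<le> Inf ?X\<close> cInf_lower[OF _ bdd, of "?I (\<lambda>r. min (g r) (h r))"] m by force
    then have "(\<integral>x. ?f x \<partial>lborel) \<le> 0"
      using i by (simp add: set_lebesgue_integral_def)
    moreover have "0 \<le> (\<integral>x. ?f x \<partial>lborel)" by (rule Bochner_Integration.integral_nonneg) (rule pos)
    ultimately have "(\<integral>x. ?f x \<partial>lborel) = 0" by linarith
    then have "AE x in lborel. ?f x = 0"
      by (subst (asm) integral_nonneg_eq_0_iff_AE[OF if']) (use pos in auto)
    then show ?thesis by eventually_elim (auto simp: indicator_def min_def split: if_splits)
  qed
  with sg show ?thesis by blast
qed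

lemma metric_speed:
  assumes "abs_cont_curve \<gamma>"
  shows speed_bound_metric_speed: "speed_bound \<gamma> (metric_speed \<gamma>)"
    and metric_speed_le: "speed_bound \<gamma> h \<Longrightarrow> AE t in lborel. t \<in> {0..1} \<longrightarrow> metric_speed \<gamma> t \<le> h t"
proof -
  obtain g0 where "speed_bound \<gamma> g0" using assms by (auto simp: abs_cont_curve_def)
  from someI_ex[OF ex_minimal_speed[OF this], folded metric_speed_def]
  show "speed_bound \<gamma> (metric_speed \<gamma>)"
    "speed_bound \<gamma> h \<Longrightarrow> AE t in lborel. t \<in> {0..1} \<longrightarrow> metric_speed \<gamma> t \<le> h t" by blast+
qed

lemma indicator_L2:
  assumes "A \<in> sets M" "emeasure M A < \<infinity>"
  shows "(indicator A :: _ \<Rightarrow> real) \<in> L2 M"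
proof -
  have "(\<lambda>x. (indicator A x :: real)\<^sup>2) = indicator A" by (auto simp: indicator_def)
  then show ?thesis using assms by (simp add: L2_def)
qed

section \<open>Dyadic difference quotients and their limit, the metric speed\<close>

definition dyadic_length :: "(real \<Rightarrow> 'a::metric_space) \<Rightarrow> nat \<Rightarrow> nat \<Rightarrow> real" where
  "dyadic_length \<gamma> n k = dist (\<gamma> (real k / 2^n)) (\<gamma> (real (Suc k) / 2^n))"

abbreviation dyadic_interval :: "nat \<Rightarrow> nat \<Rightarrow> real set" where
  "dyadic_interval n k \<equiv> {real k / 2^n..<real (Suc k) / 2^n}"

text \<open>The half-open intervals are disjoint, so at most one summand is non-zero; the value is 0
  at time 1 and outside the unit interval.\<close>

definition dyadic_speed :: "(real \<Rightarrow> 'a::metric_space) \<Rightarrow> nat \<Rightarrow> real \<Rightarrow> real" where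
  "dyadic_speed \<gamma> n t = (\<Sum>k<2^n. 2^n * dyadic_length \<gamma> n k * indicator (dyadic_interval n k) t)"

lemma dyadic_interval_unique:
  assumes "t \<in> dyadic_interval n k" "t \<in> dyadic_interval n j"
  shows "k = j"
proof -
  have *: "i < l" if "real i / 2^n < real l / 2^n" for i l
    using that by (metis divide_right_mono leD of_nat_le_iff not_le zero_le_numeral zero_le_power)
  have "k < Suc j" "j < Suc k"
    using assms by (auto intro!: * elim: le_less_trans)
  then show ?thesis by simp
qed

lemma dyadic_speed_on:
  assumes "k < 2^n" "t \<in> dyadic_interval n k"
  shows "dyadic_speed \<gamma> n t = 2^n * dyadic_length \<gamma> n k"
proof -
  have "dyadic_speed \<gamma> n t = (\<Sum>j<2^n. if j = k then 2^n * dyadic_length \<gamma> n k else 0)"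
    unfolding dyadic_speed_def
  proof (intro sum.cong refl)
    fix j
    have "indicator (dyadic_interval n j) t = (if j = k then 1 else 0 :: real)"
    proof (cases "j = k")
        case False
        then have *: "t \<notin> dyadic_interval n j" using dyadic_interval_unique[OF assms(2)] by blast
        then show ?thesis using False by (simp only: indicator_simps(2)[OF *] if_False)
      qed (use assms(2) in \<open>simp only: indicator_simps simp_thms if_True\<close>)
    then show "2^n * dyadic_length \<gamma> n j * indicator (dyadic_interval n j) t
       = (if j = k then 2^n * dyadic_length \<gamma> n k else 0)" by simp
  qed
  then show ?thesis using assms by simp
qed

lemma dyadic_length_nonneg [simp]: "0 \<le> dyadic_length \<gamma> n k"
  by (simp add: dyadic_length_def)

lemma dyadic_speed_nonneg [simp]: "0 \<le> dyadic_speed \<gamma> n t"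
  by (auto simp: dyadic_speed_def intro!: sum_nonneg)

lemma dyadic_interval_subset: "k < 2^n \<Longrightarrow> dyadic_interval n k \<subseteq> {0..1}"
proof -
  assume "k < 2^n"
  then have "Suc k \<le> 2^n" by simp
  then have "real (Suc k) \<le> 2^n" using of_nat_le_iff[of "Suc k" "2^n", where 'a=real] by simp
  then have "real (Suc k) / 2^n \<le> 1" by (simp add: divide_le_eq)
  moreover have "0 \<le> real k / 2^n" by simp
  ultimately show ?thesis
    by (intro subsetI) (simp only: atLeastLessThan_iff atLeastAtMost_iff, linarith)
qed

lemma dyadic_speed_eq_0: "t \<notin> {0..1} \<Longrightarrow> dyadic_speed \<gamma> n t = 0"
  unfolding dyadic_speed_def using dyadic_interval_subset
  by (intro sum.neutral) (fastforce split: split_indicator)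

lemma dyadic_speed_measurable [measurable]: "dyadic_speed \<gamma> n \<in> borel_measurable borel"
  unfolding dyadic_speed_def by measurable

lemma dyadic_speed_L2: "dyadic_speed \<gamma> n \<in> L2 lborel"
proof -
  let ?B = "\<Sum>k<2^n. 2^n * dyadic_length \<gamma> n k"
  have i: "(\<lambda>t. ?B * indicator {0..1::real} t) \<in> L2 lborel"
    by (intro L2_cmult indicator_L2) auto
  have "\<bar>dyadic_speed \<gamma> n t\<bar> \<le> \<bar>?B * indicator {0..1} t\<bar>" for t
  proof (cases "t \<in> {0..1}")
    case True
    have "dyadic_speed \<gamma> n t \<le> ?B"
      unfolding dyadic_speed_def by (intro sum_mono mult_left_le) (auto split: split_indicator)
    then show ?thesis using True by auto
  qed (simp add: dyadic_speed_eq_0)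
  then show ?thesis by (intro L2_bound[OF i]) auto
qed

lemma L2_set_integrable:
  assumes "h \<in> L2 M" "A \<in> sets M" "emeasure M A < \<infinity>"
  shows "set_integrable M A h"
  using L2_mult_integrable[OF indicator_L2[OF assms(2,3)] assms(1)] by (simp add: set_integrable_def)

lemma set_integral_dyadic_speed:
  assumes "b \<le> 2^n" "a \<le> b"
  shows "(LINT t:{real a / 2^n..<real b / 2^n}|lborel. dyadic_speed \<gamma> n t) = (\<Sum>k\<in>{a..<b}. dyadic_length \<gamma> n k)"
  using assms
proof (induction b)
  case 0
  then show ?case by (simp add: set_lebesgue_integral_def)
next
  case (Suc b)
  have one: "(LINT t:dyadic_interval n b|lborel. dyadic_speed \<gamma> n t) = dyadic_length \<gamma> n b"
  proof -
    have "(LINT t:dyadic_interval n b|lborel. dyadic_speed \<gamma> n t)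
        = (LINT t:dyadic_interval n b|lborel. 2^n * dyadic_length \<gamma> n b)"
      by (rule set_lebesgue_integral_cong) (use Suc.prems dyadic_speed_on[of b n] in auto)
    also have "\<dots> = dyadic_length \<gamma> n b"
      by (simp add: set_lebesgue_integral_def measure_def divide_right_mono add_divide_distrib)
    finally show ?thesis .
  qed
  show ?case
  proof (cases "a = Suc b")
    case True
    then show ?thesis by (simp add: set_lebesgue_integral_def)
  next
    case False
    then have ab: "a \<le> b" using Suc.prems by simp
    have le: "real a / 2^n \<le> real b / 2^n" "real b / 2^n \<le> real (Suc b) / 2^n"
      using ab by (simp_all add: divide_right_mono)
    have "{real a / 2^n..<real (Suc b) / 2^n} = {real a / 2^n..<real b / 2^n} \<union> dyadic_interval n b"
      using le by auto
    then have "(LINT t:{real a / 2^n..<real (Suc b) / 2^n}|lborel. dyadic_speed \<gamma> n t)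
      = (LINT t:{real a / 2^n..<real b / 2^n}|lborel. dyadic_speed \<gamma> n t)
       + (LINT t:dyadic_interval n b|lborel. dyadic_speed \<gamma> n t)"
      using le by (simp only:) (intro set_integral_Un L2_set_integrable dyadic_speed_L2, auto)
    then show ?thesis using Suc ab one by simp
  qed
qed

lemma dist_le_sum_dyadic_length:
  assumes "a \<le> b"
  shows "dist (\<gamma> (real a / 2^n)) (\<gamma> (real b / 2^n)) \<le> (\<Sum>k\<in>{a..<b}. dyadic_length \<gamma> n k)"
  using assms
proof (induction b rule: dec_induct)
  case (step b)
  have "dist (\<gamma> (real a / 2^n)) (\<gamma> (real (Suc b) / 2^n))
     \<le> dist (\<gamma> (real a / 2^n)) (\<gamma> (real b / 2^n)) + dyadic_length \<gamma> n b"
    unfolding dyadic_length_def by (rule dist_triangle)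
  then show ?case using step by simp
qed simp

text \<open>A point of level \<open>n\<close> is also a point of level \<open>m\<close>, so the
  finer step function dominates the coarser increments. Hence every later dyadic speed, and every
  limit of them, obeys the constraints of level \<open>n\<close>.\<close>

lemma dist_le_integral_dyadic_speed:
  assumes "b \<le> 2^n" "a \<le> b" "n \<le> m"
  shows "dist (\<gamma> (real a / 2^n)) (\<gamma> (real b / 2^n)) \<le> (LINT t:{real a / 2^n..<real b / 2^n}|lborel. dyadic_speed \<gamma> m t)"
proof -
  have *: "real c / 2^n = real (c * 2^(m - n)) / 2^m" for c
  proof -
    have "(2::real)^m = 2^n * 2^(m - n)" using assms(3) by (simp flip: power_add)
    then show ?thesis by simp
  qed
  have "b * 2^(m - n) \<le> 2^n * 2^(m - n)" using assms(1) by (rule mult_le_mono1)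
  also have "\<dots> = 2^m" using assms(3) by (simp flip: power_add)
  finally have "b * 2^(m - n) \<le> 2^m" .
  moreover have "a * 2^(m - n) \<le> b * 2^(m - n)" using assms(2) by simp
  ultimately show ?thesis
    unfolding * by (simp only: set_integral_dyadic_speed dist_le_sum_dyadic_length)
qed

text \<open>The dyadic speed is the \<open>L\<^sup>2\<close>-projection of \<open>0\<close> onto the convex set of all functions whose integrals
  over the dyadic intervals dominate the increments.\<close>

lemma dyadic_speed_pythagoras:
  assumes h: "h \<in> L2 lborel"
    and le: "\<And>k. k < 2^n \<Longrightarrow> dyadic_length \<gamma> n k \<le> (LINT t:dyadic_interval n k|lborel. h t)"
  shows "(l2norm lborel (\<lambda>t. h t - dyadic_speed \<gamma> n t))\<^sup>2 \<le> (l2norm lborel h)\<^sup>2 - (l2norm lborel (dyadic_speed \<gamma> n))\<^sup>2"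
proof -
  let ?g = "dyadic_speed \<gamma> n"
  note g = dyadic_speed_L2[of \<gamma> n]
  \<comment> \<open>Pairing with the step function sees only the integrals over the dyadic
    intervals.\<close>
  have eq: "(\<integral>t. ?g t * u t \<partial>lborel) = (\<Sum>k<2^n. 2^n * dyadic_length \<gamma> n k * (LINT t:dyadic_interval n k|lborel. u t))"
    if u: "u \<in> L2 lborel" for u
  proof -
    have "(\<integral>t. ?g t * u t \<partial>lborel) = (\<integral>t. (\<Sum>k<2^n. 2^n * dyadic_length \<gamma> n k * (indicator (dyadic_interval n k) t *\<^sub>R u t)) \<partial>lborel)"
      unfolding dyadic_speed_def by (simp add: sum_distrib_right mult.assoc)
    also have "\<dots> = (\<Sum>k<2^n. \<integral>t. 2^n * dyadic_length \<gamma> n k * (indicator (dyadic_interval n k) t *\<^sub>R u t) \<partial>lborel)"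
    proof (rule Bochner_Integration.integral_sum)
      fix k
      have "emeasure lborel (dyadic_interval n k) < \<infinity>"
        by (simp add: divide_right_mono)
      then have "set_integrable lborel (dyadic_interval n k) u" by (intro L2_set_integrable u) auto
      then show "integrable lborel (\<lambda>t. 2^n * dyadic_length \<gamma> n k * (indicator (dyadic_interval n k) t *\<^sub>R u t))"
        unfolding set_integrable_def by (rule integrable_mult_right)
    qed
    finally show ?thesis by (simp add: set_lebesgue_integral_def)
  qed
  \<comment> \<open>The variational inequality of the projection: the coefficients are non-negative,
    and on each interval \<open>h\<close> has at least the integral of \<open>?g\<close>.\<close>
  have "(\<integral>t. ?g t * ?g t \<partial>lborel) \<le> (\<integral>t. ?g t * h t \<partial>lborel)"
    unfolding eq[OF g] eq[OF h]
  proof (intro sum_mono mult_left_mono)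
    fix k assume "k \<in> {..<2^n :: nat}"
    then have "k < 2^n" by simp
    then show "(LINT t:dyadic_interval n k|lborel. ?g t) \<le> (LINT t:dyadic_interval n k|lborel. h t)"
      using le[of k] set_integral_dyadic_speed[of "Suc k" n k \<gamma>] by simp
  qed simp
  moreover have "(l2norm lborel (\<lambda>t. h t - ?g t))\<^sup>2
      = (\<integral>t. (h t)\<^sup>2 + (?g t)\<^sup>2 - 2 * (?g t * h t) \<partial>lborel)"
    unfolding l2norm_power2 by (intro Bochner_Integration.integral_cong) (auto simp: power2_diff)
  moreover have "\<dots> = (l2norm lborel h)\<^sup>2 + (l2norm lborel ?g)\<^sup>2 - 2 * (\<integral>t. ?g t * h t \<partial>lborel)"
    using L2_mult_integrable[OF g h] L2_square_integrable[OF g] L2_square_integrable[OF h] by (simp add: l2norm_power2)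
  moreover have "(\<integral>t. ?g t * ?g t \<partial>lborel) = (l2norm lborel ?g)\<^sup>2"
    unfolding l2norm_power2 by (simp add: power2_eq_square)
  ultimately show ?thesis by linarith
qed

text \<open>The finer step function is a competitor in the projection at the coarser level.\<close>

lemma dyadic_speed_cauchy_estimate:
  assumes "n \<le> m"
  shows "(l2norm lborel (\<lambda>t. dyadic_speed \<gamma> m t - dyadic_speed \<gamma> n t))\<^sup>2
    \<le> (l2norm lborel (dyadic_speed \<gamma> m))\<^sup>2 - (l2norm lborel (dyadic_speed \<gamma> n))\<^sup>2"
proof (rule dyadic_speed_pythagoras[OF dyadic_speed_L2])
  fix k :: nat assume "k < 2^n"
  then show "dyadic_length \<gamma> n k \<le> (LINT t:dyadic_interval n k|lborel. dyadic_speed \<gamma> m t)"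
    using dist_le_integral_dyadic_speed[of "Suc k" n k m \<gamma>] assms by (simp add: dyadic_length_def)
qed

lemma dyadic_energy_mono:
  assumes "n \<le> m"
  shows "(l2norm lborel (dyadic_speed \<gamma> n))\<^sup>2 \<le> (l2norm lborel (dyadic_speed \<gamma> m))\<^sup>2"
  using dyadic_speed_cauchy_estimate[OF assms, of \<gamma>]
  by (smt (verit) zero_le_power2)

lemma dyadic_floor_tendsto: "(\<lambda>n. real_of_int \<lfloor>2^n * u\<rfloor> / 2^n) \<longlonglongrightarrow> u"
proof (rule tendsto_sandwich[OF _ _ _ tendsto_const])
  have "(\<lambda>n. u - (1/2)^n) \<longlonglongrightarrow> u - 0" by (intro tendsto_intros LIMSEQ_realpow_zero) auto
  then show "(\<lambda>n. u - (1/2)^n) \<longlonglongrightarrow> u" by simp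
  have *: "u - (1/2)^i \<le> real_of_int \<lfloor>2^i * u\<rfloor> / 2^i" "real_of_int \<lfloor>2^i * u\<rfloor> / 2^i \<le> u" for i
  proof -
    have "real_of_int \<lfloor>2^i * u\<rfloor> \<le> 2^i * u" "2^i * u \<le> real_of_int \<lfloor>2^i * u\<rfloor> + 1" by linarith+
    then have "u \<le> (real_of_int \<lfloor>2^i * u\<rfloor> + 1) / 2^i" "real_of_int \<lfloor>2^i * u\<rfloor> / 2^i \<le> u"
      by (simp_all add: le_divide_eq divide_le_eq mult.commute)
    then show "u - (1/2)^i \<le> real_of_int \<lfloor>2^i * u\<rfloor> / 2^i" "real_of_int \<lfloor>2^i * u\<rfloor> / 2^i \<le> u"
      by (simp_all add: add_divide_distrib power_divide)
  qed
  show "\<forall>\<^sub>F n in sequentially. u - (1/2)^n \<le> real_of_int \<lfloor>2^n * u\<rfloor> / 2^n"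
    "\<forall>\<^sub>F n in sequentially. real_of_int \<lfloor>2^n * u\<rfloor> / 2^n \<le> u"
    using * by (auto intro!: always_eventually)
qed

text \<open>The dyadic floors of \<open>t\<close> and \<open>s\<close> approach them from below;
  continuity of the curve handles the distances and dominated convergence the integrals.\<close>

lemma dist_le_integral_of_dyadic:
  fixes \<gamma> :: "real \<Rightarrow> 'a::metric_space"
  assumes cont: "continuous_on {0..1} \<gamma>" and h: "set_integrable lborel {0..1} h"
    and le: "\<And>n a b. a \<le> b \<Longrightarrow> b \<le> 2^n \<Longrightarrow>
      dist (\<gamma> (real a / 2^n)) (\<gamma> (real b / 2^n)) \<le> (LINT r:{real a / 2^n..<real b / 2^n}|lborel. h r)"
    and ts: "0 \<le> t" "t < s" "s \<le> 1"
  shows "dist (\<gamma> t) (\<gamma> s) \<le> (LINT r:{t..s}|lborel. h r)"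
proof -
  define d where "d = (\<lambda>(u::real) n. real (nat \<lfloor>2^n * u\<rfloor>) / 2^n)"
  have d: "d u n \<le> u" "0 \<le> d u n" if "0 \<le> u" for u n
  proof -
    have r: "real (nat \<lfloor>2^n * u\<rfloor>) = of_int \<lfloor>2^n * u\<rfloor>" using that by simp
    have "of_int \<lfloor>2^n * u\<rfloor> \<le> 2^n * u" by linarith
    then show "d u n \<le> u" unfolding d_def r by (simp add: divide_le_eq mult.commute)
    show "0 \<le> d u n" by (simp add: d_def)
  qed
  have lim: "(\<lambda>n. d u n) \<longlonglongrightarrow> u" if "0 \<le> u" for u
    using dyadic_floor_tendsto[of u] that by (simp add: d_def)
  have d1: "d u n \<in> {0..1}" if "0 \<le> u" "u \<le> 1" for u n using d[OF that(1), of n] that by auto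
  have gl: "(\<lambda>n. \<gamma> (d u n)) \<longlonglongrightarrow> \<gamma> u" if "0 \<le> u" "u \<le> 1" for u
    using cont lim[OF that(1)] d1[OF that] that
    by (intro continuous_on_tendsto_compose[OF cont]) auto
  have "(\<lambda>n. LINT r:{d t n..<d s n}|lborel. h r) \<longlonglongrightarrow> (LINT r:{t..s}|lborel. h r)"
    unfolding set_lebesgue_integral_def
  proof (rule integral_dominated_convergence[where w="\<lambda>r. \<bar>indicator {0..1} r * h r\<bar>"])
    have *: "(\<lambda>r. indicator A r *\<^sub>R h r) \<in> borel_measurable lborel" if "A \<subseteq> {0..1}" "A \<in> sets borel" for A
      using set_integrable_subset[OF h, of A] that by (auto simp: set_integrable_def dest: borel_measurable_integrable)
    show "(\<lambda>r. indicator {t..s} r *\<^sub>R h r) \<in> borel_measurable lborel" using ts by (intro *) auto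
    have sub: "{d t n..<d s n} \<subseteq> {0..1}" for n using d1[of t n] d1[of s n] ts by fastforce
    then show "(\<lambda>r. indicator {d t n..<d s n} r *\<^sub>R h r) \<in> borel_measurable lborel" for n by (intro *) auto
    show "integrable lborel (\<lambda>r. \<bar>indicator {0..1} r * h r\<bar>)"
      using h by (auto simp: set_integrable_def)
    show "AE r in lborel. norm (indicator {d t n..<d s n} r *\<^sub>R h r) \<le> \<bar>indicator {0..1} r * h r\<bar>" for n
      using sub[of n] by (intro AE_I2) (auto simp: abs_mult split: split_indicator)
    \<comment> \<open>The right end is truly exceptional: \<open>s\<close> belongs to the closed
      interval but, the floors being at most \<open>s\<close>, to none of the half-open
      ones.\<close>
    have ae: "AE r in lborel. r \<noteq> t \<and> r \<noteq> s" using AE_lborel_singleton[of t] AE_lborel_singleton[of s] by auto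
    show "AE r in lborel. (\<lambda>n. indicator {d t n..<d s n} r *\<^sub>R h r) \<longlonglongrightarrow> indicator {t..s} r *\<^sub>R h r"
      using ae
    proof eventually_elim
      case (elim r)
      have "eventually (\<lambda>n. indicator {d t n..<d s n} r = (indicator {t..s} r :: real)) sequentially"
      proof (cases "r < t")
        case True
        then have "eventually (\<lambda>n. r < d t n) sequentially" using lim[of t] ts by (intro order_tendstoD) auto
        then show ?thesis by eventually_elim (use True in auto)
      next
        case False
        show ?thesis
        proof (cases "r < s")
          case True
          then have ev: "eventually (\<lambda>n. r < d s n) sequentially" using lim[of s] ts by (intro order_tendstoD) auto
          have dr: "\<And>n. d t n \<le> r" using d(1)[of t] False ts by (meson not_le order_trans)
          from ev show ?thesis
            by eventually_elim (use True False dr in \<open>auto simp: indicator_def\<close>)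
        next
          case F: False
          have "d s n \<le> r" for n using d(1)[of s n] F ts by auto
          then show ?thesis using F False elim by (intro always_eventually) (auto simp: indicator_def not_less)
        qed
      qed
      then show ?case by (intro tendsto_eventually) (auto elim: eventually_mono)
    qed
  qed
  moreover have "(\<lambda>n. dist (\<gamma> (d t n)) (\<gamma> (d s n))) \<longlonglongrightarrow> dist (\<gamma> t) (\<gamma> s)"
    using ts by (intro tendsto_dist gl) auto
  moreover have "dist (\<gamma> (d t n)) (\<gamma> (d s n)) \<le> (LINT r:{d t n..<d s n}|lborel. h r)" for n
    unfolding d_def
  proof (rule le)
    show "nat \<lfloor>2^n * t\<rfloor> \<le> nat \<lfloor>2^n * s\<rfloor>" using ts by (intro nat_mono floor_mono mult_left_mono) auto
    have "\<lfloor>2^n * s\<rfloor> \<le> \<lfloor>2^n * 1 :: real\<rfloor>" using ts by (intro floor_mono mult_left_mono) auto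
    also have "\<dots> = 2^n" by (simp add: floor_eq_iff)
    finally show "nat \<lfloor>2^n * s\<rfloor> \<le> 2^n" by (simp add: nat_le_iff)
  qed
  ultimately show ?thesis by (intro LIMSEQ_le) auto
qed

abbreviation dyadic_energy :: "(real \<Rightarrow> 'a::metric_space) \<Rightarrow> nat \<Rightarrow> real" where
  "dyadic_energy \<gamma> n \<equiv> (l2norm lborel (dyadic_speed \<gamma> n))\<^sup>2"

text \<open>Cauchy-Schwarz against the indicator of \<open>A\<close>.\<close>

lemma set_integral_L2_tendsto:
  assumes g: "\<And>n. g n \<in> L2 M" "h \<in> L2 M" and lim: "(\<lambda>n. l2norm M (\<lambda>t. g n t - h t)) \<longlonglongrightarrow> 0"
    and A: "A \<in> sets M" "emeasure M A < \<infinity>"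
  shows "(\<lambda>n. LINT t:A|M. g n t) \<longlonglongrightarrow> (LINT t:A|M. h t)"
proof -
  have est: "\<bar>(LINT t:A|M. g n t) - (LINT t:A|M. h t)\<bar> \<le> l2norm M (indicator A) * l2norm M (\<lambda>t. g n t - h t)" for n
  proof -
    have "(LINT t:A|M. g n t) - (LINT t:A|M. h t) = (\<integral>t. indicator A t * (g n t - h t) \<partial>M)"
      using L2_set_integrable[OF g(1)[of n] A] L2_set_integrable[OF g(2) A]
      by (simp add: set_lebesgue_integral_def set_integrable_def right_diff_distrib)
    then show ?thesis
      using l2_Cauchy_Schwarz[OF indicator_L2[OF A] L2_diff[OF g(1)[of n] g(2)]] by simp
  qed
  have "(\<lambda>n. l2norm M (indicator A) * l2norm M (\<lambda>t. g n t - h t)) \<longlonglongrightarrow> l2norm M (indicator A) * 0"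
    by (intro tendsto_intros lim)
  then have z: "(\<lambda>n. l2norm M (indicator A) * l2norm M (\<lambda>t. g n t - h t)) \<longlonglongrightarrow> 0" by simp
  have "(\<lambda>n. (LINT t:A|M. g n t) - (LINT t:A|M. h t)) \<longlonglongrightarrow> 0"
    by (rule Lim_null_comparison[OF _ z], rule always_eventually) (simp only: est real_norm_def simp_thms)
  then show ?thesis by (simp add: LIM_zero_iff)
qed

lemma l2norm_tendsto:
  assumes "\<And>n. g n \<in> L2 M" "h \<in> L2 M" "(\<lambda>n. l2norm M (\<lambda>t. g n t - h t)) \<longlonglongrightarrow> 0"
  shows "(\<lambda>n. l2norm M (g n)) \<longlonglongrightarrow> l2norm M h"
proof -
  have "(\<lambda>n. l2norm M (g n) - l2norm M h) \<longlonglongrightarrow> 0"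
  proof (rule Lim_null_comparison[OF _ assms(3)], rule always_eventually, rule allI)
    fix n
    show "norm (l2norm M (g n) - l2norm M h) \<le> l2norm M (\<lambda>t. g n t - h t)"
      using l2norm_triangle_diff[OF assms(1,2), of n] l2norm_triangle_diff[OF assms(2,1), of n]
      by (simp add: abs_le_iff l2norm_minus_commute[of M h])
  qed
  then show ?thesis by (simp add: LIM_zero_iff)
qed

text \<open>The constraints at dyadic times are integrals over sets of finite measure and survive
  the limit in \<open>L2\<close>; continuity of the curve extends them to all times.\<close>

lemma speed_bound_of_dyadic_energy:
  fixes \<gamma> :: "real \<Rightarrow> 'a::polish_space"
  assumes cont: "continuous_on {0..1} \<gamma>" and K: "\<And>n. dyadic_energy \<gamma> n \<le> K"
  obtains h where "h \<in> L2 lborel" "(\<lambda>n. l2norm lborel (\<lambda>t. dyadic_speed \<gamma> n t - h t)) \<longlonglongrightarrow> 0" "speed_bound \<gamma> h"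
proof -
  let ?g = "dyadic_speed \<gamma>"
  obtain h where h: "h \<in> L2 lborel" "(\<lambda>n. l2norm lborel (\<lambda>t. ?g n t - h t)) \<longlonglongrightarrow> 0"
    by (rule L2_limit_of_monotone_energy[OF dyadic_speed_L2 dyadic_speed_cauchy_estimate K])
  have "speed_bound \<gamma> h" unfolding speed_bound_def
  proof (intro conjI allI impI)
    show i: "set_integrable lborel {0..1} h" by (rule L2_set_integrable[OF h(1)]) auto
    fix t s :: real assume "0 \<le> t" "t < s" "s \<le> 1"
    then show "dist (\<gamma> t) (\<gamma> s) \<le> (LINT r:{t..s}|lborel. h r)"
    proof (rule dist_le_integral_of_dyadic[OF cont i, rotated])
      fix n a b :: nat assume ab: "a \<le> b" "b \<le> 2^n"
      let ?A = "{real a / 2^n..<real b / 2^n}"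
      have "(\<lambda>m. LINT t:?A|lborel. ?g m t) \<longlonglongrightarrow> (LINT t:?A|lborel. h t)"
        by (rule set_integral_L2_tendsto[OF dyadic_speed_L2 h]) (use ab in \<open>auto simp: divide_right_mono\<close>)
      then show "dist (\<gamma> (real a / 2^n)) (\<gamma> (real b / 2^n)) \<le> (LINT r:?A|lborel. h r)"
        by (rule LIMSEQ_le_const) (use dist_le_integral_dyadic_speed[OF ab(2,1)] in blast)
    qed
  qed
  with h show thesis by (rule that)
qed

text \<open>A speed bound is known to be measurable only on the unit interval, hence the cut-off,
  which makes it a competitor for the projection on the whole line.\<close>

lemma dyadic_length_le_integral:
  assumes "speed_bound \<gamma> g" "k < 2^n"
  shows "dyadic_length \<gamma> n k \<le> (LINT t:dyadic_interval n k|lborel. indicator {0..1} t * g t)"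
proof -
  have le: "0 \<le> real k / 2^n" "real k / 2^n < real (Suc k) / 2^n" "real (Suc k) / 2^n \<le> 1"
  proof -
    have "Suc k \<le> 2^n" using assms(2) by simp
    then have "real (Suc k) \<le> 2^n" using of_nat_le_iff[of "Suc k" "2^n", where 'a=real] by simp
    then show "real (Suc k) / 2^n \<le> 1" by (simp add: divide_le_eq)
    show "real k / 2^n < real (Suc k) / 2^n" by (rule divide_strict_right_mono) auto
  qed simp
  have "dyadic_length \<gamma> n k \<le> (LINT t:{real k / 2^n..real (Suc k) / 2^n}|lborel. g t)"
    unfolding dyadic_length_def using assms(1) le unfolding speed_bound_def by blast
  also have "\<dots> = (LINT t:dyadic_interval n k|lborel. indicator {0..1} t * g t)"
    unfolding set_lebesgue_integral_def
  proof (rule integral_cong_AE)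
    have g: "set_integrable lborel {0..1} g" using assms(1) by (simp add: speed_bound_def)
    then have g': "(\<lambda>t. indicator {0..1} t * g t) \<in> borel_measurable lborel"
      by (auto simp: set_integrable_def)
    then show "(\<lambda>t. indicator (dyadic_interval n k) t *\<^sub>R (indicator {0..1} t * g t)) \<in> borel_measurable lborel"
      by auto
    have sub: "{real k / 2^n..real (Suc k) / 2^n} \<subseteq> {0..1}"
      by (intro subsetI) (use le in \<open>simp only: atLeastAtMost_iff, linarith\<close>)
    show "(\<lambda>t. indicator {real k / 2^n..real (Suc k) / 2^n} t *\<^sub>R g t) \<in> borel_measurable lborel"
      using set_integrable_subset[OF g _ sub] by (auto simp: set_integrable_def)
    show "AE t in lborel. indicator {real k / 2^n..real (Suc k) / 2^n} t *\<^sub>R g t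
        = indicator (dyadic_interval n k) t *\<^sub>R (indicator {0..1} t * g t)"
      using AE_lborel_singleton[of "real (Suc k) / 2^n"]
    proof eventually_elim
      case (elim t)
      then have "t \<in> {real k / 2^n..real (Suc k) / 2^n} \<longleftrightarrow> t \<in> dyadic_interval n k"
        by (auto simp del: of_nat_Suc)
      moreover have "t \<in> dyadic_interval n k \<Longrightarrow> t \<in> {0..1}"
        using dyadic_interval_subset[OF assms(2)] by blast
      ultimately show ?case unfolding indicator_def by (simp del: atLeastAtMost_iff atLeastLessThan_iff)
    qed
  qed
  finally show ?thesis .
qed

lemma dyadic_energy_le:
  assumes "speed_bound \<gamma> g" "(\<lambda>t. indicator {0..1} t * g t) \<in> L2 lborel"
  shows "dyadic_energy \<gamma> n \<le> (l2norm lborel (\<lambda>t. indicator {0..1} t * g t))\<^sup>2"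
  using dyadic_speed_pythagoras[OF assms(2) dyadic_length_le_integral[OF assms(1)], of n]
  by (smt (verit) zero_le_power2)

text \<open>The limit \<open>h\<close> of the dyadic speeds is a speed bound and therefore dominates
  the metric speed a.e. Conversely the dyadic lengths never exceed the integral of the metric speed,
  while they converge to the integral of \<open>h\<close>. The two functions thus agree a.e. on the
  unit interval.\<close>

lemma metric_speed_of_dyadic_energy:
  fixes \<gamma> :: "real \<Rightarrow> 'a::polish_space"
  assumes cont: "continuous_on {0..1} \<gamma>" and K: "\<And>n. dyadic_energy \<gamma> n \<le> K"
  shows "abs_cont_curve \<gamma>"
    and "(\<lambda>t. indicator {0..1} t * metric_speed \<gamma> t) \<in> L2 lborel"
    and "(\<lambda>n. l2norm lborel (\<lambda>t. dyadic_speed \<gamma> n t - indicator {0..1} t * metric_speed \<gamma> t)) \<longlonglongrightarrow> 0"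
proof -
  let ?s = "\<lambda>t. indicator {0..1} t * metric_speed \<gamma> t"
  obtain h where h: "h \<in> L2 lborel" "(\<lambda>n. l2norm lborel (\<lambda>t. dyadic_speed \<gamma> n t - h t)) \<longlonglongrightarrow> 0" "speed_bound \<gamma> h"
    using speed_bound_of_dyadic_energy[OF cont K] .
  show ac: "abs_cont_curve \<gamma>" using h(3) by (auto simp: abs_cont_curve_def)
  note sb = speed_bound_metric_speed[OF ac]
  then have si: "integrable lborel ?s" by (simp add: speed_bound_def set_integrable_def)
  have le: "AE t in lborel. t \<in> {0..1} \<longrightarrow> metric_speed \<gamma> t \<le> h t" by (rule metric_speed_le[OF ac h(3)])
  let ?h = "\<lambda>t. indicator {0..1} t * h t"
  have hi: "integrable lborel ?h" using h(3) by (simp add: speed_bound_def set_integrable_def)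
  have "(LINT t:{0..<1}|lborel. dyadic_speed \<gamma> n t) \<le> (\<integral>t. ?s t \<partial>lborel)" for n
  proof -
    have "(LINT t:{0..<1}|lborel. dyadic_speed \<gamma> n t) = dist (\<gamma> 0) (\<gamma> 0) + (\<Sum>k<2^n. dyadic_length \<gamma> n k)"
      using set_integral_dyadic_speed[of "2^n" n 0 \<gamma>] by (simp add: lessThan_atLeast0)
    also have "\<dots> \<le> (\<Sum>k<2^n. LINT t:dyadic_interval n k|lborel. ?s t)"
      unfolding dist_self add_0 by (intro sum_mono dyadic_length_le_integral[OF sb]) (simp only: lessThan_iff)
    also have "\<dots> = (\<integral>t. (\<Sum>k<2^n. indicator (dyadic_interval n k) t * ?s t) \<partial>lborel)"
      unfolding set_lebesgue_integral_def real_scaleR_def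
      by (rule Bochner_Integration.integral_sum[symmetric])
         (use integrable_mult_indicator[OF _ si] in auto)
    also have "\<dots> \<le> (\<integral>t. ?s t \<partial>lborel)"
    proof (rule integral_mono_AE)
      show "integrable lborel (\<lambda>t. (\<Sum>k<2^n. indicator (dyadic_interval n k) t * ?s t))"
        by (rule Bochner_Integration.integrable_sum) (use integrable_mult_indicator[OF _ si] in auto)
      show "AE t in lborel. (\<Sum>k<2^n. indicator (dyadic_interval n k) t * ?s t) \<le> ?s t"
        using speed_bound_nonneg_AE[OF sb]
      proof eventually_elim
        case (elim t)
        then have "0 \<le> ?s t" by (auto simp: indicator_def)
        \<comment> \<open>At most one of the disjoint dyadic intervals contains
          \<open>t\<close>.\<close>
        moreover have "(\<Sum>k<2^n. indicator (dyadic_interval n k) t) \<le> (1::real)"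
        proof (cases "\<exists>k<2^n. t \<in> dyadic_interval n k")
          case True
          then obtain k where k: "k < 2^n" "t \<in> dyadic_interval n k" by blast
          have "(\<Sum>j<2^n. indicator (dyadic_interval n j) t) = (\<Sum>j<2^n. if j = k then 1 else 0 :: real)"
            by (intro sum.cong refl) (metis dyadic_interval_unique k(2) indicator_simps)
          then show ?thesis by simp
        next
          case False
          then have "(\<Sum>j<2^n. indicator (dyadic_interval n j) t) = (0::real)"
            by (intro sum.neutral) (metis indicator_simps(2) lessThan_iff)
          then show ?thesis by simp
        qed
        ultimately show ?case by (simp only: sum_distrib_right[symmetric] mult_left_le_one_le sum_nonneg indicator_pos_le)
      qed
    qed (rule si)
    finally show ?thesis .
  qed
  moreover have "(\<lambda>n. LINT t:{0..<1}|lborel. dyadic_speed \<gamma> n t) \<longlonglongrightarrow> (LINT t:{0..<1}|lborel. h t)"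
    by (rule set_integral_L2_tendsto[OF dyadic_speed_L2 h(1,2)]) auto
  ultimately have "(LINT t:{0..<1}|lborel. h t) \<le> (\<integral>t. ?s t \<partial>lborel)"
    by (intro LIMSEQ_le_const2) auto
  moreover have "(LINT t:{0..<1}|lborel. h t) = (\<integral>t. ?h t \<partial>lborel)"
    unfolding set_lebesgue_integral_def real_scaleR_def
  proof (rule integral_cong_AE)
    show "AE t in lborel. indicator {0..<1} t * h t = indicator {0..1} t * h t"
      using AE_lborel_singleton[of 1] by eventually_elim (auto simp: indicator_def)
  qed (use h(1)[THEN L2_measurable] in auto)
  ultimately have le': "(\<integral>t. ?h t - ?s t \<partial>lborel) \<le> 0" using hi si by simp
  have pos: "AE t in lborel. 0 \<le> ?h t - ?s t"
    using le by eventually_elim (auto simp: indicator_def)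
  have "(\<integral>t. ?h t - ?s t \<partial>lborel) = 0"
    using le' integral_nonneg_AE[OF pos] by linarith
  then have "AE t in lborel. ?h t - ?s t = 0"
    using integral_nonneg_eq_0_iff_AE[OF Bochner_Integration.integrable_diff[OF hi si] pos] by simp
  then have eq: "AE t in lborel. ?h t = ?s t" by eventually_elim simp
  have sm: "?s \<in> borel_measurable lborel" using si by auto
  show "?s \<in> L2 lborel"
    by (rule L2_bound[OF h(1) sm]) (use eq in \<open>eventually_elim, auto simp: indicator_def split: if_splits\<close>)
  show "(\<lambda>n. l2norm lborel (\<lambda>t. dyadic_speed \<gamma> n t - ?s t)) \<longlonglongrightarrow> 0"
  proof (rule Lim_null_comparison[OF _ h(2)], rule always_eventually, rule allI)
    fix n
    \<comment> \<open>Only an inequality is claimed: off the unit interval the dyadic speed and the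
      cut-off speed vanish, whereas nothing has been said about \<open>h\<close> there.\<close>
    have "l2norm lborel (\<lambda>t. dyadic_speed \<gamma> n t - ?s t) \<le> l2norm lborel (\<lambda>t. dyadic_speed \<gamma> n t - h t)"
    proof (rule l2norm_mono_AE[OF L2_diff[OF dyadic_speed_L2 h(1)]])
      show "(\<lambda>t. dyadic_speed \<gamma> n t - ?s t) \<in> borel_measurable lborel" using sm by auto
      show "AE t in lborel. \<bar>dyadic_speed \<gamma> n t - ?s t\<bar> \<le> \<bar>dyadic_speed \<gamma> n t - h t\<bar>"
        using eq
      proof eventually_elim
        case (elim t)
        then show ?case by (cases "t \<in> {0..1}") (auto simp: dyadic_speed_eq_0)
      qed
    qed
    then show "norm (l2norm lborel (\<lambda>t. dyadic_speed \<gamma> n t - ?s t)) \<le> l2norm lborel (\<lambda>t. dyadic_speed \<gamma> n t - h t)"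
      by simp
  qed
qed

section \<open>The energy of a curve as a supremum of dyadic energies\<close>

lemma curve_energy_abs_cont:
  assumes "abs_cont_curve \<gamma>"
  shows "(\<lambda>t. indicator {0..1} t * metric_speed \<gamma> t) \<in> borel_measurable lborel"
    and "curve_energy \<gamma> = (\<integral>\<^sup>+t. ennreal ((indicator {0..1} t * metric_speed \<gamma> t)\<^sup>2) \<partial>lborel)"
proof -
  show "(\<lambda>t. indicator {0..1} t * metric_speed \<gamma> t) \<in> borel_measurable lborel"
    using speed_bound_metric_speed[OF assms] by (auto simp: speed_bound_def set_integrable_def)
  show "curve_energy \<gamma> = (\<integral>\<^sup>+t. ennreal ((indicator {0..1} t * metric_speed \<gamma> t)\<^sup>2) \<partial>lborel)"
    using assms unfolding curve_energy_def by (auto intro!: nn_integral_cong split: split_indicator)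
qed

lemma dyadic_energy_bounded:
  assumes "curve_energy \<gamma> < \<infinity>"
  shows "\<exists>K. \<forall>n. dyadic_energy \<gamma> n \<le> K"
proof -
  have ac: "abs_cont_curve \<gamma>" using assms by (auto simp: curve_energy_def split: if_splits)
  have "(\<lambda>t. indicator {0..1} t * metric_speed \<gamma> t) \<in> L2 lborel"
    using curve_energy_abs_cont[OF ac] assms by (simp add: L2_nn_iff)
  from dyadic_energy_le[OF speed_bound_metric_speed[OF ac] this] show ?thesis by blast
qed

text \<open>Each dyadic energy depends on finitely many values of the curve, so this formula is what
  makes the energy a Borel function of the curve. Curves that are not absolutely continuous are
  included: their dyadic energies are unbounded.\<close>

lemma curve_energy_eq_SUP:
  fixes \<gamma> :: "real \<Rightarrow> 'a::polish_space"
  assumes cont: "continuous_on {0..1} \<gamma>"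
  shows "curve_energy \<gamma> = (SUP n. ennreal (dyadic_energy \<gamma> n))"
proof (cases "\<exists>K. \<forall>n. dyadic_energy \<gamma> n \<le> K")
  case True
  then obtain K where K: "\<And>n. dyadic_energy \<gamma> n \<le> K" by blast
  note ms = metric_speed_of_dyadic_energy[OF cont K]
  let ?s = "\<lambda>t. indicator {0..1} t * metric_speed \<gamma> t"
  have "curve_energy \<gamma> = ennreal ((l2norm lborel ?s)\<^sup>2)"
    using curve_energy_abs_cont(2)[OF ms(1)] l2norm_nn[OF ms(2)] by simp
  moreover have "(\<lambda>n. ennreal (dyadic_energy \<gamma> n)) \<longlonglongrightarrow> ennreal ((l2norm lborel ?s)\<^sup>2)"
    by (intro tendsto_ennrealI tendsto_intros l2norm_tendsto[OF dyadic_speed_L2 ms(2,3)])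
  moreover have "(\<lambda>n. ennreal (dyadic_energy \<gamma> n)) \<longlonglongrightarrow> (SUP n. ennreal (dyadic_energy \<gamma> n))"
    by (rule LIMSEQ_SUP) (unfold incseq_def, blast intro: ennreal_leI dyadic_energy_mono)
  ultimately show ?thesis by (simp only: LIMSEQ_unique)
next
  case False
  then have "curve_energy \<gamma> = \<infinity>" using dyadic_energy_bounded[of \<gamma>] by (metis infinity_ennreal_def less_top)
  moreover have "(SUP n. ennreal (dyadic_energy \<gamma> n)) = \<infinity>"
  proof (rule ccontr)
    assume "(SUP n. ennreal (dyadic_energy \<gamma> n)) \<noteq> \<infinity>"
    then obtain r where r: "0 \<le> r" "(SUP n. ennreal (dyadic_energy \<gamma> n)) = ennreal r"
      by (cases "(SUP n. ennreal (dyadic_energy \<gamma> n))") auto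
    have "ennreal (dyadic_energy \<gamma> n) \<le> ennreal r" for n unfolding r(2)[symmetric] by (rule SUP_upper) simp
    then show False using False r(1) by (auto simp: ennreal_le_iff)
  qed
  ultimately show ?thesis by (simp only:)
qed

lemma curve_energy_le:
  fixes \<gamma> :: "real \<Rightarrow> 'a::polish_space"
  assumes cont: "continuous_on {0..1} \<gamma>" and "speed_bound \<gamma> g" "(\<lambda>t. indicator {0..1} t * g t) \<in> L2 lborel"
  shows "curve_energy \<gamma> \<le> (\<integral>\<^sup>+t. ennreal ((indicator {0..1} t * g t)\<^sup>2) \<partial>lborel)"
  unfolding curve_energy_eq_SUP[OF cont] l2norm_nn[OF assms(3)]
  by (intro SUP_least ennreal_leI dyadic_energy_le assms)

section \<open>Test plans\<close>

text \<open>Compactness of the unit interval makes the boundedness built into the function space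
  automatic.\<close>

lemma mspace_curves: "mspace curves = {\<gamma>. \<gamma> \<in> extensional {0..1} \<and> continuous_on {0..1} \<gamma>}"
proof -
  have "compactin (top_of_set {0..1::real}) (topspace (top_of_set {0..1}))"
    by (simp add: compactin_subtopology)
  from compactin_mspace_cfunspace[OF this, of euclidean_metric] show ?thesis
    unfolding curves_def by auto
qed

lemma space_curve_borel: "space curve_borel = mspace curves"
  unfolding curve_borel_def using openin_subset[of "mtopology_of curves"]
  by (subst space_measure_of) auto

lemma open_in_curve_borel: "openin (mtopology_of curves) U \<Longrightarrow> U \<in> sets curve_borel"
  unfolding curve_borel_def using openin_subset[of "mtopology_of curves"]
  by (subst sets_measure_of) auto

lemma mdist_curves_le:
  assumes "0 \<le> B" "\<And>x. x \<in> {0..1} \<Longrightarrow> dist (\<gamma> x) (\<gamma>' x) \<le> B"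
  shows "mdist curves \<gamma> \<gamma>' \<le> B"
  unfolding curves_def by (rule mdist_cfunspace_le) (use assms in auto)

lemma dist_le_mdist_curves:
  assumes "\<gamma> \<in> mspace curves" "\<gamma>' \<in> mspace curves" "t \<in> {0..1}"
  shows "dist (\<gamma> t) (\<gamma>' t) \<le> mdist curves \<gamma> \<gamma>'"
  using mdist_cfunspace_imp_mdist_le[of \<gamma> "top_of_set {0..1}" euclidean_metric \<gamma>' "mdist curves \<gamma> \<gamma>'" t] assms
  by (simp add: curves_def del: mspace_cfunspace)

section \<open>Measurability of evaluation, restriction and dyadic speed on the space of
  curves\<close>

lemma eval_measurable:
  assumes "t \<in> {0..1}"
  shows "(\<lambda>\<gamma>. \<gamma> t) \<in> measurable curve_borel (borel :: 'a::polish_space measure)"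
proof (rule borel_measurableI)
  fix U :: "'a set" assume U: "open U"
  have "Lipschitz_continuous_map curves euclidean_metric (\<lambda>\<gamma>. \<gamma> t :: 'a)"
    unfolding Lipschitz_continuous_map_def
    by (auto intro!: exI[of _ 1] dist_le_mdist_curves simp: assms[simplified])
  then have "continuous_map (mtopology_of curves) euclidean (\<lambda>\<gamma>. \<gamma> t :: 'a)"
    using Lipschitz_continuous_imp_continuous_map[of curves "euclidean_metric :: 'a metric"] by simp
  then have "openin (mtopology_of curves) {\<gamma> \<in> mspace curves. \<gamma> t \<in> U}"
    using U by (auto simp: continuous_map_def)
  then have "{\<gamma> \<in> mspace curves. \<gamma> t \<in> U} \<in> sets curve_borel" by (rule open_in_curve_borel)
  also have "{\<gamma> \<in> mspace curves. \<gamma> t \<in> U} = (\<lambda>\<gamma>. \<gamma> t) -` U \<inter> space curve_borel"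
    by (auto simp: space_curve_borel)
  finally show "(\<lambda>\<gamma>. \<gamma> t) -` U \<inter> space curve_borel \<in> sets curve_borel" .
qed

text \<open>The piece of the curve over \<open>[t, s]\<close>, run affinely over the unit interval;
  \<open>restrict\<close> supplies the default value off it that the points of \<open>curves\<close>
  carry.\<close>

definition restr_curve :: "real \<Rightarrow> real \<Rightarrow> (real \<Rightarrow> 'a) \<Rightarrow> real \<Rightarrow> 'a" where
  "restr_curve t s \<gamma> = restrict (\<lambda>r. \<gamma> (t + (s - t) * r)) {0..1}"

lemma affine_in_unit:
  fixes t s r :: real
  assumes "0 \<le> t" "t < s" "s \<le> 1" "r \<in> {0..1}"
  shows "t + (s - t) * r \<in> {0..1}"
proof -
  have "(s - t) * r \<le> s - t" using assms by (intro mult_left_le) auto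
  moreover have "0 \<le> (s - t) * r" using assms by simp
  ultimately show ?thesis using assms(1-3) unfolding atLeastAtMost_iff by (intro conjI) linarith+
qed

lemma restr_curve_in_curves:
  fixes \<gamma> :: "real \<Rightarrow> 'a::polish_space"
  assumes "0 \<le> t" "t < s" "s \<le> 1" "\<gamma> \<in> mspace curves"
  shows "restr_curve t s \<gamma> \<in> mspace curves"
proof -
  have "continuous_on {0..1} (\<lambda>r. \<gamma> (t + (s - t) * r))"
    by (rule continuous_on_compose2[of "{0..1}" \<gamma>])
       (use assms affine_in_unit[OF assms(1-3)] in \<open>auto simp: mspace_curves intro!: continuous_intros\<close>)
  moreover have "continuous_on {0..1} (restr_curve t s \<gamma>) \<longleftrightarrow> continuous_on {0..1} (\<lambda>r. \<gamma> (t + (s - t) * r))"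
    by (rule continuous_on_cong) (auto simp: restr_curve_def)
  ultimately show ?thesis
    by (simp add: mspace_curves) (simp add: restr_curve_def)
qed

text \<open>Restriction does not increase the supremum distance, so it is continuous.\<close>

lemma restr_curve_measurable:
  assumes "0 \<le> t" "t < s" "s \<le> 1"
  shows "restr_curve t s \<in> measurable curve_borel (curve_borel :: (real \<Rightarrow> 'a::polish_space) measure)"
proof -
  let ?C = "curves :: (real \<Rightarrow> 'a) metric"
  have "Lipschitz_continuous_map ?C ?C (restr_curve t s)"
    unfolding Lipschitz_continuous_map_def
  proof (intro conjI exI[of _ 1] ballI)
    show "restr_curve t s \<in> mspace ?C \<rightarrow> mspace ?C" using restr_curve_in_curves[OF assms] by auto
    fix \<gamma> \<gamma>' assume g: "\<gamma> \<in> mspace ?C" "\<gamma>' \<in> mspace ?C"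
    have *: "dist (restr_curve t s \<gamma> x) (restr_curve t s \<gamma>' x) \<le> mdist ?C \<gamma> \<gamma>'" if "x \<in> {0..1}" for x
      using dist_le_mdist_curves[OF g affine_in_unit[OF assms that]] that
      by (simp add: restr_curve_def)
    then show "mdist ?C (restr_curve t s \<gamma>) (restr_curve t s \<gamma>') \<le> 1 * mdist ?C \<gamma> \<gamma>'"
      using order_trans[OF zero_le_dist *[of 0]] by (intro mdist_curves_le) simp_all
  qed
  then have c: "continuous_map (mtopology_of ?C) (mtopology_of ?C) (restr_curve t s)"
    by (rule Lipschitz_continuous_imp_continuous_map)
  show ?thesis
    unfolding curve_borel_def[where 'a='a]
  proof (rule measurable_measure_of)
    show "{U. openin (mtopology_of ?C) U} \<subseteq> Pow (mspace ?C)"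
      using openin_subset[of "mtopology_of ?C"] by auto
    show "restr_curve t s \<in> space (sigma (mspace ?C) {U. openin (mtopology_of ?C) U}) \<rightarrow> mspace ?C"
      using restr_curve_in_curves[OF assms] by (auto simp flip: curve_borel_def simp: space_curve_borel)
    fix U assume "U \<in> {U. openin (mtopology_of ?C) U}"
    then have "openin (mtopology_of ?C) {\<gamma> \<in> mspace ?C. restr_curve t s \<gamma> \<in> U}"
      using c by (auto simp: continuous_map_def)
    from open_in_curve_borel[OF this]
    show "restr_curve t s -` U \<inter> space (sigma (mspace ?C) {U. openin (mtopology_of ?C) U})
       \<in> sets (sigma (mspace ?C) {U. openin (mtopology_of ?C) U})"
      by (simp flip: curve_borel_def add: space_curve_borel vimage_def Int_def conj_commute)
  qed
qed

abbreviation clamp01 :: "real \<Rightarrow> real" where "clamp01 t \<equiv> max 0 (min 1 t)"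

text \<open>Clamping makes evaluation total in time, so that it can be measurable on the full
  product with \<open>lborel\<close>.\<close>

definition eval_pair :: "(real \<Rightarrow> 'a) \<times> real \<Rightarrow> 'a" where
  "eval_pair z = fst z (clamp01 (snd z))"

text \<open>The approximations read the time only through a dyadic floor, which has countably many
  values; at each of them evaluation is measurable, and continuity of the curve gives the
  limit.\<close>

lemma eval_pair_measurable [measurable]:
  "eval_pair \<in> measurable (curve_borel \<Otimes>\<^sub>M lborel) (borel :: 'a::polish_space measure)"
proof (rule borel_measurable_LIMSEQ_metric)
  define f where "f = (\<lambda>i (z :: (real \<Rightarrow> 'a) \<times> real). fst z (clamp01 (real_of_int \<lfloor>2^i * snd z\<rfloor> / 2^i)))"
  show "f i \<in> measurable (curve_borel \<Otimes>\<^sub>M lborel) borel" for i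
    unfolding f_def
  proof (rule measurable_compose_countable[where g="\<lambda>z. \<lfloor>2^i * snd z\<rfloor>" and f="\<lambda>k z. fst z (clamp01 (real_of_int k / 2^i))"])
    fix k :: int
    show "(\<lambda>z. fst z (clamp01 (real_of_int k / 2^i))) \<in> measurable (curve_borel \<Otimes>\<^sub>M lborel) (borel :: 'a measure)"
      by (rule measurable_compose[OF measurable_fst eval_measurable]) auto
  qed measurable
  fix z :: "(real \<Rightarrow> 'a) \<times> real" assume z: "z \<in> space (curve_borel \<Otimes>\<^sub>M lborel)"
  then have cont: "continuous_on {0..1} (fst z)"
    by (auto simp: space_pair_measure space_curve_borel mspace_curves)
  have "(\<lambda>i. clamp01 (real_of_int \<lfloor>2^i * snd z\<rfloor> / 2^i)) \<longlonglongrightarrow> clamp01 (snd z)"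
    by (intro tendsto_max tendsto_min tendsto_const dyadic_floor_tendsto)
  then show "(\<lambda>i. f i z) \<longlonglongrightarrow> eval_pair z"
    unfolding f_def eval_pair_def
    by (intro continuous_on_tendsto_compose[OF cont]) auto
qed

lemma dyadic_speed_pair_measurable [measurable]:
  "(\<lambda>z. dyadic_speed (fst z) n (snd z)) \<in> borel_measurable (curve_borel \<Otimes>\<^sub>M lborel :: ((real \<Rightarrow> 'a::polish_space) \<times> real) measure)"
  unfolding dyadic_speed_def
proof (intro borel_measurable_sum borel_measurable_times borel_measurable_const)
  fix k assume "k \<in> {..<2^n :: nat}"
  then have "k < 2^n" by simp
  then have "real (Suc k) \<le> 2^n" "real k \<le> 2^n" using of_nat_le_iff[of "Suc k" "2^n", where 'a=real] by simp_all
  then have "real (Suc k) / 2^n \<le> 1" "real k / 2^n \<le> 1" by (simp_all add: divide_le_eq)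
  then have "(\<lambda>z. fst z (real k / 2^n)) \<in> measurable (curve_borel \<Otimes>\<^sub>M lborel) (borel :: 'a measure)"
     "(\<lambda>z. fst z (real (Suc k) / 2^n)) \<in> measurable (curve_borel \<Otimes>\<^sub>M lborel) (borel :: 'a measure)"
    by (auto intro!: measurable_compose[OF measurable_fst eval_measurable] simp del: of_nat_Suc)
  then show "(\<lambda>z. dyadic_length (fst z :: real \<Rightarrow> 'a) n k) \<in> borel_measurable (curve_borel \<Otimes>\<^sub>M lborel)"
    unfolding dyadic_length_def by (rule borel_measurable_dist)
  show "(\<lambda>z. indicator (dyadic_interval n k) (snd z) :: real) \<in> borel_measurable ((curve_borel :: (real \<Rightarrow> 'a) measure) \<Otimes>\<^sub>M lborel)"
    by measurable
qed

lemma dyadic_energy_measurable [measurable]: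
  "(\<lambda>\<gamma>. dyadic_energy \<gamma> n) \<in> borel_measurable (curve_borel :: (real \<Rightarrow> 'a::polish_space) measure)"
  unfolding l2norm_power2
  by (rule lborel.borel_measurable_lebesgue_integral) (simp add: case_prod_beta', measurable)

lemma curve_energy_measurable [measurable]:
  "curve_energy \<in> borel_measurable (curve_borel :: (real \<Rightarrow> 'a::polish_space) measure)"
proof (subst measurable_cong)
  show "curve_energy \<gamma> = (SUP n. ennreal (dyadic_energy \<gamma> n))" if "\<gamma> \<in> space curve_borel" for \<gamma> :: "real \<Rightarrow> 'a"
    using that by (intro curve_energy_eq_SUP) (simp add: space_curve_borel mspace_curves)
qed measurable

abbreviation path_work :: "('a::polish_space \<Rightarrow> real) \<Rightarrow> (real \<Rightarrow> 'a) \<Rightarrow> real set \<Rightarrow> ennreal" where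
  "path_work G \<gamma> A \<equiv> \<integral>\<^sup>+t\<in>A. ennreal (G (\<gamma> t) * metric_speed \<gamma> t) \<partial>lborel"

section \<open>A fixed test plan: compression, joint speed and work\<close>

locale plan =
  fixes m :: "'a::polish_space measure" and \<pi> :: "(real \<Rightarrow> 'a) measure"
  assumes sets_m [measurable_cong]: "sets m = sets borel" and test_plan: "test_plan m \<pi>"
begin

sublocale prob_space \<pi>
  using test_plan by (simp add: test_plan_def)

lemma sets_plan [measurable_cong]: "sets \<pi> = sets curve_borel"
  using test_plan by (simp add: test_plan_def)

lemma space_plan: "space \<pi> = mspace curves"
  using sets_eq_imp_space_eq[OF sets_plan] by (simp add: space_curve_borel)

lemma continuous_plan: "\<gamma> \<in> space \<pi> \<Longrightarrow> continuous_on {0..1} \<gamma>"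
  by (simp add: space_plan mspace_curves)

lemma eval_plan: "t \<in> {0..1} \<Longrightarrow> (\<lambda>\<gamma>. \<gamma> t) \<in> measurable \<pi> borel"
  using eval_measurable[of t] by (simp add: measurable_cong_sets[OF sets_plan refl])

sublocale pair: pair_sigma_finite \<pi> "lborel :: real measure" ..

definition compression :: real where
  "compression = (SOME C. C > 0 \<and> (\<forall>t\<in>{0..1}. \<forall>A\<in>sets borel.
        emeasure (distr \<pi> borel (\<lambda>\<gamma>. \<gamma> t)) A \<le> ennreal C * emeasure m A))"

lemma compression:
  shows "0 < compression"
    and "t \<in> {0..1} \<Longrightarrow> A \<in> sets borel \<Longrightarrow> emeasure (distr \<pi> borel (\<lambda>\<gamma>. \<gamma> t)) A \<le> ennreal compression * emeasure m A"
proof -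
  have "\<exists>C>0. \<forall>t\<in>{0..1}. \<forall>A\<in>sets borel.
        emeasure (distr \<pi> borel (\<lambda>\<gamma>. \<gamma> t)) A \<le> ennreal C * emeasure m A"
    using test_plan by (simp add: test_plan_def)
  from someI_ex[OF this, folded compression_def]
  show "0 < compression"
    "t \<in> {0..1} \<Longrightarrow> A \<in> sets borel \<Longrightarrow> emeasure (distr \<pi> borel (\<lambda>\<gamma>. \<gamma> t)) A \<le> ennreal compression * emeasure m A"
    by blast+
qed

lemma nn_integral_eval_le:
  assumes t: "t \<in> {0..1}" and u: "u \<in> borel_measurable borel"
  shows "(\<integral>\<^sup>+\<gamma>. u (\<gamma> t) \<partial>\<pi>) \<le> ennreal compression * (\<integral>\<^sup>+x. u x \<partial>m)"
proof -
  have "(\<integral>\<^sup>+\<gamma>. u (\<gamma> t) \<partial>\<pi>) = (\<integral>\<^sup>+x. u x \<partial>distr \<pi> borel (\<lambda>\<gamma>. \<gamma> t))"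
    by (rule nn_integral_distr[symmetric, OF eval_plan[OF t]]) (use u in simp)
  also have "\<dots> \<le> (\<integral>\<^sup>+x. u x \<partial>scale_measure (ennreal compression) m)"
  proof (rule nn_integral_mono_measure)
    show "distr \<pi> borel (\<lambda>\<gamma>. \<gamma> t) \<le> scale_measure (ennreal compression) m"
      by (subst le_measure) (use compression(2)[OF t] sets_m in auto)
  qed (simp add: sets_m)
  also have "\<dots> = ennreal compression * (\<integral>\<^sup>+x. u x \<partial>m)"
    by (rule nn_integral_scale_measure) (use u sets_m in \<open>simp add: measurable_cong_sets[OF sets_m refl]\<close>)
  finally show ?thesis .
qed

text \<open>By the compression bound the curves that sit in an \<open>m\<close>-null set at time
  \<open>t\<close> are negligible. The exceptional set of curves depends on \<open>t\<close>, which
  is why later only countably many times are treated together.\<close>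

lemma AE_eval:
  assumes t: "t \<in> {0..1}" and "AE x in m. P x"
  shows "AE \<gamma> in \<pi>. P (\<gamma> t)"
proof -
  obtain N where N: "{x \<in> space m. \<not> P x} \<subseteq> N" "emeasure m N = 0" "N \<in> sets m"
    using assms(2) by (rule AE_E)
  have sp: "space m = UNIV" using sets_eq_imp_space_eq[OF sets_m] by simp
  have Nb: "N \<in> sets borel" using N(3) by (simp add: sets_m)
  have "emeasure (distr \<pi> borel (\<lambda>\<gamma>. \<gamma> t)) N = 0"
    using compression(2)[OF t Nb] N(2) by simp
  then have "AE x in distr \<pi> borel (\<lambda>\<gamma>. \<gamma> t). x \<notin> N"
    using Nb by (intro AE_not_in) (auto simp: null_sets_def)
  then have "AE \<gamma> in \<pi>. \<gamma> t \<notin> N"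
    using eval_plan[OF t] by (rule AE_distrD[rotated])
  then show ?thesis by eventually_elim (use N(1) sp in auto)
qed

lemma energy_finite: "(\<integral>\<^sup>+\<gamma>. curve_energy \<gamma> \<partial>\<pi>) < \<infinity>"
  using test_plan by (simp add: test_plan_def)

lemma energy_measurable [measurable]: "curve_energy \<in> borel_measurable \<pi>"
  using curve_energy_measurable by (simp add: measurable_cong_sets[OF sets_plan refl])

lemma AE_energy_finite: "AE \<gamma> in \<pi>. curve_energy \<gamma> < \<infinity>"
  using nn_integral_PInf_AE[OF energy_measurable] energy_finite by (auto simp: less_top)

lemma dyadic_energy_meas [measurable]: "(\<lambda>\<gamma>. dyadic_energy \<gamma> n) \<in> borel_measurable \<pi>"
  using dyadic_energy_measurable by (simp add: measurable_cong_sets[OF sets_plan refl])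

lemma dyadic_energy_integrable: "integrable \<pi> (\<lambda>\<gamma>. dyadic_energy \<gamma> n)"
  and dyadic_energy_integral_le: "(\<integral>\<gamma>. dyadic_energy \<gamma> n \<partial>\<pi>) \<le> enn2real (\<integral>\<^sup>+\<gamma>. curve_energy \<gamma> \<partial>\<pi>)"
proof -
  have le: "(\<integral>\<^sup>+\<gamma>. ennreal (dyadic_energy \<gamma> n) \<partial>\<pi>) \<le> (\<integral>\<^sup>+\<gamma>. curve_energy \<gamma> \<partial>\<pi>)"
    by (intro nn_integral_mono) (auto simp only: curve_energy_eq_SUP[OF continuous_plan] intro: SUP_upper)
  also note energy_finite
  finally show i: "integrable \<pi> (\<lambda>\<gamma>. dyadic_energy \<gamma> n)"
    by (intro integrableI_bounded) auto
  show "(\<integral>\<gamma>. dyadic_energy \<gamma> n \<partial>\<pi>) \<le> enn2real (\<integral>\<^sup>+\<gamma>. curve_energy \<gamma> \<partial>\<pi>)"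
    unfolding integral_eq_nn_integral[OF borel_measurable_integrable[OF i] AE_I2[OF zero_le_power2]]
    by (rule enn2real_mono[OF le]) (use energy_finite in simp)
qed

lemma pair_plan_sets: "sets (\<pi> \<Otimes>\<^sub>M (lborel :: real measure)) = sets (curve_borel \<Otimes>\<^sub>M lborel)"
  by (intro sets_pair_measure_cong sets_plan refl)

lemma eval_pair_plan [measurable]: "eval_pair \<in> measurable (\<pi> \<Otimes>\<^sub>M lborel) borel"
  using eval_pair_measurable by (simp add: measurable_cong_sets[OF pair_plan_sets refl])

lemma dyadic_pair_plan [measurable]:
  "(\<lambda>z. dyadic_speed (fst z) n (snd z)) \<in> borel_measurable (\<pi> \<Otimes>\<^sub>M lborel)"
  using dyadic_speed_pair_measurable by (simp add: measurable_cong_sets[OF pair_plan_sets refl])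

text \<open>The dyadic speeds are jointly measurable, and their energies, integrated over the plan,
  increase and stay bounded, so they converge in \<open>L2\<close> of the product. A subsequence
  converges a.e.; for almost every curve its limit has to be the metric speed, to which the dyadic
  speeds of that curve converge in \<open>L2\<close>.\<close>

lemma ex_joint_speed:
  "\<exists>S. S \<in> L2 (\<pi> \<Otimes>\<^sub>M lborel) \<and> (\<forall>z. 0 \<le> S z) \<and> (\<forall>\<gamma> t. t \<notin> {0..1} \<longrightarrow> S (\<gamma>, t) = 0) \<and>
     (AE \<gamma> in \<pi>. AE t in lborel. indicator {0..1} t * metric_speed \<gamma> t = S (\<gamma>, t))"
proof -
  let ?P = "\<pi> \<Otimes>\<^sub>M (lborel :: real measure)"
  define g where "g = (\<lambda>n (z :: (real \<Rightarrow> 'a) \<times> real). dyadic_speed (fst z) n (snd z))"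
  define A where "A = (\<lambda>n. \<integral>\<gamma>. dyadic_energy \<gamma> n \<partial>\<pi>)"
  have gm [measurable]: "g n \<in> borel_measurable ?P" for n unfolding g_def by measurable
  have sq: "(\<integral>\<^sup>+z. ennreal ((g n z)\<^sup>2) \<partial>?P) = (\<integral>\<^sup>+\<gamma>. ennreal (dyadic_energy \<gamma> n) \<partial>\<pi>)" for n
    using lborel.nn_integral_fst[of "\<lambda>z. ennreal ((g n z)\<^sup>2)" \<pi>]
    by (simp add: g_def l2norm_nn[OF dyadic_speed_L2])
  have gL: "g n \<in> L2 ?P" for n
    using sq[of n] nn_integral_eq_integral[OF dyadic_energy_integrable[of n]]
    by (subst L2_nn_iff) auto
  have A: "(l2norm ?P (\<lambda>z. g k z - g n z))\<^sup>2 \<le> A k - A n" if "n \<le> k" for n k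
  proof -
    have "ennreal ((l2norm ?P (\<lambda>z. g k z - g n z))\<^sup>2) = (\<integral>\<^sup>+z. ennreal ((g k z - g n z)\<^sup>2) \<partial>?P)"
      by (rule l2norm_nn[symmetric]) (intro L2_diff gL)
    also have "\<dots> = (\<integral>\<^sup>+\<gamma>. ennreal ((l2norm lborel (\<lambda>t. dyadic_speed \<gamma> k t - dyadic_speed \<gamma> n t))\<^sup>2) \<partial>\<pi>)"
      using lborel.nn_integral_fst[of "\<lambda>z. ennreal ((g k z - g n z)\<^sup>2)" \<pi>]
      by (simp add: g_def l2norm_nn[OF L2_diff[OF dyadic_speed_L2 dyadic_speed_L2]])
    also have "\<dots> \<le> (\<integral>\<^sup>+\<gamma>. ennreal (dyadic_energy \<gamma> k - dyadic_energy \<gamma> n) \<partial>\<pi>)"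
      by (intro nn_integral_mono ennreal_leI dyadic_speed_cauchy_estimate that)
    also have "\<dots> = ennreal (A k - A n)"
      unfolding A_def using dyadic_energy_integrable dyadic_energy_mono[OF that]
      by (subst nn_integral_eq_integral) (auto intro!: AE_I2 simp del: power_mono_iff)
    finally show ?thesis
      using dyadic_energy_mono[OF that] dyadic_energy_integrable
      by (subst (asm) ennreal_le_iff) (auto simp: A_def intro!: integral_mono simp del: power_mono_iff)
  qed
  have bdd: "A n \<le> enn2real (\<integral>\<^sup>+\<gamma>. curve_energy \<gamma> \<partial>\<pi>)" for n
    unfolding A_def by (rule dyadic_energy_integral_le)
  obtain T where T: "T \<in> L2 ?P" "(\<lambda>n. l2norm ?P (\<lambda>z. g n z - T z)) \<longlonglongrightarrow> 0"
    by (rule L2_limit_of_monotone_energy[OF gL A bdd])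
  obtain r where r: "strict_mono r" "AE z in ?P. (\<lambda>n. g (r n) z) \<longlonglongrightarrow> T z"
    using L2_AE_subseq[OF gL T] .
  \<comment> \<open>Absolute value and cut-off secure sign and support everywhere and not only
    a.e.\<close>
  define S where "S = (\<lambda>z. indicator {0..1} (snd z) * \<bar>T z\<bar>)"
  have "S \<in> L2 ?P"
  proof (rule L2_bound[OF T(1)])
    show "S \<in> borel_measurable ?P" unfolding S_def using T(1)[THEN L2_measurable] by measurable
    show "AE z in ?P. \<bar>S z\<bar> \<le> \<bar>T z\<bar>" by (auto simp: S_def indicator_def)
  qed
  moreover have "AE \<gamma> in \<pi>. AE t in lborel. indicator {0..1} t * metric_speed \<gamma> t = S (\<gamma>, t)"
    using pair.AE_pair[OF r(2)] AE_energy_finite AE_space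
  proof eventually_elim
    case (elim \<gamma>)
    obtain K where K: "\<And>n. dyadic_energy \<gamma> n \<le> K" using dyadic_energy_bounded[OF elim(2)] by blast
    note ms = metric_speed_of_dyadic_energy[OF continuous_plan[OF elim(3)] K]
    have "(\<lambda>n. l2norm lborel (\<lambda>t. dyadic_speed \<gamma> (r n) t - indicator {0..1} t * metric_speed \<gamma> t)) \<longlonglongrightarrow> 0"
      using LIMSEQ_subseq_LIMSEQ[OF ms(3) r(1)] by (simp add: o_def)
    moreover have "AE t in lborel. (\<lambda>n. dyadic_speed \<gamma> (r n) t) \<longlonglongrightarrow> T (\<gamma>, t)"
      using elim(1) by (simp add: g_def)
    ultimately have "AE t in lborel. indicator {0..1} t * metric_speed \<gamma> t = T (\<gamma>, t)"
      by (rule L2_limit_unique_AE[OF dyadic_speed_L2 ms(2)])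
    then show ?case using elim(1)
    proof eventually_elim
      case (elim t)
      have "0 \<le> T (\<gamma>, t)" using elim(2) by (rule LIMSEQ_le_const) (simp add: g_def)
      then show ?case using elim(1) by (cases "t \<in> {0..1}") (simp_all add: S_def)
    qed
  qed
  ultimately show ?thesis by (intro exI[of _ S]) (auto simp: S_def)
qed

definition joint_speed :: "(real \<Rightarrow> 'a) \<times> real \<Rightarrow> real" where
  "joint_speed = (SOME S. S \<in> L2 (\<pi> \<Otimes>\<^sub>M lborel) \<and> (\<forall>z. 0 \<le> S z) \<and> (\<forall>\<gamma> t. t \<notin> {0..1} \<longrightarrow> S (\<gamma>, t) = 0) \<and>
     (AE \<gamma> in \<pi>. AE t in lborel. indicator {0..1} t * metric_speed \<gamma> t = S (\<gamma>, t)))"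

lemma joint_speed:
  shows joint_speed_L2: "joint_speed \<in> L2 (\<pi> \<Otimes>\<^sub>M lborel)"
    and joint_speed_nonneg: "0 \<le> joint_speed z"
    and joint_speed_0: "t \<notin> {0..1} \<Longrightarrow> joint_speed (\<gamma>, t) = 0"
    and AE_joint_speed: "AE \<gamma> in \<pi>. AE t in lborel. indicator {0..1} t * metric_speed \<gamma> t = joint_speed (\<gamma>, t)"
  using someI_ex[OF ex_joint_speed, folded joint_speed_def] by blast+

lemma joint_speed_measurable [measurable]: "joint_speed \<in> borel_measurable (\<pi> \<Otimes>\<^sub>M lborel)"
  using joint_speed_L2 by (rule L2_measurable)

text \<open>The right side of the weak upper gradient inequality with the speed replaced by its
  measurable version, so that Tonelli and Cauchy-Schwarz apply on the product.\<close>

definition work :: "('a \<Rightarrow> real) \<Rightarrow> ennreal" where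
  "work G = (\<integral>\<^sup>+z. ennreal (G (eval_pair z) * joint_speed z) \<partial>(\<pi> \<Otimes>\<^sub>M lborel))"

lemma path_measurable:
  assumes \<gamma>: "\<gamma> \<in> space \<pi>" and G: "G \<in> borel_measurable m"
  shows "(\<lambda>t. G (\<gamma> (clamp01 t))) \<in> borel_measurable borel"
proof -
  have Gb: "G \<in> borel_measurable borel" using G by (simp add: measurable_cong_sets[OF sets_m refl])
  have "continuous_on UNIV (\<lambda>t. \<gamma> (clamp01 t))"
    by (rule continuous_on_compose2[OF continuous_plan[OF \<gamma>]]) (auto intro!: continuous_intros)
  then have "(\<lambda>t. \<gamma> (clamp01 t)) \<in> borel_measurable borel" by (rule borel_measurable_continuous_onI)
  from measurable_compose[OF this Gb] show ?thesis .
qed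

abbreviation joint_work :: "('a \<Rightarrow> real) \<Rightarrow> (real \<Rightarrow> 'a) \<Rightarrow> real set \<Rightarrow> ennreal" where
  "joint_work G \<gamma> A \<equiv> \<integral>\<^sup>+t\<in>A. ennreal (G (eval_pair (\<gamma>, t)) * joint_speed (\<gamma>, t)) \<partial>lborel"

text \<open>The dictionary between the integral in the definition, which involves the chosen speed,
  and the one that is measurable in the curve.\<close>

lemma AE_path_work:
  assumes "A \<subseteq> {0..1}"
  shows "AE \<gamma> in \<pi>. path_work G \<gamma> A = joint_work G \<gamma> A"
  using AE_joint_speed
proof eventually_elim
  case (elim \<gamma>)
  show ?case
  proof (rule nn_integral_cong_AE, use elim in eventually_elim)
    case (elim t)
    then show ?case using assms
      by (cases "t \<in> A") (auto simp: eval_pair_def max_def min_def subset_eq)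
  qed
qed

lemma work_eq:
  assumes "G \<in> borel_measurable m"
  shows "(\<integral>\<^sup>+\<gamma>. path_work G \<gamma> {0..1} \<partial>\<pi>) = work G"
proof -
  have [measurable]: "G \<in> borel_measurable borel"
    using assms by (simp add: measurable_cong_sets[OF sets_m refl])
  have "(\<integral>\<^sup>+\<gamma>. path_work G \<gamma> {0..1} \<partial>\<pi>) = (\<integral>\<^sup>+\<gamma>. joint_work G \<gamma> {0..1} \<partial>\<pi>)"
    by (rule nn_integral_cong_AE[OF AE_path_work]) simp
  also have "\<dots> = (\<integral>\<^sup>+\<gamma>. (\<integral>\<^sup>+t. ennreal (G (eval_pair (\<gamma>, t)) * joint_speed (\<gamma>, t)) \<partial>lborel) \<partial>\<pi>)"
    by (intro nn_integral_cong) (auto simp: joint_speed_0 split: split_indicator)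
  also have "\<dots> = work G"
    unfolding work_def by (rule lborel.nn_integral_fst) measurable
  finally show ?thesis .
qed

lemma work_add:
  assumes "G \<in> borel_measurable m" "H \<in> borel_measurable m" "\<And>x. 0 \<le> G x" "\<And>x. 0 \<le> H x"
  shows "work (\<lambda>x. G x + H x) = work G + work H"
proof -
  have [measurable]: "G \<in> borel_measurable borel" "H \<in> borel_measurable borel"
    using assms by (simp_all add: measurable_cong_sets[OF sets_m refl])
  show ?thesis
    unfolding work_def
    by (subst nn_integral_add[symmetric])
       (auto intro!: nn_integral_cong simp: distrib_right assms joint_speed_nonneg)
qed

lemma work_mono:
  assumes "\<And>x. G x \<le> H x"
  shows "work G \<le> work H"
  unfolding work_def
  by (intro nn_integral_mono ennreal_leI mult_right_mono assms joint_speed_nonneg)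

lemma work_cmult:
  assumes "G \<in> borel_measurable m" "0 \<le> c"
  shows "work (\<lambda>x. c * G x) = ennreal c * work G"
proof -
  have [measurable]: "G \<in> borel_measurable borel"
    using assms by (simp_all add: measurable_cong_sets[OF sets_m refl])
  show ?thesis
    unfolding work_def
    by (subst nn_integral_cmult[symmetric])
       (auto intro!: nn_integral_cong simp: mult.assoc ennreal_mult' assms)
qed

text \<open>Cauchy-Schwarz on the product: by compression, \<open>K\<close> evaluated along the
  curves at a fixed time has squared norm at most \<open>compression\<close> times that of
  \<open>K\<close>, and the times fill an interval of length 1. The bound gives finiteness of the
  work and its continuity under \<open>L2\<close> convergence of gradients.\<close>

lemma work_le:
  assumes K: "K \<in> L2 m" "\<And>x. 0 \<le> K x"
  shows "work K \<le> ennreal (sqrt compression * l2norm (\<pi> \<Otimes>\<^sub>M lborel) joint_speed * l2norm m K)"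
proof -
  let ?P = "\<pi> \<Otimes>\<^sub>M (lborel :: real measure)"
  have [measurable]: "K \<in> borel_measurable borel"
    using L2_measurable[OF K(1)] by (simp_all add: measurable_cong_sets[OF sets_m refl])
  \<comment> \<open>Clamped evaluation is constant for times beyond the unit interval, so without
    the cut-off it need not be square-integrable over all times.\<close>
  define u where "u = (\<lambda>z. K (eval_pair z) * indicator {0..1} (snd z))"
  have um [measurable]: "u \<in> borel_measurable ?P" unfolding u_def by measurable
  have "(\<integral>\<^sup>+z. ennreal ((u z)\<^sup>2) \<partial>?P) = (\<integral>\<^sup>+t. \<integral>\<^sup>+\<gamma>. ennreal ((u (\<gamma>, t))\<^sup>2) \<partial>\<pi> \<partial>lborel)"
    by (rule pair.nn_integral_snd[symmetric]) measurable
  also have "\<dots> \<le> (\<integral>\<^sup>+t. ennreal (compression * (l2norm m K)\<^sup>2) * indicator {0..1::real} t \<partial>lborel)"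
  proof (rule nn_integral_mono)
    fix t :: real
    show "(\<integral>\<^sup>+\<gamma>. ennreal ((u (\<gamma>, t))\<^sup>2) \<partial>\<pi>) \<le> ennreal (compression * (l2norm m K)\<^sup>2) * indicator {0..1} t"
    proof (cases "t \<in> {0..1}")
      case True
      have "(\<integral>\<^sup>+\<gamma>. ennreal ((u (\<gamma>, t))\<^sup>2) \<partial>\<pi>) = (\<integral>\<^sup>+\<gamma>. ennreal ((K (\<gamma> t))\<^sup>2) \<partial>\<pi>)"
        using True by (simp add: u_def eval_pair_def)
      also have "\<dots> \<le> ennreal compression * (\<integral>\<^sup>+x. ennreal ((K x)\<^sup>2) \<partial>m)"
        by (rule nn_integral_eval_le[OF True]) measurable
      finally show ?thesis using True K compression(1) by (simp add: l2norm_nn ennreal_mult)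
    qed (simp add: u_def)
  qed
  also have "\<dots> = ennreal (compression * (l2norm m K)\<^sup>2)"
    by (subst nn_integral_cmult) auto
  also have "\<dots> = ennreal ((sqrt compression * l2norm m K)\<^sup>2)"
    using compression(1) by (simp add: power_mult_distrib)
  finally have uL: "u \<in> L2 ?P" "l2norm ?P u \<le> sqrt compression * l2norm m K"
    using l2norm_le_nn[OF um] compression(1) by auto
  have "work K = (\<integral>\<^sup>+z. ennreal (u z * joint_speed z) \<partial>?P)"
    unfolding work_def
  proof (rule nn_integral_cong)
    fix z :: "(real \<Rightarrow> 'a) \<times> real"
    show "ennreal (K (eval_pair z) * joint_speed z) = ennreal (u z * joint_speed z)"
      using joint_speed_0[of "snd z" "fst z"] by (cases "snd z \<in> {0..1}") (simp_all add: u_def)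
  qed
  also have "\<dots> = ennreal (\<integral>z. u z * joint_speed z \<partial>?P)"
    using K(2) joint_speed_nonneg
    by (intro nn_integral_eq_integral L2_mult_integrable uL joint_speed_L2) (auto simp: u_def)
  also have "\<dots> \<le> ennreal (l2norm ?P u * l2norm ?P joint_speed)"
    using l2_Cauchy_Schwarz[OF uL(1) joint_speed_L2] by (intro ennreal_leI) linarith
  also have "\<dots> \<le> ennreal (sqrt compression * l2norm m K * l2norm ?P joint_speed)"
    by (intro ennreal_leI mult_right_mono uL) simp
  finally show ?thesis by (simp add: mult_ac)
qed

lemma work_finite:
  assumes "K \<in> L2 m" "\<And>x. 0 \<le> K x"
  shows "work K < \<infinity>"
  using le_less_trans[OF work_le[OF assms]] by simp

end

section \<open>Localisation to subintervals and to almost every curve\<close>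

lemma speed_bound_restr_curve:
  fixes \<gamma> :: "real \<Rightarrow> 'a::polish_space"
  assumes g: "speed_bound \<gamma> g" and ts: "0 \<le> t" "t < s" "s \<le> 1"
  shows "speed_bound (restr_curve t s \<gamma>) (\<lambda>r. (s - t) * g (t + (s - t) * r))"
  unfolding speed_bound_def
proof (intro conjI allI impI)
  have pos: "0 < s - t" using ts by simp
  have ind: "indicator {r1..r2} r = (indicator {t + (s - t) * r1..t + (s - t) * r2} (t + (s - t) * r) :: real)" for r1 r2 r
    using pos by (auto simp: indicator_def)
  have sub: "{t + (s - t) * r1..t + (s - t) * r2} \<subseteq> {0..1}" if "0 \<le> r1" "r1 \<le> r2" "r2 \<le> 1" for r1 r2
    using affine_in_unit[OF ts, of r1] affine_in_unit[OF ts, of r2] that by auto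
  have gi: "set_integrable lborel {0..1} g" using g by (simp add: speed_bound_def)
  have gi': "integrable lborel (\<lambda>x. indicator {t + (s - t) * r1..t + (s - t) * r2} x * g x)"
    if "0 \<le> r1" "r1 \<le> r2" "r2 \<le> 1" for r1 r2
    using set_integrable_subset[OF gi _ sub[OF that]] by (simp add: set_integrable_def)
  show "set_integrable lborel {0..1} (\<lambda>r. (s - t) * g (t + (s - t) * r))"
  proof -
    have "integrable lborel (\<lambda>r. (s - t) * (indicator {t + (s - t) * 0..t + (s - t) * 1} (t + (s - t) * r) * g (t + (s - t) * r)))"
      using gi'[of 0 1] pos
      by (intro integrable_mult_right) (rule lborel_integrable_real_affine, auto)
    then show ?thesis unfolding set_integrable_def ind[symmetric] by (simp add: mult_ac)
  qed
  fix r1 r2 :: real assume r: "0 \<le> r1" "r1 < r2" "r2 \<le> 1"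
  have "dist (restr_curve t s \<gamma> r1) (restr_curve t s \<gamma> r2) = dist (\<gamma> (t + (s - t) * r1)) (\<gamma> (t + (s - t) * r2))"
    using r by (simp add: restr_curve_def)
  also have "\<dots> \<le> (LINT x:{t + (s - t) * r1..t + (s - t) * r2}|lborel. g x)"
    using g affine_in_unit[OF ts, of r1] affine_in_unit[OF ts, of r2] r pos by (auto simp: speed_bound_def)
  also have "\<dots> = (LINT r:{r1..r2}|lborel. (s - t) * g (t + (s - t) * r))"
    unfolding set_lebesgue_integral_def
    using lborel_integral_real_affine[of "s - t" "\<lambda>x. indicator {t + (s - t) * r1..t + (s - t) * r2} x * g x" t] pos
    by (simp add: ind[symmetric] mult.left_commute[of _ "s - t"])
  finally show "dist (restr_curve t s \<gamma> r1) (restr_curve t s \<gamma> r2) \<le> (LINT r:{r1..r2}|lborel. (s - t) * g (t + (s - t) * r))" .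
qed

context plan begin

text \<open>The metric speed, slowed down affinely, is a speed bound of the restricted curve. As
  such it dominates the new metric speed and bounds the new energy.\<close>

lemma curve_energy_restr_le:
  assumes \<gamma>: "\<gamma> \<in> space \<pi>" "curve_energy \<gamma> < \<infinity>" and ts: "0 \<le> t" "t < s" "s \<le> 1"
  shows "curve_energy (restr_curve t s \<gamma>) \<le> curve_energy \<gamma>"
    and "AE r in lborel. r \<in> {0..1} \<longrightarrow> metric_speed (restr_curve t s \<gamma>) r \<le> (s - t) * metric_speed \<gamma> (t + (s - t) * r)"
proof -
  have pos: "0 < s - t" using ts by simp
  have ac: "abs_cont_curve \<gamma>" using \<gamma>(2) by (auto simp: curve_energy_def split: if_splits)
  let ?ms = "metric_speed \<gamma>"
  let ?h = "\<lambda>r. (s - t) * ?ms (t + (s - t) * r)"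
  have sb: "speed_bound (restr_curve t s \<gamma>) ?h"
    by (rule speed_bound_restr_curve[OF speed_bound_metric_speed[OF ac] ts])
  then have ac': "abs_cont_curve (restr_curve t s \<gamma>)" by (auto simp: abs_cont_curve_def)
  show "AE r in lborel. r \<in> {0..1} \<longrightarrow> metric_speed (restr_curve t s \<gamma>) r \<le> ?h r"
    by (rule metric_speed_le[OF ac' sb])
  have hm: "(\<lambda>r. indicator {0..1} r * ?h r) \<in> borel_measurable lborel"
    using sb by (auto simp: speed_bound_def set_integrable_def)
  have msm [measurable]: "(\<lambda>r. indicator {0..1} r * ?ms r) \<in> borel_measurable borel"
    using curve_energy_abs_cont(1)[OF ac] by simp
  have "(\<integral>\<^sup>+r. ennreal ((indicator {0..1} r * ?h r)\<^sup>2) \<partial>lborel)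
      = (\<integral>\<^sup>+r. ennreal ((s - t)\<^sup>2) * (ennreal ((indicator {0..1} (t + (s - t) * r) * ?ms (t + (s - t) * r))\<^sup>2) * indicator {0..1} r) \<partial>lborel)"
    by (intro nn_integral_cong)
       (use affine_in_unit[OF ts] in \<open>auto simp: power_mult_distrib ennreal_mult simp del: atLeastAtMost_iff split: split_indicator\<close>)
  also have "\<dots> \<le> (\<integral>\<^sup>+r. ennreal (s - t) * ennreal ((indicator {0..1} (t + (s - t) * r) * ?ms (t + (s - t) * r))\<^sup>2) \<partial>lborel)"
  proof (intro nn_integral_mono)
    fix r :: real
    \<comment> \<open>Of the two factors \<open>s - t\<close> one is dropped, being at most 1; the
      other cancels in the substitution.\<close>
    have "(s - t)\<^sup>2 \<le> s - t" using ts pos by (simp add: power2_eq_square mult_left_le)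
    then show "ennreal ((s - t)\<^sup>2) * (ennreal ((indicator {0..1} (t + (s - t) * r) * ?ms (t + (s - t) * r))\<^sup>2) * indicator {0..1} r)
       \<le> ennreal (s - t) * ennreal ((indicator {0..1} (t + (s - t) * r) * ?ms (t + (s - t) * r))\<^sup>2)"
      by (intro mult_mono ennreal_leI) (auto split: split_indicator)
  qed
  also have "\<dots> = ennreal (s - t) * (\<integral>\<^sup>+r. ennreal ((indicator {0..1} (t + (s - t) * r) * ?ms (t + (s - t) * r))\<^sup>2) \<partial>lborel)"
  proof (rule nn_integral_cmult)
    have 1: "(\<lambda>r. t + (s - t) * r) \<in> borel_measurable lborel" by measurable
    have 2: "(\<lambda>x. ennreal ((indicator {0..1} x * ?ms x)\<^sup>2)) \<in> borel_measurable borel"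
      by (rule measurable_compose[OF borel_measurable_power[OF msm] measurable_ennreal])
    show "(\<lambda>r. ennreal ((indicator {0..1} (t + (s - t) * r) * ?ms (t + (s - t) * r))\<^sup>2)) \<in> borel_measurable lborel"
      by (rule measurable_compose[OF 1 2])
  qed
  also have "\<dots> = (\<integral>\<^sup>+r. ennreal ((indicator {0..1} r * ?ms r)\<^sup>2) \<partial>lborel)"
    using nn_integral_real_affine[of "\<lambda>x. ennreal ((indicator {0..1} x * ?ms x)\<^sup>2)" "s - t" t] pos by simp
  also have "\<dots> = curve_energy \<gamma>" by (rule curve_energy_abs_cont(2)[OF ac, symmetric])
  finally have le: "(\<integral>\<^sup>+r. ennreal ((indicator {0..1} r * ?h r)\<^sup>2) \<partial>lborel) \<le> curve_energy \<gamma>" .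
  have cont: "continuous_on {0..1} (restr_curve t s \<gamma>)"
    using restr_curve_in_curves[OF ts, of \<gamma>] \<gamma>(1) by (simp add: space_plan mspace_curves)
  have "(\<lambda>r. indicator {0..1} r * ?h r) \<in> L2 lborel"
    using le_less_trans[OF le \<gamma>(2)] hm by (simp add: L2_nn_iff)
  from curve_energy_le[OF cont sb this] le show "curve_energy (restr_curve t s \<gamma>) \<le> curve_energy \<gamma>"
    by (rule order_trans)
qed

text \<open>Conditioning on \<open>B\<close> enlarges integrals of non-negative functions at most by
  \<open>1 / measure \<pi> B\<close>; evaluating the restricted curve is evaluating the original one
  at another time; and restriction does not increase the energy.\<close>

lemma test_plan_restr:
  assumes ts: "0 \<le> t" "t < s" "s \<le> 1" and B: "B \<in> sets \<pi>" "emeasure \<pi> B \<noteq> 0"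
  shows "test_plan m (distr (uniform_measure \<pi> B) curve_borel (restr_curve t s))" (is "test_plan m ?\<rho>")
proof -
  let ?u = "uniform_measure \<pi> B"
  have Bf: "emeasure \<pi> B \<noteq> \<infinity>" by simp
  interpret u: prob_space ?u by (rule prob_space_uniform_measure[OF B(2) Bf])
  have rm [measurable]: "restr_curve t s \<in> measurable ?u curve_borel"
    using restr_curve_measurable[OF ts]
    by (simp add: measurable_cong_sets[OF trans[OF sets_uniform_measure sets_plan] refl])
  have uu: "(\<integral>\<^sup>+\<gamma>. f \<gamma> \<partial>?u) \<le> (\<integral>\<^sup>+\<gamma>. f \<gamma> \<partial>\<pi>) / emeasure \<pi> B" if "f \<in> borel_measurable \<pi>" for f
    unfolding nn_integral_uniform_measure[OF that B(1)]
    by (intro divide_right_mono_ennreal nn_integral_mono) (auto split: split_indicator)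
  show ?thesis
    unfolding test_plan_def
  proof (intro conjI exI ballI)
    show "prob_space ?\<rho>" by (rule u.prob_space_distr[OF rm])
    show "sets ?\<rho> = sets curve_borel" by simp
    define C where "C = compression / measure \<pi> B"
    have Bpos: "0 < measure \<pi> B" using B(2) by (simp add: emeasure_eq_measure zero_less_measure_iff)
    show "0 < C" using compression(1) Bpos by (simp add: C_def)
    fix r :: real and A :: "'a set" assume r: "r \<in> {0..1}" and A: "A \<in> sets borel"
    have em: "(\<lambda>\<gamma>. \<gamma> r) \<in> measurable ?\<rho> borel" using eval_measurable[OF r] by simp
    let ?v = "t + (s - t) * r"
    have v: "?v \<in> {0..1}" by (rule affine_in_unit[OF ts r])
    have "emeasure (distr ?\<rho> borel (\<lambda>\<gamma>. \<gamma> r)) A = emeasure (distr ?u borel (\<lambda>\<gamma>. restr_curve t s \<gamma> r)) A"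
      using eval_measurable[OF r] by (subst distr_distr) (auto simp: o_def)
    also have "\<dots> = emeasure (distr ?u borel (\<lambda>\<gamma>. \<gamma> ?v)) A"
      using r by (simp add: restr_curve_def)
    also have "\<dots> = (\<integral>\<^sup>+\<gamma>. indicator A (\<gamma> ?v) \<partial>?u)"
      using A eval_plan[OF v] by (subst nn_integral_indicator[symmetric], simp, subst nn_integral_distr) auto
    also have "\<dots> \<le> (\<integral>\<^sup>+\<gamma>. indicator A (\<gamma> ?v) \<partial>\<pi>) / emeasure \<pi> B"
      by (rule uu) (use A eval_plan[OF v] in measurable)
    also have "\<dots> \<le> (ennreal compression * emeasure m A) / emeasure \<pi> B"
      using nn_integral_eval_le[OF v, of "indicator A"] A
      by (intro divide_right_mono_ennreal) (simp add: sets_m)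
    also have "\<dots> = ennreal C * emeasure m A"
      using compression(1) Bpos
      by (simp add: C_def emeasure_eq_measure divide_ennreal[symmetric] divide_ennreal_def mult_ac)
    finally show "emeasure (distr ?\<rho> borel (\<lambda>\<gamma>. \<gamma> r)) A \<le> ennreal C * emeasure m A" .
  next
    have "(\<integral>\<^sup>+\<gamma>. curve_energy \<gamma> \<partial>?\<rho>) = (\<integral>\<^sup>+\<gamma>. curve_energy (restr_curve t s \<gamma>) \<partial>?u)"
      by (rule nn_integral_distr[OF rm]) simp
    also have "\<dots> \<le> (\<integral>\<^sup>+\<gamma>. curve_energy (restr_curve t s \<gamma>) \<partial>\<pi>) / emeasure \<pi> B"
    proof (rule uu)
      have "restr_curve t s \<in> measurable \<pi> curve_borel" using rm by simp
      then show "(\<lambda>\<gamma>. curve_energy (restr_curve t s \<gamma>)) \<in> borel_measurable \<pi>" by measurable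
    qed
    also have "\<dots> \<le> (\<integral>\<^sup>+\<gamma>. curve_energy \<gamma> \<partial>\<pi>) / emeasure \<pi> B"
    proof (intro divide_right_mono_ennreal nn_integral_mono)
      fix \<gamma> assume "\<gamma> \<in> space \<pi>"
      then show "curve_energy (restr_curve t s \<gamma>) \<le> curve_energy \<gamma>"
        using curve_energy_restr_le(1)[OF _ _ ts] by (cases "curve_energy \<gamma> < \<infinity>") (auto simp: less_top[symmetric])
    qed
    also have "\<dots> < \<infinity>"
      using energy_finite B(2) by (auto simp: ennreal_divide_eq_top_iff less_top[symmetric])
    finally show "(\<integral>\<^sup>+\<gamma>. curve_energy \<gamma> \<partial>?\<rho>) < \<infinity>" .
  qed
qed

lemma set_work_measurable:
  assumes "G \<in> borel_measurable m" "A \<in> sets lborel"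
  shows "(\<lambda>\<gamma>. joint_work G \<gamma> A) \<in> borel_measurable \<pi>"
proof -
  have [measurable]: "G \<in> borel_measurable borel" "A \<in> sets lborel"
    using assms by (simp_all add: measurable_cong_sets[OF sets_m refl])
  show ?thesis
    by (rule lborel.borel_measurable_nn_integral) (simp add: case_prod_beta', measurable)
qed

text \<open>If the inequality failed on a set \<open>B\<close> of positive measure, the plan
  conditioned on \<open>B\<close> and restricted to \<open>[t, s]\<close> would still be a test
  plan. The defining inequality for it bounds the mean of \<open>X\<close> over \<open>B\<close> by
  that of \<open>Y\<close>, although \<open>Y\<close> is smaller than \<open>X\<close> on all of
  \<open>B\<close>.\<close>

lemma weak_upper_gradient_pathwise:
  assumes wug: "weak_upper_gradient m f G" and f: "f \<in> borel_measurable m"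
    and ts: "0 \<le> t" "t < s" "s \<le> 1"
  shows "AE \<gamma> in \<pi>. ennreal \<bar>f (\<gamma> s) - f (\<gamma> t)\<bar> \<le> path_work G \<gamma> {t..s}"
proof -
  have pos: "0 < s - t" using ts by simp
  have G: "G \<in> L2 m" "\<And>x. 0 \<le> G x" using wug by (auto simp: weak_upper_gradient_def)
  have fb [measurable]: "f \<in> borel_measurable borel" and Gb [measurable]: "G \<in> borel_measurable borel"
    using f L2_measurable[OF G(1)] by (simp_all add: measurable_cong_sets[OF sets_m refl])
  have t1: "t \<in> {0..1}" "s \<in> {0..1}" using ts by auto

  define X where "X = (\<lambda>\<gamma>::real \<Rightarrow> 'a. ennreal \<bar>f (\<gamma> s) - f (\<gamma> t)\<bar>)"
  define Y where "Y = (\<lambda>\<gamma>. joint_work G \<gamma> {t..s})"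
  have Xm [measurable]: "X \<in> borel_measurable \<pi>" unfolding X_def
    by (intro measurable_compose[OF _ measurable_ennreal] borel_measurable_abs borel_measurable_diff
           measurable_compose[OF eval_plan fb] t1)
  have Ym [measurable]: "Y \<in> borel_measurable \<pi>"
    unfolding Y_def by (rule set_work_measurable[OF L2_measurable[OF G(1)]]) simp
  have sub: "{t..s} \<subseteq> {0..1}" using ts by auto
  have Yeq: "AE \<gamma> in \<pi>. path_work G \<gamma> {t..s} = Y \<gamma>"
    unfolding Y_def by (rule AE_path_work[OF sub])
  have "(\<integral>\<^sup>+\<gamma>. Y \<gamma> \<partial>\<pi>) \<le> work G"
  proof -
    have "(\<integral>\<^sup>+\<gamma>. Y \<gamma> \<partial>\<pi>) \<le> (\<integral>\<^sup>+\<gamma>. (\<integral>\<^sup>+r. ennreal (G (eval_pair (\<gamma>, r)) * joint_speed (\<gamma>, r)) \<partial>lborel) \<partial>\<pi>)"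
      unfolding Y_def by (intro nn_integral_mono) (auto split: split_indicator)
    also have "\<dots> = work G" unfolding work_def by (rule lborel.nn_integral_fst) measurable
    finally show ?thesis .
  qed
  \<comment> \<open>Without finiteness the strict pointwise inequality on \<open>B\<close> would not
    give a strict inequality of integrals.\<close>
  then have Yfin: "(\<integral>\<^sup>+\<gamma>. Y \<gamma> \<partial>\<pi>) \<noteq> \<infinity>" using work_finite[OF G] by (auto simp: less_top top_unique)
  define B where "B = {\<gamma> \<in> space \<pi>. Y \<gamma> < X \<gamma>}"
  have B: "B \<in> sets \<pi>" unfolding B_def by measurable
  have "emeasure \<pi> B = 0"
  proof (rule ccontr)
    assume B0: "emeasure \<pi> B \<noteq> 0"
    let ?u = "uniform_measure \<pi> B" and ?\<rho> = "distr (uniform_measure \<pi> B) curve_borel (restr_curve t s)"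
    have tp: "test_plan m ?\<rho>" by (rule test_plan_restr[OF ts B B0])
    interpret r: plan m ?\<rho> by standard (use tp sets_m in auto)
    have rm: "restr_curve t s \<in> measurable ?u curve_borel"
      using restr_curve_measurable[OF ts]
      by (simp add: measurable_cong_sets[OF trans[OF sets_uniform_measure sets_plan] refl])
    have "(\<lambda>\<gamma>. ennreal \<bar>f (\<gamma> 1) - f (\<gamma> 0)\<bar>) \<in> borel_measurable (curve_borel :: (real \<Rightarrow> 'a) measure)"
      by (intro measurable_compose[OF _ measurable_ennreal] borel_measurable_abs borel_measurable_diff
           measurable_compose[OF eval_measurable fb]) auto
    then have "(\<integral>\<^sup>+\<gamma>. X \<gamma> \<partial>?u) = (\<integral>\<^sup>+\<gamma>. ennreal \<bar>f (\<gamma> 1) - f (\<gamma> 0)\<bar> \<partial>?\<rho>)"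
      by (subst nn_integral_distr[OF rm]) (simp_all add: restr_curve_def X_def)
    also have "\<dots> \<le> (\<integral>\<^sup>+\<gamma>. path_work G \<gamma> {0..1} \<partial>?\<rho>)"
      using wug tp unfolding weak_upper_gradient_def by blast
    \<comment> \<open>The path work is not known to be measurable in the curve. The image measure is
      therefore unfolded with the joint speed that belongs to the new plan, and the chosen speed is
      restored afterwards.\<close>
    also have "\<dots> = (\<integral>\<^sup>+\<gamma>. r.joint_work G \<gamma> {0..1} \<partial>?\<rho>)"
      by (rule nn_integral_cong_AE[OF r.AE_path_work]) simp
    also have "\<dots> = (\<integral>\<^sup>+\<gamma>. r.joint_work G (restr_curve t s \<gamma>) {0..1} \<partial>?u)"
      using r.set_work_measurable[OF L2_measurable[OF G(1)], of "{0..1}"]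
      by (intro nn_integral_distr[OF rm]) simp
    also have "\<dots> = (\<integral>\<^sup>+\<gamma>. path_work G (restr_curve t s \<gamma>) {0..1} \<partial>?u)"
      by (rule nn_integral_cong_AE) (use AE_distrD[OF rm r.AE_path_work[of "{0..1}" G]] in \<open>simp add: eq_commute\<close>)
    also have "\<dots> \<le> (\<integral>\<^sup>+\<gamma>. Y \<gamma> \<partial>?u)"
    proof (rule nn_integral_mono_AE)
      have "AE \<gamma> in \<pi>. path_work G (restr_curve t s \<gamma>) {0..1} \<le> Y \<gamma>"
        using AE_energy_finite Yeq AE_space
      proof eventually_elim
        case (elim \<gamma>)
        have ac: "abs_cont_curve \<gamma>" using elim(1) by (auto simp: curve_energy_def split: if_splits)
        \<comment> \<open>Clamp and cut-off only serve measurability; on \<open>[t, s]\<close> this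
          is the integrand of the path work of \<open>\<gamma>\<close>.\<close>
        define w where "w = (\<lambda>x. ennreal (G (\<gamma> (clamp01 x)) * (indicator {0..1} x * metric_speed \<gamma> x)) * indicator {t..s} x)"
        have m1: "(\<lambda>x. indicator {0..1} x * metric_speed \<gamma> x) \<in> borel_measurable borel"
          using curve_energy_abs_cont(1)[OF ac] by simp
        have m2: "(\<lambda>x. G (\<gamma> (clamp01 x))) \<in> borel_measurable borel"
        by (rule path_measurable[OF elim(3) L2_measurable[OF G(1)]])
        have wm: "w \<in> borel_measurable borel"
          unfolding w_def
          by (intro borel_measurable_times_ennreal measurable_compose[OF borel_measurable_times[OF m2 m1] measurable_ennreal]) simp
        have "path_work G (restr_curve t s \<gamma>) {0..1}
            \<le> (\<integral>\<^sup>+r. ennreal (s - t) * w (t + (s - t) * r) \<partial>lborel)"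
        proof (rule nn_integral_mono_AE, use curve_energy_restr_le(2)[OF elim(3,1) ts] in eventually_elim)
          case (elim r)
          show ?case
          proof (cases "r \<in> {0..1}")
            case True
            let ?v = "t + (s - t) * r"
            have v: "?v \<in> {0..1}" by (rule affine_in_unit[OF ts True])
            have "(s - t) * r \<le> s - t" "0 \<le> (s - t) * r" using True pos by (auto intro: mult_left_le)
            then have "?v \<in> {t..s}" unfolding atLeastAtMost_iff by (intro conjI) linarith+
            then have "w ?v = ennreal (G (\<gamma> ?v) * metric_speed \<gamma> ?v)"
              using v by (simp add: w_def)
            moreover have "G (restr_curve t s \<gamma> r) * metric_speed (restr_curve t s \<gamma>) r \<le> (s - t) * (G (\<gamma> ?v) * metric_speed \<gamma> ?v)"
              using mult_left_mono[of "metric_speed (restr_curve t s \<gamma>) r" "(s - t) * metric_speed \<gamma> ?v" "G (\<gamma> ?v)"] elim True G(2)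
              by (simp add: restr_curve_def mult_ac)
            ultimately show ?thesis using True pos by (simp add: ennreal_mult'[symmetric] ennreal_leI)
          qed simp
        qed
        also have "\<dots> = ennreal (s - t) * (\<integral>\<^sup>+r. w (t + (s - t) * r) \<partial>lborel)"
          by (rule nn_integral_cmult) (use wm in measurable)
        also have "\<dots> = (\<integral>\<^sup>+r. w r \<partial>lborel)"
          using nn_integral_real_affine[of w "s - t" t] wm pos by simp
        also have "\<dots> = path_work G \<gamma> {t..s}"
        proof (rule nn_integral_cong)
          fix r :: real
          show "w r = ennreal (G (\<gamma> r) * metric_speed \<gamma> r) * indicator {t..s} r"
            using sub by (cases "r \<in> {t..s}") (auto simp: w_def)
        qed
        finally show ?case using elim(2) by simp
      qed
      then show "AE \<gamma> in ?u. path_work G (restr_curve t s \<gamma>) {0..1} \<le> Y \<gamma>"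
        by (intro AE_uniform_measureI[OF B]) (auto elim: eventually_mono)
    qed
    finally have "(\<integral>\<^sup>+\<gamma>. X \<gamma> * indicator B \<gamma> \<partial>\<pi>) / emeasure \<pi> B \<le> (\<integral>\<^sup>+\<gamma>. Y \<gamma> * indicator B \<gamma> \<partial>\<pi>) / emeasure \<pi> B"
      by (simp only: nn_integral_uniform_measure[OF Xm B] nn_integral_uniform_measure[OF Ym B])
    then have "(\<integral>\<^sup>+\<gamma>. X \<gamma> * indicator B \<gamma> \<partial>\<pi>) / emeasure \<pi> B * emeasure \<pi> B \<le> (\<integral>\<^sup>+\<gamma>. Y \<gamma> * indicator B \<gamma> \<partial>\<pi>) / emeasure \<pi> B * emeasure \<pi> B"
      by (rule mult_right_mono) simp
    then have le: "(\<integral>\<^sup>+\<gamma>. X \<gamma> * indicator B \<gamma> \<partial>\<pi>) \<le> (\<integral>\<^sup>+\<gamma>. Y \<gamma> * indicator B \<gamma> \<partial>\<pi>)"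
      using B0 mult_divide_eq_ennreal[of "emeasure \<pi> B" 1] by (simp add: ennreal_divide_times)
    have "(\<integral>\<^sup>+\<gamma>. Y \<gamma> * indicator B \<gamma> \<partial>\<pi>) < (\<integral>\<^sup>+\<gamma>. X \<gamma> * indicator B \<gamma> \<partial>\<pi>)"
    proof (rule nn_integral_less)
      have "(\<integral>\<^sup>+\<gamma>. Y \<gamma> * indicator B \<gamma> \<partial>\<pi>) \<le> (\<integral>\<^sup>+\<gamma>. Y \<gamma> \<partial>\<pi>)"
        by (intro nn_integral_mono) (auto split: split_indicator)
      then show "(\<integral>\<^sup>+\<gamma>. Y \<gamma> * indicator B \<gamma> \<partial>\<pi>) \<noteq> \<infinity>" using Yfin by (auto simp: top_unique)
      show "AE \<gamma> in \<pi>. Y \<gamma> * indicator B \<gamma> \<le> X \<gamma> * indicator B \<gamma>"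
        by (intro AE_I2) (auto simp: B_def split: split_indicator)
      show "\<not> (AE \<gamma> in \<pi>. X \<gamma> * indicator B \<gamma> \<le> Y \<gamma> * indicator B \<gamma>)"
      proof
        assume "AE \<gamma> in \<pi>. X \<gamma> * indicator B \<gamma> \<le> Y \<gamma> * indicator B \<gamma>"
        then have "AE \<gamma> in \<pi>. \<gamma> \<notin> B"
          by eventually_elim (auto simp: B_def split: split_indicator_asm)
        then have "emeasure \<pi> B = 0" using B AE_iff_null_sets[OF B] by (simp add: null_sets_def)
        with B0 show False by simp
      qed
    qed (use B in measurable)
    with le show False by simp
  qed
  then have "AE \<gamma> in \<pi>. \<gamma> \<notin> B" using B by (intro AE_not_in) (simp add: null_sets_def)
  with Yeq AE_space show ?thesis
    by eventually_elim (auto simp: B_def X_def not_less)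
qed

end

section \<open>Weak upper gradients\<close>

lemma weak_upper_gradient_L2: "weak_upper_gradient m f G \<Longrightarrow> G \<in> L2 m"
  and weak_upper_gradient_nonneg: "weak_upper_gradient m f G \<Longrightarrow> 0 \<le> G x"
  by (auto simp: weak_upper_gradient_def)

lemma weak_upper_gradientI:
  assumes "sets m = sets borel" "G \<in> L2 m" "\<And>x. 0 \<le> G x"
    and "\<And>\<pi>. plan m \<pi> \<Longrightarrow> (\<integral>\<^sup>+\<gamma>. ennreal \<bar>f (\<gamma> 1) - f (\<gamma> 0)\<bar> \<partial>\<pi>) \<le> plan.work \<pi> G"
  shows "weak_upper_gradient m f G"
  unfolding weak_upper_gradient_def
proof (intro conjI allI impI)
  fix \<pi> assume "test_plan m \<pi>"
  then interpret plan m \<pi> by (intro plan.intro assms(1))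
  show "(\<integral>\<^sup>+\<gamma>. ennreal \<bar>f (\<gamma> 1) - f (\<gamma> 0)\<bar> \<partial>\<pi>)
     \<le> (\<integral>\<^sup>+\<gamma>. path_work G \<gamma> {0..1} \<partial>\<pi>)"
    unfolding work_eq[OF L2_measurable[OF assms(2)]] by (rule assms(4)) unfold_locales
qed (use assms in auto)

context plan begin

lemma weak_upper_gradient_work:
  assumes "weak_upper_gradient m f G"
  shows "(\<integral>\<^sup>+\<gamma>. ennreal \<bar>f (\<gamma> 1) - f (\<gamma> 0)\<bar> \<partial>\<pi>) \<le> work G"
  using assms test_plan unfolding work_eq[OF L2_measurable[OF weak_upper_gradient_L2[OF assms]], symmetric]
  by (simp add: weak_upper_gradient_def)

lemma endpoint_increment_measurable:
  assumes "f \<in> borel_measurable m"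
  shows "(\<lambda>\<gamma>. ennreal \<bar>f (\<gamma> 1) - f (\<gamma> 0)\<bar>) \<in> borel_measurable \<pi>"
proof -
  have fb: "f \<in> borel_measurable borel"
    using assms by (simp add: measurable_cong_sets[OF sets_m refl])
  show ?thesis
    by (intro measurable_compose[OF _ measurable_ennreal] borel_measurable_abs borel_measurable_diff
           measurable_compose[OF eval_plan fb]) auto
qed

end

section \<open>Linear operations and limits of weak upper gradients\<close>

lemma weak_upper_gradient_add:
  assumes m: "sets m = sets borel" and f: "f \<in> borel_measurable m" "weak_upper_gradient m f G"
    and h: "h \<in> borel_measurable m" "weak_upper_gradient m h H"
  shows "weak_upper_gradient m (\<lambda>x. f x + h x) (\<lambda>x. G x + H x)"
proof (rule weak_upper_gradientI[OF m])
  note L = weak_upper_gradient_L2[OF f(2)] weak_upper_gradient_L2[OF h(2)]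
  note N = weak_upper_gradient_nonneg[OF f(2)] weak_upper_gradient_nonneg[OF h(2)]
  show "(\<lambda>x. G x + H x) \<in> L2 m" by (rule L2_add[OF L])
  show "0 \<le> G x + H x" for x using N by simp
  fix \<pi> assume "plan m \<pi>"
  then interpret plan m \<pi> .
  have "(\<integral>\<^sup>+\<gamma>. ennreal \<bar>(f (\<gamma> 1) + h (\<gamma> 1)) - (f (\<gamma> 0) + h (\<gamma> 0))\<bar> \<partial>\<pi>)
      \<le> (\<integral>\<^sup>+\<gamma>. ennreal \<bar>f (\<gamma> 1) - f (\<gamma> 0)\<bar> + ennreal \<bar>h (\<gamma> 1) - h (\<gamma> 0)\<bar> \<partial>\<pi>)"
    by (intro nn_integral_mono) (simp add: ennreal_plus[symmetric] ennreal_leI del: ennreal_plus)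
  also have "\<dots> = (\<integral>\<^sup>+\<gamma>. ennreal \<bar>f (\<gamma> 1) - f (\<gamma> 0)\<bar> \<partial>\<pi>) + (\<integral>\<^sup>+\<gamma>. ennreal \<bar>h (\<gamma> 1) - h (\<gamma> 0)\<bar> \<partial>\<pi>)"
    by (intro nn_integral_add endpoint_increment_measurable f h)
  also have "\<dots> \<le> work G + work H"
    by (intro add_mono weak_upper_gradient_work f h)
  also have "\<dots> = work (\<lambda>x. G x + H x)"
    by (rule work_add[symmetric]) (use L[THEN L2_measurable] N in auto)
  finally show "(\<integral>\<^sup>+\<gamma>. ennreal \<bar>(f (\<gamma> 1) + h (\<gamma> 1)) - (f (\<gamma> 0) + h (\<gamma> 0))\<bar> \<partial>\<pi>) \<le> work (\<lambda>x. G x + H x)" .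
qed

lemma weak_upper_gradient_cmult:
  assumes m: "sets m = sets borel" and f: "f \<in> borel_measurable m" "weak_upper_gradient m f G"
  shows "weak_upper_gradient m (\<lambda>x. c * f x) (\<lambda>x. \<bar>c\<bar> * G x)"
proof (rule weak_upper_gradientI[OF m])
  note L = weak_upper_gradient_L2[OF f(2)] and N = weak_upper_gradient_nonneg[OF f(2)]
  show "(\<lambda>x. \<bar>c\<bar> * G x) \<in> L2 m" by (rule L2_cmult[OF L])
  show "0 \<le> \<bar>c\<bar> * G x" for x using N by simp
  fix \<pi> assume "plan m \<pi>"
  then interpret plan m \<pi> .
  have "(\<integral>\<^sup>+\<gamma>. ennreal \<bar>c * f (\<gamma> 1) - c * f (\<gamma> 0)\<bar> \<partial>\<pi>)
      = (\<integral>\<^sup>+\<gamma>. ennreal \<bar>c\<bar> * ennreal \<bar>f (\<gamma> 1) - f (\<gamma> 0)\<bar> \<partial>\<pi>)"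
    by (simp add: ennreal_mult'[symmetric] abs_mult[symmetric] right_diff_distrib)
  also have "\<dots> = ennreal \<bar>c\<bar> * (\<integral>\<^sup>+\<gamma>. ennreal \<bar>f (\<gamma> 1) - f (\<gamma> 0)\<bar> \<partial>\<pi>)"
    by (intro nn_integral_cmult endpoint_increment_measurable f)
  also have "\<dots> \<le> ennreal \<bar>c\<bar> * work G"
    by (intro mult_left_mono weak_upper_gradient_work f) simp
  also have "\<dots> = work (\<lambda>x. \<bar>c\<bar> * G x)"
    by (rule work_cmult[symmetric]) (use L2_measurable[OF L] in auto)
  finally show "(\<integral>\<^sup>+\<gamma>. ennreal \<bar>c * f (\<gamma> 1) - c * f (\<gamma> 0)\<bar> \<partial>\<pi>) \<le> work (\<lambda>x. \<bar>c\<bar> * G x)" .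
qed

lemma weak_upper_gradient_zero: "weak_upper_gradient m (\<lambda>x. 0) (\<lambda>x. 0)"
  by (simp add: weak_upper_gradient_def L2_zero)

text \<open>Under a test plan a.e. convergence passes to both end points, and Fatou's lemma handles
  the increments. On the other side \<open>G n\<close> is at most \<open>H\<close> plus the absolute
  difference, whose work is controlled by its \<open>L2\<close> norm.\<close>

lemma weak_upper_gradient_limit:
  assumes m: "sets m = sets borel"
    and f: "\<And>n. f n \<in> borel_measurable m" "\<And>n. weak_upper_gradient m (f n) (G n)"
    and lim: "AE x in m. (\<lambda>n. f n x) \<longlonglongrightarrow> h x"
    and G: "H \<in> L2 m" "\<And>x. 0 \<le> H x" "(\<lambda>n. l2norm m (\<lambda>x. G n x - H x)) \<longlonglongrightarrow> 0"
  shows "weak_upper_gradient m h H"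
proof (rule weak_upper_gradientI[OF m G(1,2)])
  note L = weak_upper_gradient_L2[OF f(2)] and N = weak_upper_gradient_nonneg[OF f(2)]
  fix \<pi> assume "plan m \<pi>"
  then interpret plan m \<pi> .
  let ?c = "sqrt compression * l2norm (\<pi> \<Otimes>\<^sub>M lborel) joint_speed"
  have "(\<integral>\<^sup>+\<gamma>. ennreal \<bar>h (\<gamma> 1) - h (\<gamma> 0)\<bar> \<partial>\<pi>) = (\<integral>\<^sup>+\<gamma>. liminf (\<lambda>n. ennreal \<bar>f n (\<gamma> 1) - f n (\<gamma> 0)\<bar>) \<partial>\<pi>)"
  proof (rule nn_integral_cong_AE)
    have "AE \<gamma> in \<pi>. (\<lambda>n. f n (\<gamma> 0)) \<longlonglongrightarrow> h (\<gamma> 0)" "AE \<gamma> in \<pi>. (\<lambda>n. f n (\<gamma> 1)) \<longlonglongrightarrow> h (\<gamma> 1)"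
      by (rule AE_eval[OF _ lim], simp)+
    then show "AE \<gamma> in \<pi>. ennreal \<bar>h (\<gamma> 1) - h (\<gamma> 0)\<bar> = liminf (\<lambda>n. ennreal \<bar>f n (\<gamma> 1) - f n (\<gamma> 0)\<bar>)"
    proof eventually_elim
      case (elim \<gamma>)
      then have "(\<lambda>n. ennreal \<bar>f n (\<gamma> 1) - f n (\<gamma> 0)\<bar>) \<longlonglongrightarrow> ennreal \<bar>h (\<gamma> 1) - h (\<gamma> 0)\<bar>"
        by (intro tendsto_ennrealI tendsto_intros)
      from lim_imp_Liminf[OF sequentially_bot this] show ?case by (rule sym)
    qed
  qed
  also have "\<dots> \<le> liminf (\<lambda>n. \<integral>\<^sup>+\<gamma>. ennreal \<bar>f n (\<gamma> 1) - f n (\<gamma> 0)\<bar> \<partial>\<pi>)"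
    by (rule nn_integral_liminf) (rule endpoint_increment_measurable[OF f(1)])
  also have "\<dots> \<le> liminf (\<lambda>n. work H + ennreal (?c * l2norm m (\<lambda>x. G n x - H x)))"
  proof (intro Liminf_mono always_eventually allI)
    fix n
    let ?d = "\<lambda>x. \<bar>G n x - H x\<bar>"
    have d: "?d \<in> L2 m" by (intro L2_abs L2_diff L G)
    have "(\<integral>\<^sup>+\<gamma>. ennreal \<bar>f n (\<gamma> 1) - f n (\<gamma> 0)\<bar> \<partial>\<pi>) \<le> work (G n)"
      by (rule weak_upper_gradient_work[OF f(2)])
    also have "\<dots> \<le> work (\<lambda>x. H x + ?d x)" by (rule work_mono) simp
    also have "\<dots> = work H + work ?d"
      by (rule work_add) (use L2_measurable[OF d] L2_measurable[OF G(1)] G(2) in auto)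
    also have "work ?d \<le> ennreal (?c * l2norm m ?d)" by (rule work_le[OF d]) simp
    also have "l2norm m ?d = l2norm m (\<lambda>x. G n x - H x)" by (simp add: l2norm_def)
    finally show "(\<integral>\<^sup>+\<gamma>. ennreal \<bar>f n (\<gamma> 1) - f n (\<gamma> 0)\<bar> \<partial>\<pi>)
        \<le> work H + ennreal (?c * l2norm m (\<lambda>x. G n x - H x))" by simp
  qed
  also have "\<dots> = work H"
  proof (rule lim_imp_Liminf[OF sequentially_bot])
    have "(\<lambda>n. work H + ennreal (?c * l2norm m (\<lambda>x. G n x - H x))) \<longlonglongrightarrow> work H + ennreal (?c * 0)"
      by (intro tendsto_intros tendsto_ennrealI G)
    then show "(\<lambda>n. work H + ennreal (?c * l2norm m (\<lambda>x. G n x - H x))) \<longlonglongrightarrow> work H" by simp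
  qed
  finally show "(\<integral>\<^sup>+\<gamma>. ennreal \<bar>h (\<gamma> 1) - h (\<gamma> 0)\<bar> \<partial>\<pi>) \<le> work H" .
qed

section \<open>The minimum of two weak upper gradients and the minimal one\<close>

lemma dyadic_in_unit: "a \<le> 2^n \<Longrightarrow> real a / 2^n \<in> {0..1}"
proof -
  assume "a \<le> 2^n"
  then have "real a \<le> 2^n" using of_nat_le_iff[of a "2^n", where 'a=real] by simp
  then show ?thesis by (simp add: divide_le_eq)
qed

text \<open>A function that is only controlled at dyadic times has a continuous extension with the same bounds,
  so that the gauge argument of \<open>dist_le_integral_min\<close> applies.\<close>

lemma dyadic_dist_le_integral_min:
  fixes \<phi> :: "real \<Rightarrow> real"
  assumes g: "set_integrable lborel {0..1} g" and h: "set_integrable lborel {0..1} h"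
    and bg: "\<And>n a b. a < b \<Longrightarrow> b \<le> 2^n \<Longrightarrow>
      dist (\<phi> (real a / 2^n)) (\<phi> (real b / 2^n)) \<le> (LINT r:{real a / 2^n..real b / 2^n}|lborel. g r)"
    and bh: "\<And>n a b. a < b \<Longrightarrow> b \<le> 2^n \<Longrightarrow>
      dist (\<phi> (real a / 2^n)) (\<phi> (real b / 2^n)) \<le> (LINT r:{real a / 2^n..real b / 2^n}|lborel. h r)"
  shows "dist (\<phi> 0) (\<phi> 1) \<le> (LINT r:{0..1}|lborel. min (g r) (h r))"
proof -
  define D :: "real set" where "D = {0..1} \<inter> (\<Union>n a. {of_nat a / 2^n})"
  have D01: "D \<subseteq> {0..1}" unfolding D_def by blast
  have cl: "closure D = {0..1}"
    unfolding D_def using closure_dyadic_rationals_in_convex_set_pos_1[of "{0..1}"] by simp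
  have gi: "g integrable_on {0..1}" by (rule set_borel_integral_eq_integral(1)[OF g])
  \<comment> \<open>On dyadic points the increments of \<open>\<phi>\<close> are dominated by those
    of this primitive, which is uniformly continuous. So \<open>\<phi>\<close> is uniformly
    continuous there and extends to the closure.\<close>
  define F where "F = (\<lambda>u. integral {0..u} g)"
  have F: "uniformly_continuous_on {0..1} F"
    unfolding F_def by (intro compact_uniformly_continuous indefinite_integral_continuous_1 gi) simp
  have le: "dist (\<phi> t) (\<phi> s) \<le> dist (F t) (F s)" if "t \<in> D" "s \<in> D" "t \<le> s" for t s
  proof (cases "t = s")
    case False
    have ts01: "0 \<le> t" "t \<le> 1" "0 \<le> s" "s \<le> 1" using D01 that(1,2) by (meson atLeastAtMost_iff subsetD)+
    obtain a n b k where ab: "t = real a / 2^n" "a \<le> 2^n" "s = real b / 2^k" "b \<le> 2^k"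
    proof -
      obtain a n b k where *: "t = real a / 2^n" "s = real b / 2^k" "t \<le> 1" "s \<le> 1"
        using \<open>t \<in> D\<close> \<open>s \<in> D\<close> unfolding D_def by auto
      have "real a \<le> real (2^n)" "real b \<le> real (2^k)" using *(3,4) unfolding *(1,2) by (simp_all add: divide_le_eq)
      then have "a \<le> 2^n" "b \<le> 2^k" by (simp_all only: of_nat_le_iff)
      with * that show thesis by blast
    qed
    \<comment> \<open>A common denominator for points of two dyadic levels.\<close>
    let ?a = "a * 2^k" and ?b = "b * 2^n" and ?N = "n + k"
    have t: "t = real ?a / 2^?N" and s: "s = real ?b / 2^?N" by (simp_all add: ab power_add)
    have "?a < ?b"
    proof (rule ccontr)
      assume "\<not> ?a < ?b"
      then have "real ?b \<le> real ?a" by (simp only: of_nat_le_iff not_less)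
      then have "real ?b / 2^?N \<le> real ?a / 2^?N" by (rule divide_right_mono) simp
      then have "s \<le> t" by (simp only: t s)
      then show False using \<open>t \<le> s\<close> False by simp
    qed
    moreover have "?b \<le> 2^?N" using ab(4) by (simp add: power_add)
    ultimately have "dist (\<phi> t) (\<phi> s) \<le> (LINT r:{t..s}|lborel. g r)"
      unfolding t s by (rule bg)
    also have "\<dots> = integral {t..s} g"
      using D01 that by (intro set_borel_integral_eq_integral(2) set_integrable_subset[OF g]) auto
    also have "\<dots> = F s - F t"
    proof -
      have "g integrable_on {0..s}" using ts01 by (intro integrable_on_subinterval[OF gi]) simp
      then have "F t + integral {t..s} g = F s"
        unfolding F_def using ts01 \<open>t \<le> s\<close> by (intro Henstock_Kurzweil_Integration.integral_combine) simp_all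
      then show ?thesis by simp
    qed
    also have "\<dots> \<le> dist (F t) (F s)" by (simp add: dist_real_def)
    finally show ?thesis .
  qed simp
  have uc: "uniformly_continuous_on D \<phi>"
    unfolding uniformly_continuous_on_def
  proof (intro allI impI)
    fix e :: real assume "0 < e"
    then obtain d where d: "d > 0" "\<And>x x'. x \<in> {0..1} \<Longrightarrow> x' \<in> {0..1} \<Longrightarrow> dist x' x < d \<Longrightarrow> dist (F x') (F x) < e"
      using F unfolding uniformly_continuous_on_def by blast
    have "dist (\<phi> x') (\<phi> x) < e" if "x \<in> D" "x' \<in> D" "dist x' x < d" for x x'
    proof -
      have "dist (\<phi> x') (\<phi> x) \<le> dist (F x') (F x)"
        using le[OF that(1,2)] le[OF that(2,1)] by (cases "x \<le> x'") (simp_all add: dist_commute)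
      also have "\<dots> < e" using d(2)[of x x'] that D01 by blast
      finally show ?thesis .
    qed
    with d(1) show "\<exists>d>0. \<forall>x\<in>D. \<forall>x'\<in>D. dist x' x < d \<longrightarrow> dist (\<phi> x') (\<phi> x) < e" by blast
  qed
  obtain \<psi> where uc': "uniformly_continuous_on (closure D) \<psi>" and eq: "\<And>x. x \<in> D \<Longrightarrow> \<phi> x = \<psi> x"
    by (rule uniformly_continuous_on_extension_on_closure[OF uc]) (rule that)
  from uc' have cont: "continuous_on {0..1} \<psi>" unfolding cl by (rule uniformly_continuous_imp_continuous)
  have inD: "real a / 2^n \<in> D" if "a \<le> 2^n" for a n using that unfolding D_def using dyadic_in_unit[OF that] by blast
  \<comment> \<open>The bounds are given over closed intervals, whereas the passage from dyadic to
    all times takes half-open ones.\<close>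
  have half: "(LINT r:{real a / 2^n..<real b / 2^n}|lborel. u r) = (LINT r:{real a / 2^n..real b / 2^n}|lborel. u r)"
    if u: "set_integrable lborel {0..1} u" and ab: "a \<le> b" "b \<le> 2^n" for u :: "real \<Rightarrow> real" and a b n
    unfolding set_lebesgue_integral_def
  proof (rule integral_cong_AE)
    have sub: "{real a / 2^n..real b / 2^n} \<subseteq> {0..1}" "{real a / 2^n..<real b / 2^n} \<subseteq> {0..1}"
    proof -
      have "0 \<le> real a / 2^n" "real b / 2^n \<le> 1"
        using dyadic_in_unit[of a n] dyadic_in_unit[of b n] ab unfolding atLeastAtMost_iff by (blast intro: order_trans)+
      then show "{real a / 2^n..real b / 2^n} \<subseteq> {0..1}" "{real a / 2^n..<real b / 2^n} \<subseteq> {0..1}"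
        unfolding subset_iff atLeastAtMost_iff atLeastLessThan_iff by (blast intro: order_trans less_imp_le)+
    qed
    show "(\<lambda>r. indicator {real a / 2^n..<real b / 2^n} r *\<^sub>R u r) \<in> borel_measurable lborel"
      "(\<lambda>r. indicator {real a / 2^n..real b / 2^n} r *\<^sub>R u r) \<in> borel_measurable lborel"
      using set_integrable_subset[OF u _ sub(1)] set_integrable_subset[OF u _ sub(2)]
      by (auto simp: set_integrable_def)
    show "AE r in lborel. indicator {real a / 2^n..<real b / 2^n} r *\<^sub>R u r = indicator {real a / 2^n..real b / 2^n} r *\<^sub>R u r"
      using AE_lborel_singleton[of "real b / 2^n"] by eventually_elim (auto simp: indicator_def)
  qed
  have bound: "dist (\<psi> t) (\<psi> s) \<le> (LINT r:{t..s}|lborel. u r)"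
    if u: "set_integrable lborel {0..1} u" and bu: "\<And>n a b. a < b \<Longrightarrow> b \<le> 2^n \<Longrightarrow>
      dist (\<phi> (real a / 2^n)) (\<phi> (real b / 2^n)) \<le> (LINT r:{real a / 2^n..real b / 2^n}|lborel. u r)"
    and ts: "0 \<le> t" "t < s" "s \<le> 1" for u t s
  proof (rule dist_le_integral_of_dyadic[OF cont u _ ts])
    fix n a b :: nat assume ab: "a \<le> b" "b \<le> 2^n"
    show "dist (\<psi> (real a / 2^n)) (\<psi> (real b / 2^n)) \<le> (LINT r:{real a / 2^n..<real b / 2^n}|lborel. u r)"
    proof (cases "a = b")
      case False
      then show ?thesis
        unfolding half[OF u ab] using bu[of a b n] ab eq[OF inD[of a n]] eq[OF inD[of b n]] by auto
    qed (simp add: set_lebesgue_integral_def)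
  qed
  have "dist (\<psi> 0) (\<psi> 1) \<le> (LINT r:{0..1}|lborel. min (g r) (h r))"
    by (rule dist_le_integral_min[OF g h]) (use bound[OF g bg] bound[OF h bh] in auto)
  \<comment> \<open>0 and 1 are the dyadic points of level 0, where extension and original
    agree.\<close>
  then show ?thesis using eq[OF inD[of 0 0]] eq[OF inD[of 1 0]] by simp
qed

lemma L2_min:
  assumes "G \<in> L2 m" "H \<in> L2 m" "\<And>x. 0 \<le> G x" "\<And>x. 0 \<le> H x"
  shows "(\<lambda>x. min (G x) (H x)) \<in> L2 m"
  by (rule L2_bound[OF assms(1)]) (use assms(3,4) L2_measurable[OF assms(1)] L2_measurable[OF assms(2)] in \<open>auto simp: abs_of_nonneg min_def\<close>)

text \<open>There are countably many pairs of dyadic times, so one null set of curves serves all the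
  pathwise inequalities. Finite work makes them inequalities between Bochner integrals, the form in
  which the gauge argument takes them.\<close>

lemma (in plan) AE_path_integrable:
  assumes wug: "weak_upper_gradient m f G" and f: "f \<in> borel_measurable m"
  shows "AE \<gamma> in \<pi>. set_integrable lborel {0..1} (\<lambda>r. G (\<gamma> r) * metric_speed \<gamma> r) \<and>
    (\<forall>n a b. a < b \<longrightarrow> b \<le> 2^n \<longrightarrow> dist (f (\<gamma> (real a / 2^n))) (f (\<gamma> (real b / 2^n)))
       \<le> (LINT r:{real a / 2^n..real b / 2^n}|lborel. G (\<gamma> r) * metric_speed \<gamma> r))"
proof -
  note G = weak_upper_gradient_L2[OF wug] and G0 = weak_upper_gradient_nonneg[OF wug]
  have fin: "AE \<gamma> in \<pi>. path_work G \<gamma> {0..1} \<noteq> \<infinity>"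
  proof -
    \<comment> \<open>Finiteness a.e. is obtained for the version that is measurable in the curve
      and then carried back.\<close>
    let ?Y = "\<lambda>\<gamma>. joint_work G \<gamma> {0..1}"
    have "(\<integral>\<^sup>+\<gamma>. ?Y \<gamma> \<partial>\<pi>) = work G"
      unfolding work_eq[OF L2_measurable[OF G], symmetric]
      by (rule nn_integral_cong_AE) (use AE_path_work[of "{0..1}" G] in \<open>simp add: eq_commute\<close>)
    then have "AE \<gamma> in \<pi>. ?Y \<gamma> \<noteq> \<infinity>"
      using work_finite[OF G G0]
      by (intro nn_integral_PInf_AE set_work_measurable[OF L2_measurable[OF G]]) (simp_all add: less_top)
    then show ?thesis using AE_path_work[OF order_refl, of G] by eventually_elim simp
  qed
  have bounds: "AE \<gamma> in \<pi>. \<forall>n a b. a < b \<longrightarrow> b \<le> 2^n \<longrightarrow> ennreal \<bar>f (\<gamma> (real b / 2^n)) - f (\<gamma> (real a / 2^n))\<bar>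
       \<le> path_work G \<gamma> {real a / 2^n..real b / 2^n}"
    unfolding AE_all_countable
  proof (intro allI)
    fix n a b :: nat
    show "AE \<gamma> in \<pi>. a < b \<longrightarrow> b \<le> 2^n \<longrightarrow> ennreal \<bar>f (\<gamma> (real b / 2^n)) - f (\<gamma> (real a / 2^n))\<bar>
       \<le> path_work G \<gamma> {real a / 2^n..real b / 2^n}"
    proof (cases "a < b \<and> b \<le> 2^n")
      case True
      have "real a / 2^n < real b / 2^n" using True by (intro divide_strict_right_mono) auto
      with True weak_upper_gradient_pathwise[OF wug f, of "real a / 2^n" "real b / 2^n"] dyadic_in_unit[of b n]
      show ?thesis by simp
    qed auto
  qed
  show ?thesis
    using AE_energy_finite AE_space fin bounds
  proof eventually_elim
    case (elim \<gamma>)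
    let ?g = "\<lambda>r. G (\<gamma> r) * metric_speed \<gamma> r"
    have ac: "abs_cont_curve \<gamma>" using elim(1) by (auto simp: curve_energy_def split: if_splits)
    have nn: "AE r in lborel. r \<in> {0..1} \<longrightarrow> 0 \<le> metric_speed \<gamma> r"
      by (rule speed_bound_nonneg_AE[OF speed_bound_metric_speed[OF ac]])
    have m1: "(\<lambda>x. indicator {0..1} x * metric_speed \<gamma> x) \<in> borel_measurable borel"
      using curve_energy_abs_cont(1)[OF ac] by simp
    have m2: "(\<lambda>x. G (\<gamma> (clamp01 x))) \<in> borel_measurable borel"
    by (rule path_measurable[OF elim(2) L2_measurable[OF G]])
    \<comment> \<open>The clamp changes nothing on the unit interval and exhibits the cut-off
      integrand as a product of two Borel functions.\<close>
    have "(\<lambda>x. indicator {0..1} x *\<^sub>R ?g x) = (\<lambda>x. G (\<gamma> (clamp01 x)) * (indicator {0..1} x * metric_speed \<gamma> x))"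
      by (auto simp: fun_eq_iff split: split_indicator)
    then have gm: "(\<lambda>x. indicator {0..1} x *\<^sub>R ?g x) \<in> borel_measurable lborel"
      using borel_measurable_times[OF m2 m1] by simp
    have nn': "AE x in lborel. 0 \<le> indicator {0..1} x *\<^sub>R ?g x"
      using nn by eventually_elim (auto simp: G0 split: split_indicator)
    have "(\<integral>\<^sup>+x. ennreal (indicator {0..1} x *\<^sub>R ?g x) \<partial>lborel) < \<infinity>"
    proof -
      have "(\<integral>\<^sup>+x. ennreal (indicator {0..1} x *\<^sub>R ?g x) \<partial>lborel) = (\<integral>\<^sup>+t\<in>{0..1}. ennreal (?g t) \<partial>lborel)"
        by (intro nn_integral_cong) (auto split: split_indicator)
      then show ?thesis using elim(3) by (simp add: less_top)
    qed
    then have i: "set_integrable lborel {0..1} ?g"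
      unfolding set_integrable_def using nn' gm by (intro integrableI_nonneg)
    moreover have "dist (f (\<gamma> (real a / 2^n))) (f (\<gamma> (real b / 2^n)))
       \<le> (LINT r:{real a / 2^n..real b / 2^n}|lborel. ?g r)" if ab: "a < b" "b \<le> 2^n" for n a b
    proof -
      let ?A = "{real a / 2^n..real b / 2^n}"
      have sub: "?A \<subseteq> {0..1}"
        using dyadic_in_unit[of a n] dyadic_in_unit[of b n] ab
        unfolding subset_iff atLeastAtMost_iff by (meson less_imp_le_nat order_trans)
      have ii: "integrable lborel (\<lambda>x. indicator ?A x *\<^sub>R ?g x)"
        using set_integrable_subset[OF i _ sub] by (simp add: set_integrable_def)
      have "AE x in lborel. 0 \<le> indicator ?A x *\<^sub>R ?g x"
        using nn
      proof eventually_elim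
        case (elim x)
        then show ?case using subsetD[OF sub, of x] G0[of "\<gamma> x"] by (cases "x \<in> ?A") (simp_all del: atLeastAtMost_iff)
      qed
      from nn_integral_eq_integral[OF ii this]
      have "(\<integral>\<^sup>+r\<in>?A. ennreal (?g r) \<partial>lborel) = ennreal (LINT r:?A|lborel. ?g r)"
        unfolding set_lebesgue_integral_def
        by (subst (asm) nn_integral_cong[where v="\<lambda>r. ennreal (?g r) * indicator ?A r"]) (auto split: split_indicator)
      moreover have "ennreal \<bar>f (\<gamma> (real b / 2^n)) - f (\<gamma> (real a / 2^n))\<bar> \<le> (\<integral>\<^sup>+r\<in>?A. ennreal (?g r) \<partial>lborel)"
        using elim(4) ab by blast
      moreover have "0 \<le> (LINT r:?A|lborel. ?g r)"
        unfolding set_lebesgue_integral_def by (rule integral_nonneg_AE) fact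
      ultimately show ?thesis by (simp add: dist_real_def abs_minus_commute)
    qed
    ultimately show ?case by blast
  qed
qed

text \<open>The metric speed is a.e. non-negative, so along a curve the minimum of the two
  integrands is the minimum of the gradients times the speed. The dyadic bounds for both gradients
  are combined along almost every curve and then integrated.\<close>

lemma weak_upper_gradient_min:
  assumes m: "sets m = sets borel" and f: "f \<in> borel_measurable m"
    and G: "weak_upper_gradient m f G" and H: "weak_upper_gradient m f H"
  shows "weak_upper_gradient m f (\<lambda>x. min (G x) (H x))"
proof (rule weak_upper_gradientI[OF m])
  note L = weak_upper_gradient_L2[OF G] weak_upper_gradient_L2[OF H]
  note N = weak_upper_gradient_nonneg[OF G] weak_upper_gradient_nonneg[OF H]
  show Lm: "(\<lambda>x. min (G x) (H x)) \<in> L2 m" by (rule L2_min[OF L N])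
  show "0 \<le> min (G x) (H x)" for x using N by simp
  fix \<pi> assume "plan m \<pi>"
  then interpret plan m \<pi> .
  have "(\<integral>\<^sup>+\<gamma>. ennreal \<bar>f (\<gamma> 1) - f (\<gamma> 0)\<bar> \<partial>\<pi>)
     \<le> (\<integral>\<^sup>+\<gamma>. (\<integral>\<^sup>+t\<in>{0..1}. ennreal (min (G (\<gamma> t)) (H (\<gamma> t)) * metric_speed \<gamma> t) \<partial>lborel) \<partial>\<pi>)"
  proof (rule nn_integral_mono_AE, use AE_path_integrable[OF G f] AE_path_integrable[OF H f] AE_energy_finite in eventually_elim)
    case (elim \<gamma>)
    let ?g = "\<lambda>r. G (\<gamma> r) * metric_speed \<gamma> r" and ?h = "\<lambda>r. H (\<gamma> r) * metric_speed \<gamma> r"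
    have ac: "abs_cont_curve \<gamma>" using elim(3) by (auto simp: curve_energy_def split: if_splits)
    have nn: "AE r in lborel. r \<in> {0..1} \<longrightarrow> 0 \<le> metric_speed \<gamma> r"
      by (rule speed_bound_nonneg_AE[OF speed_bound_metric_speed[OF ac]])
    have i: "integrable lborel (\<lambda>r. indicator {0..1} r *\<^sub>R min (?g r) (?h r))"
      using set_integrable_min[OF conjunct1[OF elim(1)] conjunct1[OF elim(2)]] unfolding set_integrable_def .
    have "dist (f (\<gamma> 0)) (f (\<gamma> 1)) \<le> (LINT r:{0..1}|lborel. min (?g r) (?h r))"
      using dyadic_dist_le_integral_min[of ?g ?h "\<lambda>r. f (\<gamma> r)"] elim(1,2) by meson
    then have "ennreal \<bar>f (\<gamma> 1) - f (\<gamma> 0)\<bar> \<le> ennreal (LINT r:{0..1}|lborel. min (?g r) (?h r))"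
      by (intro ennreal_leI) (simp add: dist_real_def abs_minus_commute)
    also have "\<dots> = (\<integral>\<^sup>+r. ennreal (indicator {0..1} r *\<^sub>R min (?g r) (?h r)) \<partial>lborel)"
      unfolding set_lebesgue_integral_def
      by (rule nn_integral_eq_integral[OF i, symmetric])
         (use nn in \<open>eventually_elim, auto simp: N split: split_indicator\<close>)
    also have "\<dots> = (\<integral>\<^sup>+t\<in>{0..1}. ennreal (min (G (\<gamma> t)) (H (\<gamma> t)) * metric_speed \<gamma> t) \<partial>lborel)"
      by (rule nn_integral_cong_AE, use nn in eventually_elim)
         (auto simp: min_mult_distrib_right split: split_indicator)
    finally show ?case .
  qed
  then show "(\<integral>\<^sup>+\<gamma>. ennreal \<bar>f (\<gamma> 1) - f (\<gamma> 0)\<bar> \<partial>\<pi>) \<le> work (\<lambda>x. min (G x) (H x))"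
    unfolding work_eq[OF L2_measurable[OF Lm]] .
qed

text \<open>The scheme of \<open>ex_minimal_speed\<close> with the \<open>L2\<close> norm in place
  of the integral: stability under limits gives a gradient of least norm, and minima with
  competitors turn least norm into minimality a.e.\<close>

lemma ex_minimal_weak_upper_gradient:
  assumes m: "sets m = sets borel" and f: "f \<in> borel_measurable m" and G0: "weak_upper_gradient m f G0"
  shows "\<exists>G. weak_upper_gradient m f G \<and> (\<forall>H. weak_upper_gradient m f H \<longrightarrow> (AE x in m. G x \<le> H x))"
proof -
  let ?X = "l2norm m ` {G. weak_upper_gradient m f G}"
  have bdd: "bdd_below ?X" by (rule bdd_belowI[of _ 0]) auto
  have ne: "?X \<noteq> {}" using G0 by auto
  have "\<exists>g. weak_upper_gradient m f g \<and> l2norm m g < Inf ?X + 1 / real (Suc k)" for k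
    using cInf_lessD[OF ne, of "Inf ?X + 1 / real (Suc k)"] by auto
  then obtain u where u: "\<And>k. weak_upper_gradient m f (u k)" "\<And>k. l2norm m (u k) < Inf ?X + 1 / real (Suc k)"
    by metis
  define G where "G = rec_nat (u 0) (\<lambda>k v r. min (v r) (u (Suc k) r))"
  have GZ: "G 0 = u 0" and GS: "G (Suc k) = (\<lambda>r. min (G k r) (u (Suc k) r))" for k
    by (simp_all add: G_def)
  have sb: "weak_upper_gradient m f (G k)" for k
    by (induction k) (simp_all only: GZ GS u weak_upper_gradient_min[OF m f])
  note L = weak_upper_gradient_L2[OF sb] and N = weak_upper_gradient_nonneg[OF sb]
  have dec: "decseq (\<lambda>k. G k r)" for r by (rule decseq_SucI) (simp add: GS)
  have Gle: "G k r \<le> u k r" for k r by (cases k) (simp_all add: GZ GS)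
  \<comment> \<open>Weak upper gradients are non-negative at every point, so the decreasing sequence
    converges everywhere and not only a.e.\<close>
  have "convergent (\<lambda>k. G k r)" for r
    using decseq_convergent[OF dec[of r], of 0] N by (metis convergentI)
  then have lim: "(\<lambda>k. G k r) \<longlonglongrightarrow> lim (\<lambda>k. G k r)" for r by (simp add: convergent_LIMSEQ_iff)
  define g where "g = (\<lambda>r. lim (\<lambda>k. G k r))"
  have gm: "g \<in> borel_measurable m" unfolding g_def using L[THEN L2_measurable] by (rule borel_measurable_lim_metric)
  have g0: "0 \<le> g r" and gle: "g r \<le> G k r" for r k
    unfolding g_def using LIMSEQ_le_const[OF lim] N decseq_ge[OF dec lim] by blast+
  have gL: "g \<in> L2 m" by (rule L2_bound[OF L[of 0] gm]) (use g0 gle N in auto)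
  have conv: "(\<lambda>k. l2norm m (\<lambda>x. G k x - g x)) \<longlonglongrightarrow> 0"
  proof -
    have "(\<lambda>k. \<integral>x. (G k x - g x)\<^sup>2 \<partial>m) \<longlonglongrightarrow> (\<integral>x. 0 \<partial>m)"
    proof (rule integral_dominated_convergence[where w="\<lambda>x. (G 0 x)\<^sup>2"])
      show "(\<lambda>x. (G k x - g x)\<^sup>2) \<in> borel_measurable m" for k using L[THEN L2_measurable] gm by measurable
      show "integrable m (\<lambda>x. (G 0 x)\<^sup>2)" by (rule L2_square_integrable[OF L])
      show "AE x in m. (\<lambda>k. (G k x - g x)\<^sup>2) \<longlonglongrightarrow> 0"
      proof (rule AE_I2)
        fix x
        have "(\<lambda>k. (G k x - g x)\<^sup>2) \<longlonglongrightarrow> (g x - g x)\<^sup>2" unfolding g_def by (intro tendsto_intros lim)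
        then show "(\<lambda>k. (G k x - g x)\<^sup>2) \<longlonglongrightarrow> 0" by simp
      qed
      show "AE x in m. norm ((G k x - g x)\<^sup>2) \<le> (G 0 x)\<^sup>2" for k
      proof (rule AE_I2)
        fix x
        have "G k x \<le> G 0 x" using dec[of x] by (auto simp: decseq_def)
        then have "(G k x - g x)\<^sup>2 \<le> (G 0 x)\<^sup>2" using g0[of x] gle[of x k] by (intro power_mono) auto
        then show "norm ((G k x - g x)\<^sup>2) \<le> (G 0 x)\<^sup>2" by simp
      qed
    qed simp
    then have "(\<lambda>k. sqrt (\<integral>x. (G k x - g x)\<^sup>2 \<partial>m)) \<longlonglongrightarrow> sqrt 0" by (intro tendsto_real_sqrt) simp
    then show ?thesis by (simp add: l2norm_def)
  qed
  have wg: "weak_upper_gradient m f g"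
    by (rule weak_upper_gradient_limit[OF m f sb _ gL g0 conv]) simp
  have "l2norm m g \<le> Inf ?X"
  proof (rule LIMSEQ_le)
    show "(\<lambda>k. l2norm m (G k)) \<longlonglongrightarrow> l2norm m g" by (rule l2norm_tendsto[OF L gL conv])
    show "(\<lambda>k. Inf ?X + 1 / real (Suc k)) \<longlonglongrightarrow> Inf ?X"
      using tendsto_add[OF tendsto_const LIMSEQ_inverse_real_of_nat] by (simp add: inverse_eq_divide)
    have "l2norm m (G k) \<le> l2norm m (u k)" for k
      by (rule l2norm_mono_AE[OF weak_upper_gradient_L2[OF u(1)] L2_measurable[OF L]])
         (intro AE_I2, use Gle N order_trans[OF N Gle] in simp)
    then show "\<exists>N. \<forall>k\<ge>N. l2norm m (G k) \<le> Inf ?X + 1 / real (Suc k)"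
      using u(2) by (meson less_imp_le order_trans)
  qed
  have "AE x in m. g x \<le> h x" if h: "weak_upper_gradient m f h" for h
  proof -
    note w = weak_upper_gradient_min[OF m f wg h]
    note i = L2_square_integrable[OF gL] L2_square_integrable[OF weak_upper_gradient_L2[OF w]]
    \<comment> \<open>The minimum lies between 0 and \<open>g\<close>, so this difference of squares
      is non-negative; least norm forces its integral to vanish.\<close>
    let ?f = "\<lambda>x. (g x)\<^sup>2 - (min (g x) (h x))\<^sup>2"
    have pos: "0 \<le> ?f x" for x
      using g0[of x] weak_upper_gradient_nonneg[OF h, of x] by (simp add: power_mono)
    have "l2norm m g \<le> l2norm m (\<lambda>x. min (g x) (h x))"
      using \<open>l2norm m g \<le> Inf ?X\<close> cInf_lower[OF imageI bdd, of "\<lambda>x. min (g x) (h x)", OF CollectI, OF w]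
      by (rule order_trans)
    then have "(l2norm m g)\<^sup>2 \<le> (l2norm m (\<lambda>x. min (g x) (h x)))\<^sup>2" by (intro power_mono) auto
    then have "(\<integral>x. ?f x \<partial>m) \<le> 0" using i by (simp add: l2norm_power2)
    moreover have "0 \<le> (\<integral>x. ?f x \<partial>m)" by (rule Bochner_Integration.integral_nonneg) (rule pos)
    ultimately have "(\<integral>x. ?f x \<partial>m) = 0" by linarith
    then have "AE x in m. ?f x = 0"
      by (subst (asm) integral_nonneg_eq_0_iff_AE[OF Bochner_Integration.integrable_diff[OF i]]) (use pos in auto)
    then show ?thesis
    proof eventually_elim
      case (elim x)
      then have "(g x)\<^sup>2 = (min (g x) (h x))\<^sup>2" by (simp only: right_minus_eq)
      then have "g x = min (g x) (h x)"
        by (rule power2_eq_imp_eq[OF _ g0]) (simp only: min.boundedI g0 weak_upper_gradient_nonneg[OF h])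
      then show ?case by (metis min.cobounded2)
    qed
  qed
  with wg show ?thesis by blast
qed

section \<open>Seminormed spaces, completion and Mazur's lemma\<close>

lemma UN_eq_const: "a \<in> A \<Longrightarrow> (\<And>x. x \<in> A \<Longrightarrow> f x = K) \<Longrightarrow> (\<Union>x\<in>A. f x) = K"
  by blast

text \<open>Zero is not a component of the record: every \<open>vscale V 0 u\<close> stands for it,
  and \<open>zero_add\<close> makes it neutral. The norm may vanish on non-zero vectors, as it does
  on a.e. null functions in \<open>L2_space\<close>.\<close>

locale seminormed =
  fixes V :: "'v nspace"
  assumes nonempty: "vecs V \<noteq> {}"
    and add_closed [simp]: "u \<in> vecs V \<Longrightarrow> v \<in> vecs V \<Longrightarrow> vadd V u v \<in> vecs V"
    and scale_closed [simp]: "u \<in> vecs V \<Longrightarrow> vscale V c u \<in> vecs V"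
    and add_comm: "u \<in> vecs V \<Longrightarrow> v \<in> vecs V \<Longrightarrow> vadd V u v = vadd V v u"
    and add_assoc: "u \<in> vecs V \<Longrightarrow> v \<in> vecs V \<Longrightarrow> w \<in> vecs V \<Longrightarrow>
      vadd V (vadd V u v) w = vadd V u (vadd V v w)"
    and scale_add: "u \<in> vecs V \<Longrightarrow> v \<in> vecs V \<Longrightarrow> vscale V c (vadd V u v) = vadd V (vscale V c u) (vscale V c v)"
    and add_scale: "u \<in> vecs V \<Longrightarrow> vscale V (a + b) u = vadd V (vscale V a u) (vscale V b u)"
    and scale_scale: "u \<in> vecs V \<Longrightarrow> vscale V a (vscale V b u) = vscale V (a * b) u"
    and scale_one: "u \<in> vecs V \<Longrightarrow> vscale V 1 u = u"
    and zero_add: "u \<in> vecs V \<Longrightarrow> v \<in> vecs V \<Longrightarrow> vadd V (vscale V 0 u) v = v"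
    and norm_triangle: "u \<in> vecs V \<Longrightarrow> v \<in> vecs V \<Longrightarrow> vnorm V (vadd V u v) \<le> vnorm V u + vnorm V v"
    and norm_scale: "u \<in> vecs V \<Longrightarrow> vnorm V (vscale V c u) = \<bar>c\<bar> * vnorm V u"
begin

lemma zero_unique: "u \<in> vecs V \<Longrightarrow> v \<in> vecs V \<Longrightarrow> vscale V 0 u = vscale V 0 v"
  by (metis add_comm scale_closed zero_add)

lemma add_neg: "u \<in> vecs V \<Longrightarrow> vadd V u (vscale V (-1) u) = vscale V 0 u"
  using add_scale[of u 1 "-1"] by (simp add: scale_one)

lemma scale_0_scale: "u \<in> vecs V \<Longrightarrow> vscale V c (vscale V 0 u) = vscale V 0 u"
  by (simp add: scale_scale)

lemma norm_zero: "u \<in> vecs V \<Longrightarrow> vnorm V (vscale V 0 u) = 0"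
  by (simp add: norm_scale)

lemma norm_nonneg: "u \<in> vecs V \<Longrightarrow> 0 \<le> vnorm V u"
  using norm_triangle[of u "vscale V (-1) u"] by (simp add: add_neg norm_scale)

lemma add_swap:
  assumes "a \<in> vecs V" "b \<in> vecs V" "c \<in> vecs V" "d \<in> vecs V"
  shows "vadd V (vadd V a b) (vadd V c d) = vadd V (vadd V a c) (vadd V b d)"
proof -
  have "vadd V (vadd V a b) (vadd V c d) = vadd V a (vadd V (vadd V b c) d)"
    using assms by (simp add: add_assoc)
  also have "\<dots> = vadd V a (vadd V (vadd V c b) d)" using assms add_comm[of b c] by simp
  also have "\<dots> = vadd V (vadd V a c) (vadd V b d)" using assms by (simp add: add_assoc)
  finally show ?thesis .
qed

lemma dist_self: "u \<in> vecs V \<Longrightarrow> vdist V u u = 0"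
  by (simp add: vdist_def add_neg norm_zero)

lemma dist_nonneg: "u \<in> vecs V \<Longrightarrow> v \<in> vecs V \<Longrightarrow> 0 \<le> vdist V u v"
  by (simp add: vdist_def norm_nonneg)

lemma dist_commute:
  assumes "u \<in> vecs V" "v \<in> vecs V"
  shows "vdist V u v = vdist V v u"
proof -
  have "vscale V (-1) (vadd V v (vscale V (-1) u)) = vadd V u (vscale V (-1) v)"
    using assms by (simp add: scale_add scale_scale scale_one add_comm)
  then show ?thesis
    using norm_scale[of "vadd V v (vscale V (-1) u)" "-1"] assms by (simp add: vdist_def)
qed

lemma dist_add:
  assumes "u \<in> vecs V" "u' \<in> vecs V" "v \<in> vecs V" "v' \<in> vecs V"
  shows "vdist V (vadd V u u') (vadd V v v') \<le> vdist V u v + vdist V u' v'"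
proof -
  have "vadd V (vadd V u u') (vscale V (-1) (vadd V v v'))
      = vadd V (vadd V u (vscale V (-1) v)) (vadd V u' (vscale V (-1) v'))"
    using assms by (simp add: scale_add add_swap)
  then show ?thesis unfolding vdist_def using assms by (simp add: norm_triangle)
qed

lemma dist_scale:
  assumes "u \<in> vecs V" "v \<in> vecs V"
  shows "vdist V (vscale V c u) (vscale V c v) = \<bar>c\<bar> * vdist V u v"
proof -
  have "vadd V (vscale V c u) (vscale V (-1) (vscale V c v)) = vscale V c (vadd V u (vscale V (-1) v))"
    using assms by (simp add: scale_add scale_scale)
  then show ?thesis unfolding vdist_def using assms by (simp add: norm_scale)
qed

lemma sub_add_sub:
  assumes "u \<in> vecs V" "v \<in> vecs V" "w \<in> vecs V"
  shows "vadd V (vadd V u (vscale V (-1) v)) (vadd V v w) = vadd V u w"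
proof -
  have "vadd V (vadd V u (vscale V (-1) v)) (vadd V v w) = vadd V u (vadd V (vadd V (vscale V (-1) v) v) w)"
    using assms by (simp add: add_assoc)
  also have "vadd V (vscale V (-1) v) v = vscale V 0 v"
    using assms add_comm[of "vscale V (-1) v" v] by (simp add: add_neg)
  finally show ?thesis using assms by (simp add: zero_add)
qed

lemma dist_triangle:
  assumes "u \<in> vecs V" "v \<in> vecs V" "w \<in> vecs V"
  shows "vdist V u w \<le> vdist V u v + vdist V v w"
  using sub_add_sub[of u v "vscale V (-1) w"] norm_triangle[of "vadd V u (vscale V (-1) v)" "vadd V v (vscale V (-1) w)"] assms
  by (simp add: vdist_def)

lemma norm_diff_le_dist:
  assumes "u \<in> vecs V" "v \<in> vecs V"
  shows "\<bar>vnorm V u - vnorm V v\<bar> \<le> vdist V u v"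
proof -
  have *: "vnorm V a \<le> vdist V a b + vnorm V b" if "a \<in> vecs V" "b \<in> vecs V" for a b
  proof -
    have "vadd V (vadd V a (vscale V (-1) b)) b = a"
      using that add_assoc[of a "vscale V (-1) b" b] add_comm[of "vscale V (-1) b" b]
        add_comm[of a "vscale V 0 b"] by (simp add: add_neg zero_add)
    then show ?thesis using norm_triangle[of "vadd V a (vscale V (-1) b)" b] that by (simp add: vdist_def)
  qed
  show ?thesis using *[OF assms] *[OF assms(2,1)] dist_commute[OF assms] by (simp add: abs_le_iff)
qed

end

section \<open>Cauchy sequences and the completion\<close>

context seminormed begin

lemma cauchy_seqsD: "u \<in> cauchy_seqs V \<Longrightarrow> u n \<in> vecs V"
  by (simp add: cauchy_seqs_def)

lemma const_cauchy: "v \<in> vecs V \<Longrightarrow> (\<lambda>_. v) \<in> cauchy_seqs V"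
  by (simp add: cauchy_seqs_def dist_self)

lemma add_cauchy:
  assumes u: "u \<in> cauchy_seqs V" and v: "v \<in> cauchy_seqs V"
  shows "(\<lambda>n. vadd V (u n) (v n)) \<in> cauchy_seqs V"
  unfolding cauchy_seqs_def
proof (intro CollectI conjI allI impI)
  show "vadd V (u n) (v n) \<in> vecs V" for n using cauchy_seqsD[OF u] cauchy_seqsD[OF v] by simp
  fix e :: real assume "0 < e"
  obtain N where N: "\<forall>k\<ge>N. \<forall>n\<ge>N. vdist V (u k) (u n) < e / 2"
    using u half_gt_zero[OF \<open>0 < e\<close>] unfolding cauchy_seqs_def by blast
  obtain M where M: "\<forall>k\<ge>M. \<forall>n\<ge>M. vdist V (v k) (v n) < e / 2"
    using v half_gt_zero[OF \<open>0 < e\<close>] unfolding cauchy_seqs_def by blast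
  show "\<exists>N. \<forall>k\<ge>N. \<forall>n\<ge>N. vdist V (vadd V (u k) (v k)) (vadd V (u n) (v n)) < e"
  proof (intro exI[of _ "max N M"] allI impI)
    fix k n assume "max N M \<le> k" "max N M \<le> n"
    then have "vdist V (u k) (u n) < e / 2" "vdist V (v k) (v n) < e / 2" using N M by simp_all
    then show "vdist V (vadd V (u k) (v k)) (vadd V (u n) (v n)) < e"
      using dist_add[OF cauchy_seqsD[OF u, of k] cauchy_seqsD[OF v, of k] cauchy_seqsD[OF u, of n] cauchy_seqsD[OF v, of n]]
      by linarith
  qed
qed

lemma scale_cauchy:
  assumes u: "u \<in> cauchy_seqs V"
  shows "(\<lambda>n. vscale V c (u n)) \<in> cauchy_seqs V"
  unfolding cauchy_seqs_def
proof (intro CollectI conjI allI impI)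
  show "vscale V c (u n) \<in> vecs V" for n using cauchy_seqsD[OF u] by simp
  fix e :: real assume "0 < e"
  then have "0 < e / (\<bar>c\<bar> + 1)" by (simp add: add_nonneg_pos)
  then obtain N where N: "\<forall>k\<ge>N. \<forall>n\<ge>N. vdist V (u k) (u n) < e / (\<bar>c\<bar> + 1)"
    using u unfolding cauchy_seqs_def by blast
  show "\<exists>N. \<forall>k\<ge>N. \<forall>n\<ge>N. vdist V (vscale V c (u k)) (vscale V c (u n)) < e"
  proof (intro exI[of _ N] allI impI)
    fix k n assume "N \<le> k" "N \<le> n"
    then have "vdist V (u k) (u n) < e / (\<bar>c\<bar> + 1)" using N by simp
    then have "(\<bar>c\<bar> + 1) * vdist V (u k) (u n) < e" by (simp add: pos_less_divide_eq add_nonneg_pos mult.commute)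
    then show "vdist V (vscale V c (u k)) (vscale V c (u n)) < e"
      using dist_nonneg[OF cauchy_seqsD[OF u, of k] cauchy_seqsD[OF u, of n]]
      by (simp add: dist_scale[OF cauchy_seqsD[OF u] cauchy_seqsD[OF u]] distrib_right)
  qed
qed

lemma cauchy_rel_iff:
  "(u, v) \<in> cauchy_rel V \<longleftrightarrow> u \<in> cauchy_seqs V \<and> v \<in> cauchy_seqs V \<and> (\<lambda>n. vdist V (u n) (v n)) \<longlonglongrightarrow> 0"
  by (simp add: cauchy_rel_def)

lemma null_comparison:
  fixes f :: "nat \<Rightarrow> real"
  assumes "\<And>n. 0 \<le> f n" "\<And>n. f n \<le> g n" "g \<longlonglongrightarrow> 0"
  shows "f \<longlonglongrightarrow> 0"
  by (rule tendsto_sandwich[OF _ _ tendsto_const assms(3)]) (use assms(1,2) in simp_all)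

lemma equiv_cauchy_rel: "equiv (cauchy_seqs V) (cauchy_rel V)"
proof (rule equivI)
  show "cauchy_rel V \<subseteq> cauchy_seqs V \<times> cauchy_seqs V" by (auto simp: cauchy_rel_def)
  show "refl_on (cauchy_seqs V) (cauchy_rel V)"
    by (auto simp: refl_on_def cauchy_rel_iff dist_self cauchy_seqsD)
  show "sym (cauchy_rel V)"
    by (rule symI) (simp add: cauchy_rel_iff dist_commute[OF cauchy_seqsD cauchy_seqsD])
  show "trans (cauchy_rel V)"
  proof (rule transI)
    fix u v w assume uv: "(u, v) \<in> cauchy_rel V" and vw: "(v, w) \<in> cauchy_rel V"
    then have c: "u \<in> cauchy_seqs V" "v \<in> cauchy_seqs V" "w \<in> cauchy_seqs V" by (simp_all add: cauchy_rel_iff)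
    note d = cauchy_seqsD[OF c(1)] cauchy_seqsD[OF c(2)] cauchy_seqsD[OF c(3)]
    have "(\<lambda>n. vdist V (u n) (v n) + vdist V (v n) (w n)) \<longlonglongrightarrow> 0 + 0"
      using uv vw by (intro tendsto_add) (simp_all add: cauchy_rel_iff)
    then have s: "(\<lambda>n. vdist V (u n) (v n) + vdist V (v n) (w n)) \<longlonglongrightarrow> 0" by simp
    have "(\<lambda>n. vdist V (u n) (w n)) \<longlonglongrightarrow> 0"
      by (rule null_comparison[OF _ _ s]) (simp_all add: d dist_nonneg dist_triangle)
    then show "(u, w) \<in> cauchy_rel V" using c by (simp add: cauchy_rel_iff)
  qed
qed

abbreviation cls where "cls u \<equiv> cauchy_rel V `` {u}"

lemma cls_cong: "(u, v) \<in> cauchy_rel V \<Longrightarrow> cls u = cls v"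
  by (rule equiv_class_eq[OF equiv_cauchy_rel])

lemma vecs_completion: "vecs (nspace_completion V) = cls ` cauchy_seqs V"
  by (auto simp: nspace_completion_def quotient_def)

lemma cls_in_completion: "u \<in> cauchy_seqs V \<Longrightarrow> cls u \<in> vecs (nspace_completion V)"
  by (auto simp: vecs_completion)

text \<open>The union over all representatives collapses, because by \<open>dist_add\<close> every
  choice of them gives the same class.\<close>

lemma add_cls:
  assumes u: "u \<in> cauchy_seqs V" and v: "v \<in> cauchy_seqs V"
  shows "vadd (nspace_completion V) (cls u) (cls v) = cls (\<lambda>n. vadd V (u n) (v n))"
proof -
  have "cls (\<lambda>n. vadd V (u' n) (v' n)) = cls (\<lambda>n. vadd V (u n) (v n))" if "u' \<in> cls u" "v' \<in> cls v" for u' v'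
  proof (rule cls_cong)
    have r: "(u, u') \<in> cauchy_rel V" "(v, v') \<in> cauchy_rel V" using that by auto
    then have c: "u' \<in> cauchy_seqs V" "v' \<in> cauchy_seqs V" by (simp_all add: cauchy_rel_iff)
    note d = cauchy_seqsD[OF c(1)] cauchy_seqsD[OF c(2)] cauchy_seqsD[OF u] cauchy_seqsD[OF v]
    have "(\<lambda>n. vdist V (u n) (u' n) + vdist V (v n) (v' n)) \<longlonglongrightarrow> 0 + 0"
      using r by (intro tendsto_add) (simp_all add: cauchy_rel_iff)
    then have s: "(\<lambda>n. vdist V (u n) (u' n) + vdist V (v n) (v' n)) \<longlonglongrightarrow> 0" by simp
    have "(\<lambda>n. vdist V (vadd V (u' n) (v' n)) (vadd V (u n) (v n))) \<longlonglongrightarrow> 0"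
      by (rule null_comparison[OF _ _ s])
         (use dist_add[OF d] in \<open>simp_all add: d dist_nonneg dist_commute[OF d(1) d(3)] dist_commute[OF d(2) d(4)]\<close>)
    then show "((\<lambda>n. vadd V (u' n) (v' n)), (\<lambda>n. vadd V (u n) (v n))) \<in> cauchy_rel V"
      using add_cauchy[OF c] add_cauchy[OF u v] by (simp add: cauchy_rel_iff)
  qed
  moreover have "u \<in> cls u" "v \<in> cls v"
    using equiv_class_self[OF equiv_cauchy_rel] u v by auto
  ultimately have "(\<Union>u'\<in>cls u. \<Union>v'\<in>cls v. cls (\<lambda>n. vadd V (u' n) (v' n))) = cls (\<lambda>n. vadd V (u n) (v n))"
    by (metis (no_types, lifting) UN_eq_const)
  then show ?thesis by (simp only: nspace_completion_def nspace.simps)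
qed

lemma scale_cls:
  assumes u: "u \<in> cauchy_seqs V"
  shows "vscale (nspace_completion V) c (cls u) = cls (\<lambda>n. vscale V c (u n))"
proof -
  have "cls (\<lambda>n. vscale V c (u' n)) = cls (\<lambda>n. vscale V c (u n))" if "u' \<in> cls u" for u'
  proof (rule cls_cong)
    have r: "(u, u') \<in> cauchy_rel V" using that by auto
    then have c': "u' \<in> cauchy_seqs V" by (simp add: cauchy_rel_iff)
    note d = cauchy_seqsD[OF c'] cauchy_seqsD[OF u]
    have "(\<lambda>n. \<bar>c\<bar> * vdist V (u n) (u' n)) \<longlonglongrightarrow> \<bar>c\<bar> * 0"
      using r by (intro tendsto_mult tendsto_const) (simp add: cauchy_rel_iff)
    then show "((\<lambda>n. vscale V c (u' n)), (\<lambda>n. vscale V c (u n))) \<in> cauchy_rel V"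
      using scale_cauchy[OF c'] scale_cauchy[OF u]
      by (simp add: cauchy_rel_iff dist_scale[OF d] dist_commute[OF d])
  qed
  moreover have "u \<in> cls u" using equiv_class_self[OF equiv_cauchy_rel] u by auto
  ultimately have "(\<Union>u'\<in>cls u. cls (\<lambda>n. vscale V c (u' n))) = cls (\<lambda>n. vscale V c (u n))"
    by (metis (no_types, lifting) UN_eq_const)
  then show ?thesis by (simp only: nspace_completion_def nspace.simps)
qed

text \<open>Norms along a Cauchy sequence converge, with the same limit for all representatives, so
  the definite description denotes that limit.\<close>

lemma norm_cls:
  assumes u: "u \<in> cauchy_seqs V"
  shows "(\<lambda>n. vnorm V (u n)) \<longlonglongrightarrow> vnorm (nspace_completion V) (cls u)"
proof -
  have "Cauchy (\<lambda>n. vnorm V (u n))"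
  proof (rule metric_CauchyI)
    fix e :: real assume "0 < e"
    then obtain N where N: "\<forall>k\<ge>N. \<forall>n\<ge>N. vdist V (u k) (u n) < e"
      using u unfolding cauchy_seqs_def by blast
    show "\<exists>M. \<forall>m\<ge>M. \<forall>n\<ge>M. dist (vnorm V (u m)) (vnorm V (u n)) < e"
      using N norm_diff_le_dist[OF cauchy_seqsD[OF u] cauchy_seqsD[OF u]]
      by (metis dist_real_def le_less_trans)
  qed
  then obtain r where r: "(\<lambda>n. vnorm V (u n)) \<longlonglongrightarrow> r"
    using Cauchy_convergent convergent_def by blast
  have all: "(\<lambda>n. vnorm V (u' n)) \<longlonglongrightarrow> r" if "u' \<in> cls u" for u'
  proof -
    have uu: "(u, u') \<in> cauchy_rel V" using that by auto
    then have u': "u' \<in> cauchy_seqs V" by (simp add: cauchy_rel_iff)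
    have "(\<lambda>n. vnorm V (u n) - vnorm V (u' n)) \<longlonglongrightarrow> 0"
      by (rule Lim_null_comparison[of _ "\<lambda>n. vdist V (u n) (u' n)"])
         (use uu norm_diff_le_dist[OF cauchy_seqsD[OF u] cauchy_seqsD[OF u']] in \<open>simp_all add: cauchy_rel_iff\<close>)
    from tendsto_diff[OF r this] show ?thesis by simp
  qed
  have "u \<in> cls u" using equiv_class_self[OF equiv_cauchy_rel] u by auto
  then have "(THE r. \<forall>u'\<in>cls u. (\<lambda>n. vnorm V (u' n)) \<longlonglongrightarrow> r) = r"
    using all by (intro the_equality) (auto intro: LIMSEQ_unique)
  then show ?thesis using r by (simp add: nspace_completion_def)
qed

text \<open>Algebraic laws hold termwise for representatives, laws of the norm in the limit.\<close>

lemma seminormed_completion: "seminormed (nspace_completion V)"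
proof -
  let ?C = "nspace_completion V"
  note ac = add_cauchy scale_cauchy
  note rules = add_cls scale_cls ac
  show ?thesis
  proof
    show "vecs ?C \<noteq> {}" using nonempty const_cauchy by (fastforce simp: vecs_completion)
    fix P Q R :: "(nat \<Rightarrow> 'v) set" and a b :: real
    assume P: "P \<in> vecs ?C"
    then obtain u where u: "u \<in> cauchy_seqs V" "P = cls u" by (auto simp: vecs_completion)
    note du = cauchy_seqsD[OF u(1)]
    show "vscale ?C a P \<in> vecs ?C"
      unfolding u(2) scale_cls[OF u(1)] by (intro cls_in_completion scale_cauchy u)
    show "vscale ?C (a + b) P = vadd ?C (vscale ?C a P) (vscale ?C b P)"
      unfolding u(2) by (simp add: rules u(1) add_scale du)
    show "vscale ?C a (vscale ?C b P) = vscale ?C (a * b) P"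
      unfolding u(2) by (simp add: rules u(1) scale_scale du)
    show "vscale ?C 1 P = P"
      unfolding u(2) by (simp add: rules u(1) scale_one du)
    show "vnorm ?C (vscale ?C a P) = \<bar>a\<bar> * vnorm ?C P"
    proof (rule LIMSEQ_unique)
      show "(\<lambda>n. vnorm V (vscale V a (u n))) \<longlonglongrightarrow> vnorm ?C (vscale ?C a P)"
        unfolding u(2) scale_cls[OF u(1)] by (intro norm_cls ac u)
      show "(\<lambda>n. vnorm V (vscale V a (u n))) \<longlonglongrightarrow> \<bar>a\<bar> * vnorm ?C P"
        unfolding u(2) norm_scale[OF du] by (intro tendsto_intros norm_cls u)
    qed
    assume Q: "Q \<in> vecs ?C"
    then obtain v where v: "v \<in> cauchy_seqs V" "Q = cls v" by (auto simp: vecs_completion)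
    note dv = cauchy_seqsD[OF v(1)]
    show "vadd ?C P Q \<in> vecs ?C"
      unfolding u(2) v(2) add_cls[OF u(1) v(1)] by (intro cls_in_completion ac u v)
    show "vadd ?C P Q = vadd ?C Q P"
      unfolding u(2) v(2) by (simp add: rules u(1) v(1) add_comm[OF du dv])
    show "vscale ?C a (vadd ?C P Q) = vadd ?C (vscale ?C a P) (vscale ?C a Q)"
      unfolding u(2) v(2) by (simp add: rules u(1) v(1) scale_add du dv)
    show "vadd ?C (vscale ?C 0 P) Q = Q"
      unfolding u(2) v(2) by (simp add: rules u(1) v(1) zero_add du dv)
    show "vnorm ?C (vadd ?C P Q) \<le> vnorm ?C P + vnorm ?C Q"
    proof (rule LIMSEQ_le)
      show "(\<lambda>n. vnorm V (vadd V (u n) (v n))) \<longlonglongrightarrow> vnorm ?C (vadd ?C P Q)"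
        unfolding u(2) v(2) add_cls[OF u(1) v(1)] by (intro norm_cls ac u v)
      show "(\<lambda>n. vnorm V (u n) + vnorm V (v n)) \<longlonglongrightarrow> vnorm ?C P + vnorm ?C Q"
        unfolding u(2) v(2) by (intro tendsto_intros norm_cls u v)
    qed (use norm_triangle du dv in blast)
    assume R: "R \<in> vecs ?C"
    then obtain w where w: "w \<in> cauchy_seqs V" "R = cls w" by (auto simp: vecs_completion)
    note dw = cauchy_seqsD[OF w(1)]
    show "vadd ?C (vadd ?C P Q) R = vadd ?C P (vadd ?C Q R)"
      unfolding u(2) v(2) w(2) by (simp add: rules u(1) v(1) w(1) add_assoc du dv dw)
  qed
qed

text \<open>The completion separates points even if \<open>V\<close> does not, since sequences whose
  distance tends to 0 are identified. This is what turns a vanishing distance into the equality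
  \<open>differential m f = \<omega>\<close>.\<close>

lemma completion_dist_eq_0:
  assumes "P \<in> vecs (nspace_completion V)" "Q \<in> vecs (nspace_completion V)" "vdist (nspace_completion V) P Q = 0"
  shows "P = Q"
proof -
  obtain u v where u: "u \<in> cauchy_seqs V" "P = cls u" and v: "v \<in> cauchy_seqs V" "Q = cls v"
    using assms(1,2) by (auto simp: vecs_completion)
  have "(\<lambda>n. vdist V (u n) (v n)) \<longlonglongrightarrow> vdist (nspace_completion V) P Q"
    unfolding vdist_def u(2) v(2) scale_cls[OF v(1)] add_cls[OF u(1) scale_cauchy[OF v(1)]]
    by (rule norm_cls) (intro add_cauchy scale_cauchy u v)
  then have "(u, v) \<in> cauchy_rel V" using assms(3) u(1) v(1) by (simp add: cauchy_rel_iff)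
  then show ?thesis unfolding u v by (rule cls_cong)
qed

lemma completion_embed:
  assumes "u \<in> vecs V" "v \<in> vecs V"
  shows embed_in_completion: "completion_embed V u \<in> vecs (nspace_completion V)"
    and embed_add: "completion_embed V (vadd V u v) = vadd (nspace_completion V) (completion_embed V u) (completion_embed V v)"
    and embed_scale: "completion_embed V (vscale V c u) = vscale (nspace_completion V) c (completion_embed V u)"
    and embed_norm: "vnorm (nspace_completion V) (completion_embed V u) = vnorm V u"
  using cls_in_completion add_cls scale_cls const_cauchy[OF assms(1)] const_cauchy[OF assms(2)]
    LIMSEQ_unique[OF norm_cls[OF const_cauchy[OF assms(1)]] tendsto_const]
  by (simp_all add: completion_embed_def)

end

section \<open>Sublinear functionals, the Hahn-Banach theorem and Mazur's lemma\<close>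

context seminormed begin

text \<open>Homogeneity is asked for as an inequality only, the form that is easily checked for
  infima; equality follows by scaling back with \<open>1/c\<close>.\<close>

definition sublinear :: "('v \<Rightarrow> real) \<Rightarrow> bool" where
  "sublinear p \<longleftrightarrow> (\<forall>u\<in>vecs V. \<forall>v\<in>vecs V. p (vadd V u v) \<le> p u + p v) \<and>
     (\<forall>u\<in>vecs V. \<forall>c\<ge>0. p (vscale V c u) \<le> c * p u)"

lemma sublinearD:
  assumes "sublinear p" "u \<in> vecs V"
  shows sublinear_add: "v \<in> vecs V \<Longrightarrow> p (vadd V u v) \<le> p u + p v"
    and sublinear_scale_le: "0 \<le> c \<Longrightarrow> p (vscale V c u) \<le> c * p u"
  using assms by (auto simp: sublinear_def)

lemma sublinear_zero:
  assumes "sublinear p" "u \<in> vecs V"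
  shows "p (vscale V 0 u) = 0"
proof -
  have "p (vscale V 0 u) \<le> 0" using sublinear_scale_le[OF assms, of 0] by simp
  moreover have "p (vscale V 0 u) \<le> p (vscale V 0 u) + p (vscale V 0 u)"
    using sublinear_add[OF assms(1) scale_closed[OF assms(2)] scale_closed[OF assms(2)], of 0 0] zero_add[OF assms(2) scale_closed[OF assms(2)], of 0]
    by simp
  ultimately show ?thesis by simp
qed

lemma sublinear_scale:
  assumes "sublinear p" "u \<in> vecs V" "0 \<le> c"
  shows "p (vscale V c u) = c * p u"
proof (cases "c = 0")
  case False
  then have "0 < c" using assms(3) by simp
  have "p (vscale V (1/c) (vscale V c u)) \<le> (1/c) * p (vscale V c u)"
    using \<open>0 < c\<close> by (intro sublinear_scale_le[OF assms(1)] scale_closed assms) simp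
  then have "p u \<le> p (vscale V c u) / c" using \<open>0 < c\<close> assms(2) by (simp add: scale_scale scale_one)
  then have "c * p u \<le> p (vscale V c u)" using \<open>0 < c\<close> by (simp add: le_divide_eq mult.commute)
  then show ?thesis using sublinear_scale_le[OF assms] by simp
qed (simp add: sublinear_zero[OF assms(1,2)])

lemma sublinear_neg:
  assumes "sublinear p" "u \<in> vecs V"
  shows "- p (vscale V (-1) u) \<le> p u"
  using sublinear_add[OF assms scale_closed[OF assms(2)], of "-1"] sublinear_zero[OF assms] assms(2)
  by (simp add: add_neg)

text \<open>For each \<open>x\<close> the infimum over \<open>t \<ge> 0\<close> of
  \<open>q (v + t x) - t q x\<close> is a sublinear functional of \<open>v\<close> below
  \<open>q\<close>, so it equals \<open>q\<close>. Taking \<open>v = - x\<close> and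
  \<open>t = 1\<close> bounds \<open>q (- x)\<close> by \<open>- q x\<close>, and an odd sublinear
  functional is linear.\<close>

lemma minimal_sublinear_linear:
  assumes q: "sublinear q" and min: "\<And>r. sublinear r \<Longrightarrow> \<forall>u\<in>vecs V. r u \<le> q u \<Longrightarrow> \<forall>u\<in>vecs V. r u = q u"
  shows "\<forall>u\<in>vecs V. \<forall>v\<in>vecs V. q (vadd V u v) = q u + q v"
    and "\<forall>u\<in>vecs V. \<forall>c. q (vscale V c u) = c * q u"
proof -
  have neg: "q (vscale V (-1) x) = - q x" if x: "x \<in> vecs V" for x
  proof -
    define f where "f = (\<lambda>v t. q (vadd V v (vscale V t x)) - t * q x)"
    define r where "r = (\<lambda>v. INF t\<in>{0..}. f v t)"
    have bdd: "bdd_below (f v ` {0..})" if v: "v \<in> vecs V" for v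
    proof (rule bdd_belowI2)
      fix t :: real assume t: "t \<in> {0..}"
      \<comment> \<open>Subadditivity at \<open>t x = - v + (v + t x)\<close> bounds the infimum
        from below.\<close>
      have "vadd V (vscale V (-1) v) (vadd V v (vscale V t x)) = vscale V t x"
        using v x add_assoc[of "vscale V (-1) v" v "vscale V t x"] add_comm[of "vscale V (-1) v" v]
        by (simp add: add_neg zero_add)
      then have "t * q x \<le> q (vscale V (-1) v) + q (vadd V v (vscale V t x))"
        using sublinear_add[OF q, of "vscale V (-1) v" "vadd V v (vscale V t x)"] sublinear_scale[OF q x, of t] v x t
        by simp
      then show "- q (vscale V (-1) v) \<le> f v t" by (simp add: f_def)
    qed
    have r_le: "r v \<le> f v t" if "v \<in> vecs V" "0 \<le> t" for v t
      unfolding r_def by (rule cINF_lower[OF bdd[OF that(1)]]) (use that in simp)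
    have r_ge: "a \<le> r v" if "\<And>t. 0 \<le> t \<Longrightarrow> a \<le> f v t" for a v
      unfolding r_def by (rule cINF_greatest) (use that in auto)
    have "sublinear r"
      unfolding sublinear_def
    proof (intro conjI ballI allI impI)
      fix v w assume v: "v \<in> vecs V" and w: "w \<in> vecs V"
      have "r (vadd V v w) \<le> f v s + f w t" if "0 \<le> s" "0 \<le> t" for s t
      proof -
        have "r (vadd V v w) \<le> f (vadd V v w) (s + t)" using v w that by (intro r_le) auto
        also have "vadd V (vadd V v w) (vscale V (s + t) x) = vadd V (vadd V v (vscale V s x)) (vadd V w (vscale V t x))"
          using v w x by (simp add: add_scale add_swap)
        then have "f (vadd V v w) (s + t) \<le> f v s + f w t"
          using sublinear_add[OF q, of "vadd V v (vscale V s x)" "vadd V w (vscale V t x)"] v w x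
          by (simp add: f_def distrib_right)
        finally show ?thesis .
      qed
      then have "r (vadd V v w) - f v s \<le> r w" if "0 \<le> s" for s
        by (intro r_ge) (use that in \<open>simp add: diff_le_eq add.commute\<close>)
      then have "r (vadd V v w) - r w \<le> r v"
        by (intro r_ge) (simp add: diff_le_eq add.commute)
      then show "r (vadd V v w) \<le> r v + r w" by simp
    next
      fix v and c :: real assume v: "v \<in> vecs V" and c: "0 \<le> c"
      have *: "r (vscale V c v) \<le> c * f v t" if "0 \<le> t" for t
      proof -
        have "r (vscale V c v) \<le> f (vscale V c v) (c * t)" using v c that by (intro r_le) auto
        also have "\<dots> = c * f v t"
          using sublinear_scale[OF q, of "vadd V v (vscale V t x)" c] v x c
          by (simp add: f_def scale_add scale_scale right_diff_distrib)
        finally show ?thesis .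
      qed
      show "r (vscale V c v) \<le> c * r v"
      proof (cases "c = 0")
        case False
        then have "0 < c" using c by simp
        then have "r (vscale V c v) / c \<le> r v"
          by (intro r_ge) (use * in \<open>simp add: divide_le_eq mult.commute\<close>)
        then show ?thesis using \<open>0 < c\<close> by (simp add: divide_le_eq mult.commute)
      qed (use *[of 0] in simp)
    qed
    moreover have "r u \<le> q u" if u: "u \<in> vecs V" for u
      using r_le[OF u, of 0] u x add_comm[of u "vscale V 0 x"] by (simp add: f_def zero_add)
    ultimately have eq: "r u = q u" if "u \<in> vecs V" for u using min that by blast
    have "q (vscale V (-1) x) \<le> f (vscale V (-1) x) 1"
      using r_le[of "vscale V (-1) x" 1] eq[of "vscale V (-1) x"] x by simp
    also have "\<dots> = - q x"
      using x add_comm[of "vscale V (-1) x" x] sublinear_zero[OF q x] by (simp add: f_def scale_one add_neg)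
    finally show ?thesis using sublinear_neg[OF q x] by simp
  qed
  show "\<forall>u\<in>vecs V. \<forall>v\<in>vecs V. q (vadd V u v) = q u + q v"
  proof (intro ballI antisym)
    fix u v assume u: "u \<in> vecs V" and v: "v \<in> vecs V"
    show "q (vadd V u v) \<le> q u + q v" by (rule sublinear_add[OF q u v])
    have "q (vscale V (-1) (vadd V u v)) \<le> q (vscale V (-1) u) + q (vscale V (-1) v)"
      using u v by (simp add: scale_add sublinear_add[OF q])
    then show "q u + q v \<le> q (vadd V u v)" using u v by (simp add: neg)
  qed
  show "\<forall>u\<in>vecs V. \<forall>c. q (vscale V c u) = c * q u"
  proof (intro ballI allI)
    fix u and c :: real assume u: "u \<in> vecs V"
    show "q (vscale V c u) = c * q u"
    proof (cases "0 \<le> c")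
      case False
      have "vscale V c u = vscale V (- c) (vscale V (-1) u)" using u by (simp add: scale_scale)
      then show ?thesis
        using sublinear_scale[OF q, of "vscale V (-1) u" "- c"] u False by (simp add: neg)
    qed (simp add: sublinear_scale[OF q u])
  qed
qed

text \<open>A minimal sublinear functional below \<open>p\<close>, which exists by Zorn's lemma, is linear.\<close>

theorem Hahn_Banach:
  assumes p: "sublinear p"
  obtains L where "\<And>u v. u \<in> vecs V \<Longrightarrow> v \<in> vecs V \<Longrightarrow> L (vadd V u v) = L u + L v"
    "\<And>c u. u \<in> vecs V \<Longrightarrow> L (vscale V c u) = c * L u"
    "\<And>u. u \<in> vecs V \<Longrightarrow> L u \<le> p u"
proof -
  \<comment> \<open>Fixing the value 0 off the carrier lets the order of the whole function type
    serve for functionals on the carrier.\<close>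
  define A where "A = {q. sublinear q \<and> (\<forall>u\<in>vecs V. q u \<le> p u) \<and> (\<forall>u. u \<notin> vecs V \<longrightarrow> q u = 0)}"
  \<comment> \<open>The order is reversed, so a maximal element in Zorn's lemma is a minimal
    functional.\<close>
  define P where "P = (\<lambda>q r :: 'v \<Rightarrow> real. r \<le> q)"
  have cut: "(\<lambda>u. if u \<in> vecs V then q u else 0) \<in> A" if "sublinear q" "\<forall>u\<in>vecs V. q u \<le> p u" for q
    using that by (auto simp: A_def sublinear_def)
  have po: "partial_order_on A (relation_of P A)"
    by (rule partial_order_on_relation_ofI) (auto simp: P_def)
  have "\<exists>m\<in>A. \<forall>q\<in>A. P m q \<longrightarrow> q = m"
  proof (rule predicate_Zorn[OF po])
    fix C assume C: "C \<in> Chains (relation_of P A)"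
    then have CA: "q \<in> A" if "q \<in> C" for q using that by (auto simp: Chains_def relation_of_def)
    have lin: "q \<le> r \<or> r \<le> q" if "q \<in> C" "r \<in> C" for q r
      using C that by (auto simp: Chains_def relation_of_def P_def)
    show "\<exists>u\<in>A. \<forall>a\<in>C. P a u"
    proof (cases "C = {}")
      case True
      then show ?thesis using cut[OF p] by auto
    next
      case False
      define r where "r = (\<lambda>u. INF q\<in>C. q u)"
      have sub: "sublinear q" "\<And>u. u \<in> vecs V \<Longrightarrow> q u \<le> p u" if "q \<in> C" for q
        using CA[OF that] by (auto simp: A_def)
      have bdd: "bdd_below ((\<lambda>q. q u) ` C)" if u: "u \<in> vecs V" for u
      proof (rule bdd_belowI2)
        fix q assume q: "q \<in> C"
        show "- p (vscale V (-1) u) \<le> q u"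
          using sublinear_neg[OF sub(1)[OF q] u] sub(2)[OF q, of "vscale V (-1) u"] u by simp
      qed
      have r_le: "r u \<le> q u" if "u \<in> vecs V" "q \<in> C" for u q
        unfolding r_def by (rule cINF_lower[OF bdd[OF that(1)] that(2)])
      have r_ge: "a \<le> r u" if "\<And>q. q \<in> C \<Longrightarrow> a \<le> q u" for a u
        unfolding r_def by (rule cINF_greatest[OF False that])
      have "sublinear r"
        unfolding sublinear_def
      proof (intro conjI ballI allI impI)
        fix u v assume u: "u \<in> vecs V" and v: "v \<in> vecs V"
        \<comment> \<open>The smaller of two members of the chain can be used in both terms.\<close>
        have *: "r (vadd V u v) \<le> q1 u + q2 v" if q: "q1 \<in> C" "q2 \<in> C" for q1 q2
        proof -
          have "r (vadd V u v) \<le> q u + q v" if "q \<in> C" for q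
            using r_le[of "vadd V u v" q] sublinear_add[OF sub(1)[OF that] u v] that u v by simp
          from this[OF q(1)] this[OF q(2)] lin[OF q] show ?thesis
            by (auto simp: le_fun_def) (smt (verit))+
        qed
        have "r (vadd V u v) - q1 u \<le> r v" if "q1 \<in> C" for q1
          by (rule r_ge) (use *[OF that] in \<open>simp add: diff_le_eq add.commute\<close>)
        then have "r (vadd V u v) - r v \<le> r u"
          by (intro r_ge) (simp add: diff_le_eq add.commute)
        then show "r (vadd V u v) \<le> r u + r v" by simp
      next
        fix u and c :: real assume u: "u \<in> vecs V" and c: "0 \<le> c"
        have *: "r (vscale V c u) \<le> c * q u" if "q \<in> C" for q
          using r_le[of "vscale V c u" q] sublinear_scale[OF sub(1)[OF that] u c] u that by simp
        show "r (vscale V c u) \<le> c * r u"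
        proof (cases "c = 0")
          case False
          then have "0 < c" using c by simp
          then have "r (vscale V c u) / c \<le> r u"
            by (intro r_ge) (use * in \<open>simp add: divide_le_eq mult.commute\<close>)
          then show ?thesis using \<open>0 < c\<close> by (simp add: divide_le_eq mult.commute)
        qed (use * False in fastforce)
      qed
      moreover obtain q0 where "q0 \<in> C" using False by blast
      then have "\<forall>u\<in>vecs V. r u \<le> p u" using r_le sub(2) by (meson order_trans)
      ultimately have "(\<lambda>u. if u \<in> vecs V then r u else 0) \<in> A" by (rule cut)
      moreover have "P q (\<lambda>u. if u \<in> vecs V then r u else 0)" if "q \<in> C" for q
        using r_le that CA[OF that] by (auto simp: P_def le_fun_def A_def)
      ultimately show ?thesis by blast
    qed
  qed
  then obtain L where L: "L \<in> A" and minL: "\<And>q. q \<in> A \<Longrightarrow> q \<le> L \<Longrightarrow> q = L"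
    unfolding P_def by blast
  have sL: "sublinear L" and Lp: "\<And>u. u \<in> vecs V \<Longrightarrow> L u \<le> p u" using L by (auto simp: A_def)
  have "\<forall>u\<in>vecs V. r u = L u" if r: "sublinear r" "\<forall>u\<in>vecs V. r u \<le> L u" for r
  proof -
    have "\<forall>u\<in>vecs V. r u \<le> p u" using r(2) Lp by (meson order_trans)
    from cut[OF r(1) this] have eq: "(\<lambda>u. if u \<in> vecs V then r u else 0) = L"
      by (rule minL) (use r(2) L in \<open>auto simp: le_fun_def A_def\<close>)
    show ?thesis
    proof
      fix u assume "u \<in> vecs V"
      then show "r u = L u" using fun_cong[OF eq, of u] by simp
    qed
  qed
  note lin = minimal_sublinear_linear[OF sL this]
  show thesis by (rule that[of L]) (use lin Lp in auto)
qed

text \<open>If \<open>Q\<close> stayed away from \<open>l\<close> by \<open>\<delta>\<close>, then a linear functional below the sublinear functional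
  \<open>x \<mapsto> inf {\<parallel>x + \<tau> (v - l)\<parallel> - \<delta> \<tau>}\<close> would be bounded and at least \<open>\<delta>\<close> on \<open>Q - l\<close>.\<close>

theorem Mazur:
  assumes u: "\<And>n. u n \<in> vecs V" "\<And>n. Q (u n)" and l: "l \<in> vecs V" and weak: "weakly_converges V u l"
    and conv: "\<And>v w a b. v \<in> vecs V \<Longrightarrow> w \<in> vecs V \<Longrightarrow> Q v \<Longrightarrow> Q w \<Longrightarrow> 0 \<le> a \<Longrightarrow> 0 \<le> b \<Longrightarrow> a + b = 1 \<Longrightarrow>
       Q (vadd V (vscale V a v) (vscale V b w))"
    and "0 < \<delta>"
  shows "\<exists>v\<in>vecs V. Q v \<and> vdist V v l < \<delta>"
proof (rule ccontr)
  assume "\<not> ?thesis"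
  then have far: "\<And>v. v \<in> vecs V \<Longrightarrow> Q v \<Longrightarrow> \<delta> \<le> vdist V v l" by (auto simp: not_less)
  define y where "y = (\<lambda>v. vadd V v (vscale V (-1) l))"
  have yV [simp]: "v \<in> vecs V \<Longrightarrow> y v \<in> vecs V" for v using l by (simp add: y_def)
  \<comment> \<open>The pairs parametrise the cone generated by the differences
    \<open>v - l\<close>; the parameter is kept because the penalty \<open>\<delta> * t\<close> is
    not a function of the vector \<open>t (v - l)\<close> alone.\<close>
  define T where "T = {(v, t). v \<in> vecs V \<and> Q v \<and> (0::real) \<le> t}"
  define f where "f = (\<lambda>x (v, t). vnorm V (vadd V x (vscale V t (y v))) - \<delta> * t)"
  define p where "p = (\<lambda>x. INF z\<in>T. f x z)"
  have ne: "T \<noteq> {}" using u[of 0] by (auto simp: T_def intro!: exI[of _ "0::real"])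
  \<comment> \<open>Since \<open>v\<close> stays away from \<open>l\<close>, the penalty is at most
    the norm of \<open>t (v - l)\<close>; hence the infimum is finite.\<close>
  have lower: "- vnorm V x \<le> f x z" if x: "x \<in> vecs V" and z: "z \<in> T" for x z
  proof -
    obtain v t where z': "z = (v, t)" "v \<in> vecs V" "Q v" "0 \<le> t" using z by (auto simp: T_def)
    have "\<delta> * t \<le> t * vdist V v l"
      by (subst mult.commute) (rule mult_left_mono[OF far[OF z'(2,3)] z'(4)])
    also have "\<dots> = vnorm V (vscale V t (y v))" using z' by (simp add: norm_scale vdist_def y_def l)
    also have "vscale V t (y v) = vadd V (vscale V (-1) x) (vadd V x (vscale V t (y v)))"
      using x z' add_assoc[of "vscale V (-1) x" x "vscale V t (y v)"] add_comm[of "vscale V (-1) x" x]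
      by (simp add: add_neg zero_add)
    also have "vnorm V \<dots> \<le> vnorm V (vscale V (-1) x) + vnorm V (vadd V x (vscale V t (y v)))"
      using x z' by (intro norm_triangle) auto
    also have "vnorm V (vscale V (-1) x) = vnorm V x" using x by (simp add: norm_scale)
    finally show ?thesis by (simp add: f_def z')
  qed
  have bdd: "bdd_below (f x ` T)" if "x \<in> vecs V" for x
    by (rule bdd_belowI2[of _ "- vnorm V x"]) (rule lower[OF that])
  have p_le: "p x \<le> f x z" if "x \<in> vecs V" "z \<in> T" for x z
    unfolding p_def by (rule cINF_lower[OF bdd[OF that(1)] that(2)])
  have p_ge: "a \<le> p x" if "\<And>z. z \<in> T \<Longrightarrow> a \<le> f x z" for a x
    unfolding p_def by (rule cINF_greatest[OF ne that])
  have "sublinear p"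
    unfolding sublinear_def
  proof (intro conjI ballI allI impI)
    fix x x' assume x: "x \<in> vecs V" "x' \<in> vecs V"
    have *: "p (vadd V x x') \<le> f x z + f x' z'" if "z \<in> T" "z' \<in> T" for z z'
    proof -
      obtain v s where z: "z = (v, s)" "v \<in> vecs V" "Q v" "0 \<le> s" using \<open>z \<in> T\<close> by (auto simp: T_def)
      obtain w t where z': "z' = (w, t)" "w \<in> vecs V" "Q w" "0 \<le> t" using \<open>z' \<in> T\<close> by (auto simp: T_def)
      \<comment> \<open>Convexity makes the cone closed under sums: \<open>c\<close> is the mean of
        \<open>v\<close> and \<open>w\<close> with weights proportional to \<open>s\<close> and
        \<open>t\<close>, and the parameters, hence the penalties, add up.\<close>
      have "\<exists>c\<in>vecs V. Q c \<and> vscale V (s + t) (y c) = vadd V (vscale V s (y v)) (vscale V t (y w))"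
      proof (cases "s + t = 0")
        case True
        then have "s = 0" "t = 0" using z z' by auto
        then show ?thesis using z z' by (intro bexI[of _ v]) (simp_all add: zero_add zero_unique[of "y v" "y w"])
      next
        case False
        then have st: "0 < s + t" using z z' by simp
        let ?a = "s / (s + t)" and ?b = "t / (s + t)"
        let ?c = "vadd V (vscale V ?a v) (vscale V ?b w)"
        have ab: "?a + ?b = 1" using st by (simp add: add_divide_distrib[symmetric])
        have "y ?c = vadd V ?c (vadd V (vscale V ?a (vscale V (-1) l)) (vscale V ?b (vscale V (-1) l)))"
          unfolding y_def using add_scale[of "vscale V (-1) l" ?a ?b] l by (simp only: ab scale_one scale_closed)
        also have "\<dots> = vadd V (vscale V ?a (y v)) (vscale V ?b (y w))"
          using z z' l unfolding y_def by (simp add: add_swap scale_add)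
        finally have "vscale V (s + t) (y ?c) = vadd V (vscale V s (y v)) (vscale V t (y w))"
          using z z' st by (simp add: scale_add scale_scale)
        moreover have "Q ?c" using z z' st ab by (intro conv) auto
        ultimately show ?thesis using z z' by (intro bexI[of _ ?c]) auto
      qed
      then obtain c where c: "c \<in> vecs V" "Q c" "vscale V (s + t) (y c) = vadd V (vscale V s (y v)) (vscale V t (y w))"
        by blast
      have "p (vadd V x x') \<le> f (vadd V x x') (c, s + t)"
        using x c z z' by (intro p_le) (auto simp: T_def)
      also have "\<dots> \<le> f x z + f x' z'"
        using norm_triangle[of "vadd V x (vscale V s (y v))" "vadd V x' (vscale V t (y w))"] x z z'
        by (simp add: f_def c(3) add_swap[of x x'] distrib_left)
      finally show ?thesis .
    qed
    have "p (vadd V x x') - f x z \<le> p x'" if "z \<in> T" for z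
      by (rule p_ge) (use *[OF that] in \<open>simp add: diff_le_eq add.commute\<close>)
    then have "p (vadd V x x') - p x' \<le> p x"
      by (intro p_ge) (simp add: diff_le_eq add.commute)
    then show "p (vadd V x x') \<le> p x + p x'" by simp
  next
    fix x and c :: real assume x: "x \<in> vecs V" and c: "0 \<le> c"
    have *: "p (vscale V c x) \<le> c * f x z" if zT: "z \<in> T" for z
    proof -
      obtain v s where z: "z = (v, s)" "v \<in> vecs V" "Q v" "0 \<le> s" using zT by (auto simp: T_def)
      have "p (vscale V c x) \<le> f (vscale V c x) (v, c * s)"
        using x c z by (intro p_le) (auto simp: T_def)
      also have "vadd V (vscale V c x) (vscale V (c * s) (y v)) = vscale V c (vadd V x (vscale V s (y v)))"
        using x z by (simp add: scale_add scale_scale)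
      then have "f (vscale V c x) (v, c * s) = c * f x z"
        using x c z by (simp add: f_def norm_scale right_diff_distrib)
      finally show ?thesis .
    qed
    show "p (vscale V c x) \<le> c * p x"
    proof (cases "c = 0")
      case False
      then have "0 < c" using c by simp
      then have "p (vscale V c x) / c \<le> p x"
        by (intro p_ge) (use * in \<open>simp add: divide_le_eq mult.commute\<close>)
      then show ?thesis using \<open>0 < c\<close> by (simp add: divide_le_eq mult.commute)
    qed (use * ne in fastforce)
  qed
  then obtain L where L_add: "\<And>u v. u \<in> vecs V \<Longrightarrow> v \<in> vecs V \<Longrightarrow> L (vadd V u v) = L u + L v"
    and L_scale: "\<And>c u. u \<in> vecs V \<Longrightarrow> L (vscale V c u) = c * L u"
    and L_le: "\<And>u. u \<in> vecs V \<Longrightarrow> L u \<le> p u"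
    by (rule Hahn_Banach) blast
  \<comment> \<open>A pair with parameter 0 shows that \<open>p\<close> lies below the norm, which
    makes \<open>L\<close> bounded.\<close>
  have pn: "p x \<le> vnorm V x" if x: "x \<in> vecs V" for x
    using p_le[OF x, of "(u 0, 0)"] u[of 0] x add_comm[of x "vscale V 0 (y (u 0))"]
    by (simp add: T_def f_def zero_add)
  have "bounded_functional V L"
    unfolding bounded_functional_def
  proof (intro conjI exI[of _ 1] ballI allI)
    fix x assume x: "x \<in> vecs V"
    have "L x \<le> vnorm V x" using L_le[OF x] pn[OF x] by simp
    moreover have "- L x \<le> vnorm V x"
      using L_le[of "vscale V (-1) x"] pn[of "vscale V (-1) x"] x L_scale[OF x, of "-1"] by (simp add: norm_scale)
    ultimately show "\<bar>L x\<bar> \<le> 1 * vnorm V x" by simp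
  qed (simp_all add: L_add L_scale)
  then have lim: "(\<lambda>n. L (u n)) \<longlonglongrightarrow> L l" using weak by (simp add: weakly_converges_def)
  have "L l + \<delta> \<le> L (u n)" for n
  proof -
    \<comment> \<open>The pair \<open>(u n, 1)\<close> cancels the vector and leaves the penalty
      alone.\<close>
    have "p (vscale V (-1) (y (u n))) \<le> f (vscale V (-1) (y (u n))) (u n, 1)"
      using u[of n] by (intro p_le) (auto simp: T_def)
    also have "\<dots> = - \<delta>"
      using u[of n] add_comm[of "vscale V (-1) (y (u n))" "y (u n)"]
      by (simp add: f_def scale_one add_neg norm_zero)
    finally have "L (vscale V (-1) (y (u n))) \<le> - \<delta>" using L_le[of "vscale V (-1) (y (u n))"] u[of n] by simp
    moreover have "L (vscale V (-1) (y (u n))) = L l - L (u n)"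
      using L_scale[of "y (u n)" "-1"] L_add[of "u n" "vscale V (-1) l"] L_scale[OF l, of "-1"] u[of n] l
      by (simp add: y_def)
    ultimately show ?thesis by simp
  qed
  then have "L l + \<delta> \<le> L l" by (intro LIMSEQ_le_const[OF lim]) blast
  with \<open>0 < \<delta>\<close> show False by simp
qed

end

section \<open>Products and the space of square-integrable functions\<close>

definition prod_nspace :: "'v nspace \<Rightarrow> 'w nspace \<Rightarrow> ('v \<times> 'w) nspace" where
  "prod_nspace V W = \<lparr>vecs = vecs V \<times> vecs W,
     vadd = (\<lambda>x y. (vadd V (fst x) (fst y), vadd W (snd x) (snd y))),
     vscale = (\<lambda>c x. (vscale V c (fst x), vscale W c (snd x))),
     vnorm = (\<lambda>x. vnorm V (fst x) + vnorm W (snd x))\<rparr>"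

lemma seminormed_prod:
  assumes "seminormed V" "seminormed W"
  shows "seminormed (prod_nspace V W)"
proof -
  interpret V: seminormed V by fact
  interpret W: seminormed W by fact
  show ?thesis
  proof
    show "vecs (prod_nspace V W) \<noteq> {}" using V.nonempty W.nonempty by (auto simp: prod_nspace_def)
    fix u v :: "'a \<times> 'b" assume "u \<in> vecs (prod_nspace V W)" "v \<in> vecs (prod_nspace V W)"
    then show "vnorm (prod_nspace V W) (vadd (prod_nspace V W) u v) \<le> vnorm (prod_nspace V W) u + vnorm (prod_nspace V W) v"
      using V.norm_triangle[of "fst u" "fst v"] W.norm_triangle[of "snd u" "snd v"] by (auto simp: prod_nspace_def)
  qed (auto simp: prod_nspace_def V.add_assoc W.add_assoc V.scale_add W.scale_add
      V.add_scale W.add_scale V.scale_scale W.scale_scale V.scale_one W.scale_one V.zero_add W.zero_add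
      V.norm_scale W.norm_scale distrib_left intro: V.add_comm W.add_comm)
qed

text \<open>A functional on the product is the sum of its restrictions to the two axes, each of
  which is bounded on its factor.\<close>

lemma weakly_converges_prod:
  assumes "seminormed V" "seminormed W"
    and u: "\<And>n. u n \<in> vecs V" "a \<in> vecs V" and w: "\<And>n. w n \<in> vecs W" "b \<in> vecs W"
    and ua: "weakly_converges V u a" and wb: "weakly_converges W w b"
  shows "weakly_converges (prod_nspace V W) (\<lambda>n. (u n, w n)) (a, b)"
  unfolding weakly_converges_def
proof (intro allI impI)
  interpret V: seminormed V by fact
  interpret W: seminormed W by fact
  fix L assume "bounded_functional (prod_nspace V W) L"
  then obtain C where
    add: "\<And>x y x' y'. x \<in> vecs V \<Longrightarrow> x' \<in> vecs V \<Longrightarrow> y \<in> vecs W \<Longrightarrow> y' \<in> vecs W \<Longrightarrow>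
       L (vadd V x x', vadd W y y') = L (x, y) + L (x', y')"
    and scale: "\<And>c x y. x \<in> vecs V \<Longrightarrow> y \<in> vecs W \<Longrightarrow> L (vscale V c x, vscale W c y) = c * L (x, y)"
    and C: "\<And>x y. x \<in> vecs V \<Longrightarrow> y \<in> vecs W \<Longrightarrow> \<bar>L (x, y)\<bar> \<le> C * (vnorm V x + vnorm W y)"
    unfolding bounded_functional_def prod_nspace_def by force
  let ?oV = "vscale V 0 a" and ?oW = "vscale W 0 b"
  have "bounded_functional V (\<lambda>x. L (x, ?oW))"
    unfolding bounded_functional_def
  proof (intro conjI ballI allI exI[of _ C])
    fix x y assume x: "x \<in> vecs V" and y: "y \<in> vecs V"
    show "L (vadd V x y, ?oW) = L (x, ?oW) + L (y, ?oW)"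
      using add[OF x y, of ?oW ?oW] w by (simp add: W.zero_add)
  next
    fix c x assume x: "x \<in> vecs V"
    show "L (vscale V c x, ?oW) = c * L (x, ?oW)"
      using scale[OF x, of ?oW c] w by (simp add: W.scale_0_scale)
  next
    fix x assume x: "x \<in> vecs V"
    show "\<bar>L (x, ?oW)\<bar> \<le> C * vnorm V x" using C[OF x, of ?oW] w by (simp add: W.norm_zero)
  qed
  then have 1: "(\<lambda>n. L (u n, ?oW)) \<longlonglongrightarrow> L (a, ?oW)"
    by (rule ua[unfolded weakly_converges_def, rule_format])
  have "bounded_functional W (\<lambda>x. L (?oV, x))"
    unfolding bounded_functional_def
  proof (intro conjI ballI allI exI[of _ C])
    fix x y assume x: "x \<in> vecs W" and y: "y \<in> vecs W"
    show "L (?oV, vadd W x y) = L (?oV, x) + L (?oV, y)"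
      using add[OF _ _ x y, of ?oV ?oV] u by (simp add: V.zero_add)
  next
    fix c x assume x: "x \<in> vecs W"
    show "L (?oV, vscale W c x) = c * L (?oV, x)"
      using scale[OF _ x, of ?oV c] u by (simp add: V.scale_0_scale)
  next
    fix x assume x: "x \<in> vecs W"
    show "\<bar>L (?oV, x)\<bar> \<le> C * vnorm W x" using C[OF _ x, of ?oV] u by (simp add: V.norm_zero)
  qed
  then have 2: "(\<lambda>n. L (?oV, w n)) \<longlonglongrightarrow> L (?oV, b)"
    by (rule wb[unfolded weakly_converges_def, rule_format])
  have split: "L (x, y) = L (x, ?oW) + L (?oV, y)" if "x \<in> vecs V" "y \<in> vecs W" for x y
    using add[of x ?oV ?oW y] that u w V.add_comm[of x ?oV] by (simp add: V.zero_add W.zero_add)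
  show "(\<lambda>n. L (u n, w n)) \<longlonglongrightarrow> L (a, b)"
    unfolding split[OF u(1) w(1)] split[OF u(2) w(2)] by (rule tendsto_add[OF 1 2])
qed

lemma vnorm_L2_space: "vnorm (L2_space m) = l2norm m"
  by (simp add: L2_space_def l2norm_def fun_eq_iff)

lemma vdist_L2_space: "vdist (L2_space m) f g = l2norm m (\<lambda>x. f x - g x)"
  by (simp add: vdist_def vnorm_L2_space) (simp add: L2_space_def)

lemma seminormed_L2_space: "seminormed (L2_space m)"
proof
  show "vecs (L2_space m) \<noteq> {}" using L2_zero by (auto simp: L2_space_def)
  fix u v assume "u \<in> vecs (L2_space m)" "v \<in> vecs (L2_space m)"
  then show "vnorm (L2_space m) (vadd (L2_space m) u v) \<le> vnorm (L2_space m) u + vnorm (L2_space m) v"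
    unfolding vnorm_L2_space by (simp add: L2_space_def l2norm_triangle)
next
  fix u and c :: real
  show "vnorm (L2_space m) (vscale (L2_space m) c u) = \<bar>c\<bar> * vnorm (L2_space m) u"
    unfolding vnorm_L2_space by (simp add: L2_space_def l2norm_cmult)
qed (auto simp: L2_space_def L2_add L2_cmult algebra_simps)

section \<open>The cotangent module\<close>

lemma S2_measurable: "f \<in> S2 m \<Longrightarrow> f \<in> borel_measurable m"
  by (simp add: S2_def)

section \<open>Calculus of minimal weak upper gradients\<close>

locale borel_space =
  fixes m :: "'a::polish_space measure"
  assumes sets_m: "sets m = sets borel"
begin

lemma space_m: "space m = UNIV"
  using sets_eq_imp_space_eq[OF sets_m] by simp

lemma min_wug:
  assumes "f \<in> S2 m"
  shows weak_upper_gradient_min_wug: "weak_upper_gradient m f (min_wug m f)"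
    and min_wug_le: "weak_upper_gradient m f H \<Longrightarrow> AE x in m. min_wug m f x \<le> H x"
proof -
  obtain G0 where f: "f \<in> borel_measurable m" and "weak_upper_gradient m f G0" using assms by (auto simp: S2_def)
  from someI_ex[OF ex_minimal_weak_upper_gradient[OF sets_m this], folded min_wug_def]
  show "weak_upper_gradient m f (min_wug m f)"
    "weak_upper_gradient m f H \<Longrightarrow> AE x in m. min_wug m f x \<le> H x" by blast+
qed

lemma min_wug_L2: "f \<in> S2 m \<Longrightarrow> min_wug m f \<in> L2 m"
  and min_wug_nonneg: "f \<in> S2 m \<Longrightarrow> 0 \<le> min_wug m f x"
  using weak_upper_gradient_L2 weak_upper_gradient_nonneg weak_upper_gradient_min_wug by blast+

lemma S2I: "f \<in> borel_measurable m \<Longrightarrow> weak_upper_gradient m f G \<Longrightarrow> f \<in> S2 m"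
  by (auto simp: S2_def)

lemma S2_add:
  assumes "f \<in> S2 m" "h \<in> S2 m"
  shows "(\<lambda>x. f x + h x) \<in> S2 m"
  using weak_upper_gradient_add[OF sets_m S2_measurable[OF assms(1)] weak_upper_gradient_min_wug[OF assms(1)]
      S2_measurable[OF assms(2)] weak_upper_gradient_min_wug[OF assms(2)]]
    borel_measurable_add[OF S2_measurable[OF assms(1)] S2_measurable[OF assms(2)]]
  by (intro S2I)

lemma S2_cmult:
  assumes "f \<in> S2 m"
  shows "(\<lambda>x. c * f x) \<in> S2 m"
  using weak_upper_gradient_cmult[OF sets_m S2_measurable[OF assms] weak_upper_gradient_min_wug[OF assms]]
    S2_measurable[OF assms]
  by (intro S2I) auto

lemma S2_diff: "f \<in> S2 m \<Longrightarrow> h \<in> S2 m \<Longrightarrow> (\<lambda>x. f x - h x) \<in> S2 m"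
  using S2_add[of f "\<lambda>x. - 1 * h x"] S2_cmult[of h "- 1"] by simp

lemma S2_zero: "(\<lambda>x. 0) \<in> S2 m"
  by (rule S2I[OF _ weak_upper_gradient_zero]) simp

lemma min_wug_add:
  assumes "f \<in> S2 m" "h \<in> S2 m"
  shows "AE x in m. min_wug m (\<lambda>x. f x + h x) x \<le> min_wug m f x + min_wug m h x"
  by (rule min_wug_le[OF S2_add[OF assms]])
     (rule weak_upper_gradient_add[OF sets_m S2_measurable[OF assms(1)] weak_upper_gradient_min_wug[OF assms(1)]
      S2_measurable[OF assms(2)] weak_upper_gradient_min_wug[OF assms(2)]])

lemma min_wug_zero: "AE x in m. min_wug m (\<lambda>x. 0) x = 0"
  using min_wug_le[OF S2_zero weak_upper_gradient_zero]
  by eventually_elim (use min_wug_nonneg[OF S2_zero] in \<open>auto intro: antisym\<close>)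

lemma min_wug_cmult_le:
  assumes "f \<in> S2 m"
  shows "AE x in m. min_wug m (\<lambda>x. c * f x) x \<le> \<bar>c\<bar> * min_wug m f x"
  by (rule min_wug_le[OF S2_cmult[OF assms]])
     (rule weak_upper_gradient_cmult[OF sets_m S2_measurable[OF assms] weak_upper_gradient_min_wug[OF assms]])

text \<open>For \<open>c\<close> other than 0, the inequality \<open>min_wug_cmult_le\<close> is
  used for \<open>c\<close> and, applied to the multiple, for \<open>1/c\<close>.\<close>

lemma min_wug_cmult:
  assumes "f \<in> S2 m"
  shows "AE x in m. min_wug m (\<lambda>x. c * f x) x = \<bar>c\<bar> * min_wug m f x"
proof (cases "c = 0")
  case True
  then show ?thesis using min_wug_zero by simp
next
  case False
  have "AE x in m. min_wug m (\<lambda>x. (1/c) * (c * f x)) x \<le> \<bar>1/c\<bar> * min_wug m (\<lambda>x. c * f x) x"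
    by (rule min_wug_cmult_le[OF S2_cmult[OF assms]])
  then have "AE x in m. min_wug m f x \<le> \<bar>1/c\<bar> * min_wug m (\<lambda>x. c * f x) x" using False by simp
  then show ?thesis using min_wug_cmult_le[OF assms, of c]
  proof eventually_elim
    case (elim x)
    have "\<bar>c\<bar> * min_wug m f x \<le> \<bar>c\<bar> * (\<bar>1/c\<bar> * min_wug m (\<lambda>x. c * f x) x)"
      by (rule mult_left_mono[OF elim(1)]) simp
    also have "\<dots> = min_wug m (\<lambda>x. c * f x) x" using False by simp
    finally show ?case using elim(2) by simp
  qed
qed

lemma min_wug_diff_commute:
  assumes "f \<in> S2 m" "h \<in> S2 m"
  shows "AE x in m. min_wug m (\<lambda>x. f x - h x) x = min_wug m (\<lambda>x. h x - f x) x"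
  using min_wug_cmult[OF S2_diff[OF assms(2,1)], of "- 1"] by simp

lemma min_wug_diff_triangle:
  assumes "f \<in> S2 m" "h \<in> S2 m" "k \<in> S2 m"
  shows "AE x in m. min_wug m (\<lambda>x. f x - k x) x \<le> min_wug m (\<lambda>x. f x - h x) x + min_wug m (\<lambda>x. h x - k x) x"
  using min_wug_add[OF S2_diff[OF assms(1,2)] S2_diff[OF assms(2,3)]] by simp

lemma min_wug_le_diff:
  assumes "f \<in> S2 m" "h \<in> S2 m"
  shows "AE x in m. min_wug m f x \<le> min_wug m (\<lambda>x. f x - h x) x + min_wug m h x"
  using min_wug_add[OF S2_diff[OF assms] assms(2)] by simp

section \<open>Countable families over a partition and their pointwise norm\<close>

definition partition_family :: "'a cot_family \<Rightarrow> bool" where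
  "partition_family F \<longleftrightarrow> countable F \<and> (\<forall>p\<in>F. fst p \<in> S2 m \<and> snd p \<in> sets m) \<and>
     (\<forall>p\<in>F. \<forall>q\<in>F. p \<noteq> q \<longrightarrow> snd p \<inter> snd q = {}) \<and> \<Union>(snd ` F) = UNIV"

lemma partition_familyD:
  assumes "partition_family F"
  shows partition_countable: "countable F"
    and partition_S2: "p \<in> F \<Longrightarrow> fst p \<in> S2 m"
    and partition_sets: "p \<in> F \<Longrightarrow> snd p \<in> sets m"
    and partition_unique: "p \<in> F \<Longrightarrow> q \<in> F \<Longrightarrow> x \<in> snd p \<Longrightarrow> x \<in> snd q \<Longrightarrow> p = q"
    and partition_cover: "\<exists>p\<in>F. x \<in> snd p"
  using assms by (auto simp: partition_family_def)

lemma pointwise_norm_eq: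
  assumes F: "partition_family F" and p: "p \<in> F" "x \<in> snd p"
  shows "cot_pointwise_norm m F x = min_wug m (fst p) x"
proof -
  have "(THE p. p \<in> F \<and> x \<in> snd p) = p"
    by (rule the_equality) (use p partition_unique[OF F _ p(1) _ p(2)] in blast)+
  then show ?thesis by (simp add: cot_pointwise_norm_def)
qed

lemma pointwise_norm_nonneg:
  assumes "partition_family F"
  shows "0 \<le> cot_pointwise_norm m F x"
proof -
  obtain p where p: "p \<in> F" "x \<in> snd p" using partition_cover[OF assms] by blast
  then show ?thesis using min_wug_nonneg[OF partition_S2[OF assms p(1)]] by (simp add: pointwise_norm_eq[OF assms p])
qed

lemma pointwise_norm_measurable:
  assumes F: "partition_family F"
  shows "cot_pointwise_norm m F \<in> borel_measurable m"
proof (rule measurable_piecewise_restrict[where C="snd ` F"])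
  show "countable (snd ` F)" using partition_countable[OF F] by simp
  show "A \<inter> space m \<in> sets m" if "A \<in> snd ` F" for A using that partition_sets[OF F] space_m by auto
  show "space m \<subseteq> \<Union>(snd ` F)" using partition_cover[OF F] by blast
  fix A assume "A \<in> snd ` F"
  then obtain p where p: "p \<in> F" "A = snd p" by blast
  have "min_wug m (fst p) \<in> borel_measurable (restrict_space m A)"
    by (intro measurable_restrict_space1 L2_measurable min_wug_L2 partition_S2[OF F p(1)])
  then show "cot_pointwise_norm m F \<in> borel_measurable (restrict_space m A)"
    by (subst measurable_cong[where g="min_wug m (fst p)"])
       (auto simp: space_restrict_space p pointwise_norm_eq[OF F p(1)])
qed

text \<open>Sum and integral are exchanged, and at each point exactly one member of the family
  contributes. The condition of finite norm is thereby separated from the partition conditions,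
  under which the pointwise norm already makes sense and is measurable.\<close>

lemma cot_families_iff:
  "F \<in> cot_families m \<longleftrightarrow> partition_family F \<and> cot_pointwise_norm m F \<in> L2 m"
proof -
  have "(\<integral>\<^sup>+(f, A). (\<integral>\<^sup>+x\<in>A. ennreal ((min_wug m f x)\<^sup>2) \<partial>m) \<partial>count_space F)
     = (\<integral>\<^sup>+x. ennreal ((cot_pointwise_norm m F x)\<^sup>2) \<partial>m)" if F: "partition_family F"
  proof -
    have "(\<integral>\<^sup>+(f, A). (\<integral>\<^sup>+x\<in>A. ennreal ((min_wug m f x)\<^sup>2) \<partial>m) \<partial>count_space F)
      = (\<integral>\<^sup>+p. (\<integral>\<^sup>+x. ennreal ((min_wug m (fst p) x)\<^sup>2) * indicator (snd p) x \<partial>m) \<partial>count_space F)"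
      by (simp add: case_prod_beta')
    also have "\<dots> = (\<integral>\<^sup>+x. (\<integral>\<^sup>+p. ennreal ((min_wug m (fst p) x)\<^sup>2) * indicator (snd p) x \<partial>count_space F) \<partial>m)"
      by (rule nn_integral_count_space_nn_integral[symmetric])
         (use partition_countable[OF F] partition_sets[OF F] L2_measurable[OF min_wug_L2[OF partition_S2[OF F]]]
           in \<open>auto intro!: borel_measurable_times_ennreal measurable_compose[OF borel_measurable_power measurable_ennreal]\<close>)
    also have "\<dots> = (\<integral>\<^sup>+x. ennreal ((cot_pointwise_norm m F x)\<^sup>2) \<partial>m)"
    proof (rule nn_integral_cong)
      fix x
      obtain p where p: "p \<in> F" "x \<in> snd p" using partition_cover[OF F] by blast
      have "(\<integral>\<^sup>+q. ennreal ((min_wug m (fst q) x)\<^sup>2) * indicator (snd q) x \<partial>count_space F)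
         = (\<integral>\<^sup>+q. ennreal ((cot_pointwise_norm m F x)\<^sup>2) * indicator {p} q \<partial>count_space F)"
      proof (rule nn_integral_cong)
        fix q assume "q \<in> space (count_space F)"
        then have "x \<in> snd q \<longleftrightarrow> q = p" using p partition_unique[OF F _ p(1) _ p(2), of q] by auto
        then show "ennreal ((min_wug m (fst q) x)\<^sup>2) * indicator (snd q) x = ennreal ((cot_pointwise_norm m F x)\<^sup>2) * indicator {p} q"
          by (cases "q = p") (simp_all add: pointwise_norm_eq[OF F p])
      qed
      also have "\<dots> = ennreal ((cot_pointwise_norm m F x)\<^sup>2)"
        using p by (subst nn_integral_cmult_indicator) auto
      finally show "(\<integral>\<^sup>+q. ennreal ((min_wug m (fst q) x)\<^sup>2) * indicator (snd q) x \<partial>count_space F)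
         = ennreal ((cot_pointwise_norm m F x)\<^sup>2)" .
    qed
    finally show ?thesis .
  qed
  then show ?thesis
    using L2_nn_iff[OF pointwise_norm_measurable, of F]
    by (auto simp: cot_families_def partition_family_def space_m case_prod_beta')
qed

lemma cot_familyD:
  assumes "F \<in> cot_families m"
  shows cot_partition: "partition_family F" and cot_L2: "cot_pointwise_norm m F \<in> L2 m"
  using assms by (simp_all add: cot_families_iff)

text \<open>Countability of both families provides one null set for all pairs of members.\<close>

lemma AE_families:
  assumes F: "partition_family F" and H: "partition_family H"
    and R: "\<And>f h. f \<in> S2 m \<Longrightarrow> h \<in> S2 m \<Longrightarrow> AE x in m. R f h x"
  shows "AE x in m. \<forall>p\<in>F. \<forall>q\<in>H. R (fst p) (fst q) x"
  by (intro AE_ball_countable' R partition_S2[OF F] partition_S2[OF H] partition_countable F H)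

abbreviation gap :: "('a \<Rightarrow> real) \<times> 'a set \<Rightarrow> ('a \<Rightarrow> real) \<times> 'a set \<Rightarrow> 'a \<Rightarrow> real" where
  "gap p q \<equiv> min_wug m (\<lambda>y. fst p y - fst q y)"

abbreviation coincide :: "'a cot_family \<Rightarrow> 'a cot_family \<Rightarrow> 'a \<Rightarrow> bool" where
  "coincide F H x \<equiv> \<forall>p\<in>F. \<forall>q\<in>H. x \<in> snd p \<longrightarrow> x \<in> snd q \<longrightarrow> gap p q x = 0"

text \<open>The countable quantifiers move inside the a.e. statement, so that one can argue at a
  fixed point with the pieces that contain it.\<close>

lemma cot_rel_iff:
  "(F, H) \<in> cot_rel m \<longleftrightarrow> F \<in> cot_families m \<and> H \<in> cot_families m \<and>
     (AE x in m. coincide F H x)"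
proof -
  have "(AE x in m. coincide F H x)
    \<longleftrightarrow> (\<forall>p\<in>F. \<forall>q\<in>H. AE x in m. x \<in> snd p \<longrightarrow> x \<in> snd q \<longrightarrow> gap p q x = 0)"
    if "F \<in> cot_families m" "H \<in> cot_families m"
    using partition_countable[OF cot_partition[OF that(1)]] partition_countable[OF cot_partition[OF that(2)]]
    by (simp only: AE_ball_countable)
  moreover have "(F, H) \<in> cot_rel m \<longleftrightarrow> F \<in> cot_families m \<and> H \<in> cot_families m \<and>
    (\<forall>p\<in>F. \<forall>q\<in>H. AE x in m. x \<in> snd p \<longrightarrow> x \<in> snd q \<longrightarrow> gap p q x = 0)"
    by (simp only: cot_rel_def mem_Collect_eq case_prod_beta' Int_iff imp_conjL fst_conv snd_conv)
  ultimately show ?thesis by blast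
qed

lemma cot_addI: "a \<in> F \<Longrightarrow> b \<in> H \<Longrightarrow> (\<lambda>x. fst a x + fst b x, snd a \<inter> snd b) \<in> cot_add F H"
  by (cases a, cases b) (force simp: cot_add_def)

lemma cot_addE:
  assumes "p \<in> cot_add F H"
  obtains a b where "a \<in> F" "b \<in> H" "p = (\<lambda>x. fst a x + fst b x, snd a \<inter> snd b)"
  using assms by (force simp: cot_add_def)

lemma cot_scaleI: "a \<in> F \<Longrightarrow> (\<lambda>x. c * fst a x, snd a) \<in> cot_scale c F"
  by (cases a) (force simp: cot_scale_def)

lemma cot_scaleE:
  assumes "p \<in> cot_scale c F"
  obtains a where "a \<in> F" "p = (\<lambda>x. c * fst a x, snd a)"
  using assms by (force simp: cot_scale_def)

lemma partition_add:
  assumes F: "partition_family F" and H: "partition_family H"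
  shows "partition_family (cot_add F H)"
  unfolding partition_family_def
proof (intro conjI ballI impI)
  show "countable (cot_add F H)"
    unfolding cot_add_def using partition_countable[OF F] partition_countable[OF H] by simp
  show "fst p \<in> S2 m" "snd p \<in> sets m" if "p \<in> cot_add F H" for p
    using that partition_S2[OF F] partition_S2[OF H] partition_sets[OF F] partition_sets[OF H]
    by (fastforce simp: cot_add_def intro!: S2_add)+
  show "snd p \<inter> snd q = {}" if pq: "p \<in> cot_add F H" "q \<in> cot_add F H" "p \<noteq> q" for p q
  proof (rule ccontr)
    assume "snd p \<inter> snd q \<noteq> {}"
    then obtain x where x: "x \<in> snd p" "x \<in> snd q" by blast
    obtain a b where p: "a \<in> F" "b \<in> H" "p = (\<lambda>x. fst a x + fst b x, snd a \<inter> snd b)"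
      using pq(1) by (rule cot_addE)
    obtain a' b' where q: "a' \<in> F" "b' \<in> H" "q = (\<lambda>x. fst a' x + fst b' x, snd a' \<inter> snd b')"
      using pq(2) by (rule cot_addE)
    have "a = a'" "b = b'"
      using partition_unique[OF F p(1) q(1)] partition_unique[OF H p(2) q(2)] x p(3) q(3) by auto
    then show False using pq(3) p q by simp
  qed
  show "\<Union>(snd ` cot_add F H) = UNIV"
  proof -
    have "x \<in> \<Union>(snd ` cot_add F H)" for x
    proof -
      obtain a b where "a \<in> F" "x \<in> snd a" "b \<in> H" "x \<in> snd b"
        using partition_cover[OF F] partition_cover[OF H] by blast
      then show ?thesis by (cases a, cases b) (force simp: cot_add_def)
    qed
    then show ?thesis by blast
  qed
qed

lemma partition_scale:
  assumes F: "partition_family F"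
  shows "partition_family (cot_scale c F)"
  unfolding partition_family_def
proof (intro conjI ballI impI)
  show "countable (cot_scale c F)"
    unfolding cot_scale_def using partition_countable[OF F] by simp
  show "fst p \<in> S2 m" "snd p \<in> sets m" if "p \<in> cot_scale c F" for p
    using that partition_S2[OF F] partition_sets[OF F] by (auto elim!: cot_scaleE intro!: S2_cmult)
  show "snd p \<inter> snd q = {}" if pq: "p \<in> cot_scale c F" "q \<in> cot_scale c F" "p \<noteq> q" for p q
  proof (rule ccontr)
    assume "snd p \<inter> snd q \<noteq> {}"
    then obtain x where x: "x \<in> snd p" "x \<in> snd q" by blast
    obtain a where p: "a \<in> F" "p = (\<lambda>x. c * fst a x, snd a)" using pq(1) by (rule cot_scaleE)
    obtain b where q: "b \<in> F" "q = (\<lambda>x. c * fst b x, snd b)" using pq(2) by (rule cot_scaleE)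
    have "a = b" using partition_unique[OF F p(1) q(1)] x p(2) q(2) by auto
    then show False using pq(3) p q by simp
  qed
  show "\<Union>(snd ` cot_scale c F) = UNIV"
  proof -
    have "x \<in> \<Union>(snd ` cot_scale c F)" for x
    proof -
      obtain a where a: "a \<in> F" "x \<in> snd a" using partition_cover[OF F] by blast
      then show ?thesis by (intro UnionI[OF imageI[OF cot_scaleI[OF a(1)]]]) simp
    qed
    then show ?thesis by blast
  qed
qed

lemma AE_pointwise_norm_add:
  assumes F: "partition_family F" and H: "partition_family H"
  shows "AE x in m. cot_pointwise_norm m (cot_add F H) x \<le> cot_pointwise_norm m F x + cot_pointwise_norm m H x"
proof -
  have "AE x in m. \<forall>p\<in>F. \<forall>q\<in>H. min_wug m (\<lambda>x. fst p x + fst q x) x \<le> min_wug m (fst p) x + min_wug m (fst q) x"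
    by (rule AE_families[OF F H, of "\<lambda>f h x. min_wug m (\<lambda>x. f x + h x) x \<le> min_wug m f x + min_wug m h x"]) (rule min_wug_add)
  then show ?thesis
  proof eventually_elim
    case (elim x)
    obtain a b where ab: "a \<in> F" "x \<in> snd a" "b \<in> H" "x \<in> snd b"
      using partition_cover[OF F] partition_cover[OF H] by blast
    have "cot_pointwise_norm m (cot_add F H) x = min_wug m (\<lambda>x. fst a x + fst b x) x"
      using pointwise_norm_eq[OF partition_add[OF F H] cot_addI[OF ab(1,3)]] ab by simp
    then show ?case
      using elim ab by (simp add: pointwise_norm_eq[OF F ab(1,2)] pointwise_norm_eq[OF H ab(3,4)])
  qed
qed

lemma AE_pointwise_norm_scale:
  assumes F: "partition_family F"
  shows "AE x in m. cot_pointwise_norm m (cot_scale c F) x = \<bar>c\<bar> * cot_pointwise_norm m F x"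
proof -
  have "AE x in m. \<forall>p\<in>F. \<forall>q\<in>F. min_wug m (\<lambda>x. c * fst p x) x = \<bar>c\<bar> * min_wug m (fst p) x"
    by (rule AE_families[OF F F, of "\<lambda>f h x. min_wug m (\<lambda>x. c * f x) x = \<bar>c\<bar> * min_wug m f x"]) (rule min_wug_cmult)
  then show ?thesis
  proof eventually_elim
    case (elim x)
    obtain a where a: "a \<in> F" "x \<in> snd a" using partition_cover[OF F] by blast
    have "cot_pointwise_norm m (cot_scale c F) x = min_wug m (\<lambda>x. c * fst a x) x"
      using pointwise_norm_eq[OF partition_scale[OF F] cot_scaleI[OF a(1)]] a by simp
    then show ?case using elim a by (simp add: pointwise_norm_eq[OF F a])
  qed
qed

lemma cot_add_family:
  assumes F: "F \<in> cot_families m" and H: "H \<in> cot_families m"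
  shows "cot_add F H \<in> cot_families m"
proof -
  note P = cot_partition[OF F] cot_partition[OF H]
  have "cot_pointwise_norm m (cot_add F H) \<in> L2 m"
    by (rule L2_bound[OF L2_add[OF cot_L2[OF F] cot_L2[OF H]] pointwise_norm_measurable[OF partition_add[OF P]]])
       (use AE_pointwise_norm_add[OF P] in eventually_elim, simp add: pointwise_norm_nonneg partition_add P)
  then show ?thesis using partition_add[OF P] by (simp add: cot_families_iff)
qed

lemma cot_scale_family:
  assumes F: "F \<in> cot_families m"
  shows "cot_scale c F \<in> cot_families m"
proof -
  note P = cot_partition[OF F]
  have "cot_pointwise_norm m (cot_scale c F) \<in> L2 m"
    by (rule L2_bound[OF L2_cmult[OF cot_L2[OF F], of c] pointwise_norm_measurable[OF partition_scale[OF P]]])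
       (use AE_pointwise_norm_scale[OF P, of c] in eventually_elim, simp add: abs_mult)
  then show ?thesis using partition_scale[OF P] by (simp add: cot_families_iff)
qed

end

section \<open>The quotient by the relation and its seminorm\<close>

context borel_space begin

lemma cot_relI:
  assumes "F \<in> cot_families m" "H \<in> cot_families m"
    and "AE x in m. coincide F H x"
  shows "(F, H) \<in> cot_rel m"
  using assms by (simp add: cot_rel_iff)

text \<open>Some vector space laws hold for classes only, because a sum lives on a refined partition
  and lists empty intersections of pieces as well. What survives is that the functions agree
  wherever pieces overlap.\<close>

lemma cot_relI_eq:
  assumes "F \<in> cot_families m" "H \<in> cot_families m"
    and "\<And>x p q. p \<in> F \<Longrightarrow> q \<in> H \<Longrightarrow> x \<in> snd p \<Longrightarrow> x \<in> snd q \<Longrightarrow> fst p = fst q"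
  shows "(F, H) \<in> cot_rel m"
proof (rule cot_relI[OF assms(1,2)])
  show "AE x in m. coincide F H x"
    using min_wug_zero
  proof eventually_elim
    case (elim x)
    show ?case
    proof (intro ballI impI)
      fix p q assume "p \<in> F" "q \<in> H" "x \<in> snd p" "x \<in> snd q"
      then have "fst p = fst q" by (rule assms(3))
      then show "gap p q x = 0" using elim by simp
    qed
  qed
qed

text \<open>Symmetry comes from \<open>min_wug_diff_commute\<close>. For transitivity the piece of
  the middle family that contains the point is inserted into the triangle inequality.\<close>

lemma equiv_cot_rel: "equiv (cot_families m) (cot_rel m)"
proof (rule equivI)
  show "cot_rel m \<subseteq> cot_families m \<times> cot_families m" by (auto simp: cot_rel_iff)
  show "refl_on (cot_families m) (cot_rel m)"
  proof (rule refl_onI)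
    fix F assume F: "F \<in> cot_families m"
    show "(F, F) \<in> cot_rel m"
    proof (rule cot_relI_eq[OF F F])
      fix x p q assume "p \<in> F" "q \<in> F" "x \<in> snd p" "x \<in> snd q"
      then have "p = q" by (rule partition_unique[OF cot_partition[OF F]])
      then show "fst p = fst q" by simp
    qed
  qed
  show "sym (cot_rel m)"
  proof (rule symI)
    fix F H assume FH: "(F, H) \<in> cot_rel m"
    then have c: "F \<in> cot_families m" "H \<in> cot_families m" by (simp_all add: cot_rel_iff)
    have "AE x in m. \<forall>p\<in>H. \<forall>q\<in>F. gap p q x = gap q p x"
      by (rule AE_families[OF cot_partition[OF c(2)] cot_partition[OF c(1)],
            of "\<lambda>f h x. min_wug m (\<lambda>y. f y - h y) x = min_wug m (\<lambda>y. h y - f y) x"]) (rule min_wug_diff_commute)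
    moreover have "AE x in m. coincide F H x"
      using FH by (simp add: cot_rel_iff)
    ultimately have "AE x in m. coincide H F x"
    proof eventually_elim
      case (elim x)
      show ?case
      proof (intro ballI impI)
        fix p q assume pq: "p \<in> H" "q \<in> F" "x \<in> snd p" "x \<in> snd q"
        have "gap p q x = gap q p x"
          using elim(1) pq by blast
        also have "\<dots> = 0" using elim(2) pq by blast
        finally show "gap p q x = 0" .
      qed
    qed
    then show "(H, F) \<in> cot_rel m" by (rule cot_relI[OF c(2,1)])
  qed
  show "trans (cot_rel m)"
  proof (rule transI)
    fix F H K assume FH: "(F, H) \<in> cot_rel m" and HK: "(H, K) \<in> cot_rel m"
    then have c: "F \<in> cot_families m" "H \<in> cot_families m" "K \<in> cot_families m" by (simp_all add: cot_rel_iff)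
    note P = cot_partition[OF c(1)] cot_partition[OF c(2)] cot_partition[OF c(3)]
    have "AE x in m. \<forall>p\<in>F. \<forall>q\<in>K. \<forall>r\<in>H. gap p q x
         \<le> gap p r x + gap r q x"
      by (intro AE_ball_countable' min_wug_diff_triangle partition_S2[OF P(1)] partition_S2[OF P(2)]
          partition_S2[OF P(3)] partition_countable P)
    moreover have "AE x in m. coincide F H x"
       "AE x in m. coincide H K x"
      using FH HK by (simp_all add: cot_rel_iff)
    ultimately have "AE x in m. coincide F K x"
    proof eventually_elim
      case (elim x)
      show ?case
      proof (intro ballI impI)
        fix p q assume pq: "p \<in> F" "q \<in> K" "x \<in> snd p" "x \<in> snd q"
        obtain r where r: "r \<in> H" "x \<in> snd r" using partition_cover[OF P(2)] by blast
        have "gap p r x = 0" "gap r q x = 0"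
          using elim(2,3) pq r by blast+
        moreover have "gap p q x
         \<le> gap p r x + gap r q x"
          using elim(1) pq(1,2) r(1) by blast
        moreover have "0 \<le> gap p q x"
          by (intro min_wug_nonneg S2_diff partition_S2[OF P(1) pq(1)] partition_S2[OF P(3) pq(2)])
        ultimately show "gap p q x = 0" by linarith
      qed
    qed
    then show "(F, K) \<in> cot_rel m" by (rule cot_relI[OF c(1,3)])
  qed
qed

abbreviation cot_cls where "cot_cls F \<equiv> cot_rel m `` {F}"

lemma cot_cls_cong: "(F, H) \<in> cot_rel m \<Longrightarrow> cot_cls F = cot_cls H"
  by (rule equiv_class_eq[OF equiv_cot_rel])

lemma cot_cls_self: "F \<in> cot_families m \<Longrightarrow> F \<in> cot_cls F"
  by (rule equiv_class_self[OF equiv_cot_rel])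

lemma vecs_pre_cotangent: "vecs (pre_cotangent m) = cot_cls ` cot_families m"
  by (auto simp: pre_cotangent_def quotient_def)

text \<open>A difference of sums is a sum of differences, whose gradients vanish a.e. on overlapping
  pieces.\<close>

lemma cot_add_rel:
  assumes "(F, F') \<in> cot_rel m" "(H, H') \<in> cot_rel m"
  shows "(cot_add F H, cot_add F' H') \<in> cot_rel m"
proof -
  have c: "F \<in> cot_families m" "F' \<in> cot_families m" "H \<in> cot_families m" "H' \<in> cot_families m"
    using assms by (simp_all add: cot_rel_iff)
  note P = cot_partition[OF c(1)] cot_partition[OF c(2)] cot_partition[OF c(3)] cot_partition[OF c(4)]
  have tri: "AE x in m. min_wug m (\<lambda>y. (a y + b y) - (a' y + b' y)) x
      \<le> min_wug m (\<lambda>y. a y - a' y) x + min_wug m (\<lambda>y. b y - b' y) x"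
    if "a \<in> S2 m" "a' \<in> S2 m" "b \<in> S2 m" "b' \<in> S2 m" for a a' b b'
  proof -
    have "(\<lambda>y. (a y + b y) - (a' y + b' y)) = (\<lambda>y. (a y - a' y) + (b y - b' y))" by (auto simp: fun_eq_iff)
    then show ?thesis using min_wug_add[OF S2_diff[OF that(1,2)] S2_diff[OF that(3,4)]] by simp
  qed
  have "AE x in m. \<forall>a\<in>F. \<forall>a'\<in>F'. \<forall>b\<in>H. \<forall>b'\<in>H'. min_wug m (\<lambda>y. (fst a y + fst b y) - (fst a' y + fst b' y)) x
      \<le> gap a a' x + gap b b' x"
    by (intro AE_ball_countable' tri partition_S2[OF P(1)] partition_S2[OF P(2)]
          partition_S2[OF P(3)] partition_S2[OF P(4)] partition_countable P)
  moreover have "AE x in m. coincide F F' x"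
     "AE x in m. coincide H H' x"
    using assms by (simp_all add: cot_rel_iff)
  ultimately have "AE x in m. coincide (cot_add F H) (cot_add F' H') x"
  proof eventually_elim
    case (elim x)
    show ?case
    proof (intro ballI impI)
      fix p q assume pq: "p \<in> cot_add F H" "q \<in> cot_add F' H'" and x: "x \<in> snd p" "x \<in> snd q"
      obtain a b where p: "a \<in> F" "b \<in> H" "p = (\<lambda>x. fst a x + fst b x, snd a \<inter> snd b)"
        using pq(1) by (rule cot_addE)
      obtain a' b' where q: "a' \<in> F'" "b' \<in> H'" "q = (\<lambda>x. fst a' x + fst b' x, snd a' \<inter> snd b')"
        using pq(2) by (rule cot_addE)
      have "gap a a' x = 0" "gap b b' x = 0"
        using elim(2,3) p q x by auto
      moreover have "gap p q x
         \<le> gap a a' x + gap b b' x"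
        using elim(1) p q by simp
      moreover have "0 \<le> gap p q x"
        by (intro min_wug_nonneg S2_diff partition_S2[OF partition_add[OF P(1,3)] pq(1)]
            partition_S2[OF partition_add[OF P(2,4)] pq(2)])
      ultimately show "gap p q x = 0" by linarith
    qed
  qed
  then show ?thesis by (intro cot_relI cot_add_family c)
qed

lemma cot_scale_rel:
  assumes "(F, F') \<in> cot_rel m"
  shows "(cot_scale c F, cot_scale c F') \<in> cot_rel m"
proof -
  have k: "F \<in> cot_families m" "F' \<in> cot_families m"
    using assms by (simp_all add: cot_rel_iff)
  note P = cot_partition[OF k(1)] cot_partition[OF k(2)]
  have hom: "AE x in m. min_wug m (\<lambda>y. c * a y - c * a' y) x = \<bar>c\<bar> * min_wug m (\<lambda>y. a y - a' y) x"
    if "a \<in> S2 m" "a' \<in> S2 m" for a a'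
    using min_wug_cmult[OF S2_diff[OF that], of c] by (simp add: right_diff_distrib)
  have "AE x in m. \<forall>a\<in>F. \<forall>a'\<in>F'. min_wug m (\<lambda>y. c * fst a y - c * fst a' y) x = \<bar>c\<bar> * gap a a' x"
    by (intro AE_ball_countable' hom partition_S2[OF P(1)] partition_S2[OF P(2)] partition_countable P)
  moreover have "AE x in m. coincide F F' x"
    using assms by (simp_all add: cot_rel_iff)
  ultimately have "AE x in m. coincide (cot_scale c F) (cot_scale c F') x"
  proof eventually_elim
    case (elim x)
    show ?case
    proof (intro ballI impI)
      fix p q assume pq: "p \<in> cot_scale c F" "q \<in> cot_scale c F'" and x: "x \<in> snd p" "x \<in> snd q"
      obtain a where p: "a \<in> F" "p = (\<lambda>x. c * fst a x, snd a)" using pq(1) by (rule cot_scaleE)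
      obtain a' where q: "a' \<in> F'" "q = (\<lambda>x. c * fst a' x, snd a')" using pq(2) by (rule cot_scaleE)
      show "gap p q x = 0"
        using elim p q x by simp
    qed
  qed
  then show ?thesis by (intro cot_relI cot_scale_family k)
qed

lemma add_cot_cls:
  assumes F: "F \<in> cot_families m" and H: "H \<in> cot_families m"
  shows "vadd (pre_cotangent m) (cot_cls F) (cot_cls H) = cot_cls (cot_add F H)"
proof -
  have "cot_cls (cot_add F' H') = cot_cls (cot_add F H)" if "F' \<in> cot_cls F" "H' \<in> cot_cls H" for F' H'
    using that by (intro cot_cls_cong[symmetric] cot_add_rel) auto
  then have "(\<Union>F'\<in>cot_cls F. \<Union>H'\<in>cot_cls H. cot_cls (cot_add F' H')) = cot_cls (cot_add F H)"
    using cot_cls_self[OF F] cot_cls_self[OF H] by (metis (no_types, lifting) UN_eq_const)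
  then show ?thesis by (simp only: pre_cotangent_def nspace.simps)
qed

lemma scale_cot_cls:
  assumes F: "F \<in> cot_families m"
  shows "vscale (pre_cotangent m) c (cot_cls F) = cot_cls (cot_scale c F)"
proof -
  have "cot_cls (cot_scale c F') = cot_cls (cot_scale c F)" if "F' \<in> cot_cls F" for F'
    using that by (intro cot_cls_cong[symmetric] cot_scale_rel) auto
  then have "(\<Union>F'\<in>cot_cls F. cot_cls (cot_scale c F')) = cot_cls (cot_scale c F)"
    using cot_cls_self[OF F] by (metis (no_types, lifting) UN_eq_const)
  then show ?thesis by (simp only: pre_cotangent_def nspace.simps)
qed

text \<open>At almost every point the gap of the two pieces containing it vanishes, and
  \<open>min_wug_le_diff\<close> is applied in both directions.\<close>

lemma pointwise_norm_cong:
  assumes "(F, H) \<in> cot_rel m"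
  shows "AE x in m. cot_pointwise_norm m F x = cot_pointwise_norm m H x"
proof -
  have c: "F \<in> cot_families m" "H \<in> cot_families m" using assms by (simp_all add: cot_rel_iff)
  note P = cot_partition[OF c(1)] cot_partition[OF c(2)]
  have "AE x in m. \<forall>p\<in>F. \<forall>q\<in>H. min_wug m (fst p) x \<le> gap p q x + min_wug m (fst q) x"
    by (intro AE_ball_countable' min_wug_le_diff partition_S2[OF P(1)] partition_S2[OF P(2)] partition_countable P)
  moreover have "AE x in m. \<forall>p\<in>F. \<forall>q\<in>H. min_wug m (fst q) x \<le> gap q p x + min_wug m (fst p) x"
    by (intro AE_ball_countable' min_wug_le_diff partition_S2[OF P(1)] partition_S2[OF P(2)] partition_countable P)
  moreover have "(H, F) \<in> cot_rel m" using assms equiv_cot_rel by (meson equivE symE)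
  then have "AE x in m. coincide H F x"
    by (simp add: cot_rel_iff)
  moreover have "AE x in m. coincide F H x"
    using assms by (simp add: cot_rel_iff)
  ultimately show ?thesis
  proof eventually_elim
    case (elim x)
    obtain p q where p: "p \<in> F" "x \<in> snd p" and q: "q \<in> H" "x \<in> snd q"
      using partition_cover[OF P(1)] partition_cover[OF P(2)] by blast
    have "min_wug m (fst p) x \<le> gap p q x + min_wug m (fst q) x"
      "min_wug m (fst q) x \<le> gap q p x + min_wug m (fst p) x"
      "gap q p x = 0" "gap p q x = 0"
      using elim p q by blast+
    then show ?case by (simp add: pointwise_norm_eq[OF P(1) p] pointwise_norm_eq[OF P(2) q])
  qed
qed

lemma norm_cot_cls:
  assumes F: "F \<in> cot_families m"
  shows "vnorm (pre_cotangent m) (cot_cls F) = l2norm m (cot_pointwise_norm m F)"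
proof -
  have "l2norm m (cot_pointwise_norm m F') = l2norm m (cot_pointwise_norm m F)" if "F' \<in> cot_cls F" for F'
  proof -
    have r: "(F, F') \<in> cot_rel m" using that by auto
    then have F': "F' \<in> cot_families m" by (simp add: cot_rel_iff)
    show ?thesis
      by (rule l2norm_cong_AE[OF L2_measurable[OF cot_L2[OF F']] L2_measurable[OF cot_L2[OF F]]])
         (use pointwise_norm_cong[OF r] in eventually_elim, simp)
  qed
  then have *: "\<forall>F'\<in>cot_cls F. l2norm m (cot_pointwise_norm m F) = l2norm m (cot_pointwise_norm m F')"
    by (metis (no_types, lifting))
  have "(THE r. \<forall>F'\<in>cot_cls F. r = l2norm m (cot_pointwise_norm m F')) = l2norm m (cot_pointwise_norm m F)"
  proof (rule the_equality)
    show "\<forall>F'\<in>cot_cls F. l2norm m (cot_pointwise_norm m F) = l2norm m (cot_pointwise_norm m F')" by (rule *)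
    fix r assume "\<forall>F'\<in>cot_cls F. r = l2norm m (cot_pointwise_norm m F')"
    then show "r = l2norm m (cot_pointwise_norm m F)" by (rule bspec[OF _ cot_cls_self[OF F]])
  qed
  then show ?thesis by (simp only: pre_cotangent_def nspace.simps l2norm_def)
qed

lemma singleton_family:
  assumes "f \<in> S2 m"
  shows "{(f, UNIV)} \<in> cot_families m" and "cot_pointwise_norm m {(f, UNIV)} = min_wug m f"
proof -
  have p: "partition_family {(f, UNIV)}"
    using assms by (simp add: partition_family_def sets_m)
  show n: "cot_pointwise_norm m {(f, UNIV)} = min_wug m f"
    using pointwise_norm_eq[OF p, of "(f, UNIV)"] by (auto simp: fun_eq_iff)
  show "{(f, UNIV)} \<in> cot_families m" using p min_wug_L2[OF assms] by (simp add: cot_families_iff n)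
qed

lemma seminormed_pre_cotangent: "seminormed (pre_cotangent m)"
proof -
  let ?V = "pre_cotangent m"
  note fam = cot_add_family cot_scale_family
  note rules = add_cot_cls scale_cot_cls fam
  have clsI: "cot_cls F \<in> vecs ?V" if "F \<in> cot_families m" for F using that by (simp add: vecs_pre_cotangent)
  show ?thesis
  proof
    show "vecs ?V \<noteq> {}" using singleton_family(1)[OF S2_zero] by (auto simp: vecs_pre_cotangent)
    fix P Q R :: "'a cot_family set" and a b :: real
    assume "P \<in> vecs ?V"
    then obtain F where F: "F \<in> cot_families m" "P = cot_cls F" by (auto simp: vecs_pre_cotangent)
    note PF = cot_partition[OF F(1)]
    show "vscale ?V a P \<in> vecs ?V" by (simp add: F rules clsI)
    have scale_scale: "cot_scale a (cot_scale b F) = cot_scale (a * b) F"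
      unfolding cot_scale_def by (auto simp: image_image case_prod_beta' mult.assoc)
    show "vscale ?V a (vscale ?V b P) = vscale ?V (a * b) P" by (simp add: F rules scale_scale)
    have "cot_scale 1 F = F" unfolding cot_scale_def by (simp add: case_prod_beta')
    then show "vscale ?V 1 P = P" by (simp add: F rules)
    have "(cot_scale (a + b) F, cot_add (cot_scale a F) (cot_scale b F)) \<in> cot_rel m"
    proof (rule cot_relI_eq)
      fix x p q assume pq: "p \<in> cot_scale (a + b) F" "q \<in> cot_add (cot_scale a F) (cot_scale b F)" and x: "x \<in> snd p" "x \<in> snd q"
      obtain u where u: "u \<in> F" "p = (\<lambda>x. (a + b) * fst u x, snd u)" using pq(1) by (rule cot_scaleE)
      obtain v' w' where q: "v' \<in> cot_scale a F" "w' \<in> cot_scale b F" "q = (\<lambda>x. fst v' x + fst w' x, snd v' \<inter> snd w')"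
        using pq(2) by (rule cot_addE)
      obtain v where v: "v \<in> F" "v' = (\<lambda>x. a * fst v x, snd v)" using q(1) by (rule cot_scaleE)
      obtain w where w: "w \<in> F" "w' = (\<lambda>x. b * fst w x, snd w)" using q(2) by (rule cot_scaleE)
      have "u = v" "u = w"
        using partition_unique[OF PF u(1) v(1), of x] partition_unique[OF PF u(1) w(1), of x] x u v w q by auto
      then show "fst p = fst q" using u q v w by (simp add: distrib_right)
    qed (simp_all add: F fam)
    from cot_cls_cong[OF this] show "vscale ?V (a + b) P = vadd ?V (vscale ?V a P) (vscale ?V b P)"
      by (simp add: F rules)
    show "vnorm ?V (vscale ?V a P) = \<bar>a\<bar> * vnorm ?V P"
    proof -
      have "l2norm m (cot_pointwise_norm m (cot_scale a F)) = l2norm m (\<lambda>x. a * cot_pointwise_norm m F x)"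
        by (rule l2norm_cong_AE)
           (use AE_pointwise_norm_scale[OF PF, of a] L2_measurable[OF L2_cmult[OF cot_L2[OF F(1)], of a]]
              L2_measurable[OF cot_L2[OF cot_scale_family[OF F(1)]]] in
            \<open>auto elim!: eventually_mono simp: abs_mult\<close>)
      then show ?thesis by (simp add: F rules norm_cot_cls l2norm_cmult)
    qed
    assume "Q \<in> vecs ?V"
    then obtain H where H: "H \<in> cot_families m" "Q = cot_cls H" by (auto simp: vecs_pre_cotangent)
    note PH = cot_partition[OF H(1)]
    show "vadd ?V P Q \<in> vecs ?V" by (simp add: F H rules clsI)
    have comm: "A \<in> cot_add H' F'" if A: "A \<in> cot_add F' H'" for A and F' H' :: "'a cot_family"
    proof -
      obtain a b where "a \<in> F'" "b \<in> H'" "A = (\<lambda>x. fst a x + fst b x, snd a \<inter> snd b)" using A by (rule cot_addE)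
      then show ?thesis using cot_addI[of b H' a F'] by (simp add: add.commute Int_commute)
    qed
    have "cot_add F H = cot_add H F" using comm by blast
    then show "vadd ?V P Q = vadd ?V Q P" by (simp add: F H rules)
    have "cot_scale a (cot_add F H) = cot_add (cot_scale a F) (cot_scale a H)"
    proof (intro equalityI subsetI)
      fix p assume "p \<in> cot_scale a (cot_add F H)"
      then obtain c where c: "c \<in> cot_add F H" "p = (\<lambda>x. a * fst c x, snd c)" by (rule cot_scaleE)
      obtain u v where uv: "u \<in> F" "v \<in> H" "c = (\<lambda>x. fst u x + fst v x, snd u \<inter> snd v)" using c(1) by (rule cot_addE)
      show "p \<in> cot_add (cot_scale a F) (cot_scale a H)"
        using cot_addI[OF cot_scaleI[OF uv(1)] cot_scaleI[OF uv(2)], of a a] by (simp add: c uv distrib_left)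
    next
      fix p assume "p \<in> cot_add (cot_scale a F) (cot_scale a H)"
      then obtain c d where cd: "c \<in> cot_scale a F" "d \<in> cot_scale a H" "p = (\<lambda>x. fst c x + fst d x, snd c \<inter> snd d)"
        by (rule cot_addE)
      obtain u where u: "u \<in> F" "c = (\<lambda>x. a * fst u x, snd u)" using cd(1) by (rule cot_scaleE)
      obtain v where v: "v \<in> H" "d = (\<lambda>x. a * fst v x, snd v)" using cd(2) by (rule cot_scaleE)
      show "p \<in> cot_scale a (cot_add F H)"
        using cot_scaleI[OF cot_addI[OF u(1) v(1)], of a] by (simp add: cd u v distrib_left)
    qed
    then show "vscale ?V a (vadd ?V P Q) = vadd ?V (vscale ?V a P) (vscale ?V a Q)" by (simp add: F H rules)
    \<comment> \<open>The left family lives on the common refinement with the partition of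
      \<open>F\<close>, so in general only the classes coincide.\<close>
    have "(cot_add (cot_scale 0 F) H, H) \<in> cot_rel m"
    proof (rule cot_relI_eq)
      fix x p q assume p: "p \<in> cot_add (cot_scale 0 F) H" and q: "q \<in> H" and x: "x \<in> snd p" "x \<in> snd q"
      obtain c d where cd: "c \<in> cot_scale 0 F" "d \<in> H" "p = (\<lambda>x. fst c x + fst d x, snd c \<inter> snd d)"
        using p by (rule cot_addE)
      obtain u where u: "u \<in> F" "c = (\<lambda>x. 0 * fst u x, snd u)" using cd(1) by (rule cot_scaleE)
      have "d = q" using partition_unique[OF PH cd(2) q, of x] x cd by auto
      then show "fst p = fst q" using cd u by simp
    qed (simp_all add: F H fam)
    from cot_cls_cong[OF this] show "vadd ?V (vscale ?V 0 P) Q = Q" by (simp add: F H rules)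
    show "vnorm ?V (vadd ?V P Q) \<le> vnorm ?V P + vnorm ?V Q"
    proof -
      have "l2norm m (cot_pointwise_norm m (cot_add F H)) \<le> l2norm m (\<lambda>x. cot_pointwise_norm m F x + cot_pointwise_norm m H x)"
        by (rule l2norm_mono_AE[OF L2_add[OF cot_L2[OF F(1)] cot_L2[OF H(1)]] L2_measurable[OF cot_L2[OF cot_add_family[OF F(1) H(1)]]]])
           (use AE_pointwise_norm_add[OF PF PH] in eventually_elim, simp add: pointwise_norm_nonneg partition_add PF PH)
      also have "\<dots> \<le> l2norm m (cot_pointwise_norm m F) + l2norm m (cot_pointwise_norm m H)"
        by (rule l2norm_triangle[OF cot_L2[OF F(1)] cot_L2[OF H(1)]])
      finally show ?thesis by (simp add: F H rules norm_cot_cls)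
    qed
    assume "R \<in> vecs ?V"
    then obtain K where K: "K \<in> cot_families m" "R = cot_cls K" by (auto simp: vecs_pre_cotangent)
    have "cot_add (cot_add F H) K = cot_add F (cot_add H K)"
    proof (intro equalityI subsetI)
      fix p assume "p \<in> cot_add (cot_add F H) K"
      then obtain c w where c: "c \<in> cot_add F H" "w \<in> K" "p = (\<lambda>x. fst c x + fst w x, snd c \<inter> snd w)" by (rule cot_addE)
      obtain u v where uv: "u \<in> F" "v \<in> H" "c = (\<lambda>x. fst u x + fst v x, snd u \<inter> snd v)" using c(1) by (rule cot_addE)
      show "p \<in> cot_add F (cot_add H K)"
        using cot_addI[OF uv(1) cot_addI[OF uv(2) c(2)]] by (simp add: c uv add.assoc Int_assoc)
    next
      fix p assume "p \<in> cot_add F (cot_add H K)"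
      then obtain u c where c: "u \<in> F" "c \<in> cot_add H K" "p = (\<lambda>x. fst u x + fst c x, snd u \<inter> snd c)" by (rule cot_addE)
      obtain v w where vw: "v \<in> H" "w \<in> K" "c = (\<lambda>x. fst v x + fst w x, snd v \<inter> snd w)" using c(2) by (rule cot_addE)
      show "p \<in> cot_add (cot_add F H) K"
        using cot_addI[OF cot_addI[OF c(1) vw(1)] vw(2)] by (simp add: c vw add.assoc Int_assoc)
    qed
    then show "vadd ?V (vadd ?V P Q) R = vadd ?V P (vadd ?V Q R)" by (simp add: F H K rules)
  qed
qed

end

section \<open>The differential as a linear map and its closedness\<close>

context borel_space begin

sublocale pre_cotangent: seminormed "pre_cotangent m"
  by (rule seminormed_pre_cotangent)

sublocale cotangent: seminormed "cotangent_module m"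
  unfolding cotangent_module_def by (rule pre_cotangent.seminormed_completion)

lemma differential_eq: "differential m f = completion_embed (pre_cotangent m) (cot_cls {(f, UNIV)})"
  by (simp add: differential_def space_m)

lemma cot_cls_singleton:
  assumes "f \<in> S2 m"
  shows "cot_cls {(f, UNIV)} \<in> vecs (pre_cotangent m)"
  using singleton_family(1)[OF assms] by (simp add: vecs_pre_cotangent)

lemma differential_in_cotangent: "f \<in> S2 m \<Longrightarrow> differential m f \<in> vecs (cotangent_module m)"
  unfolding differential_eq cotangent_module_def
  using pre_cotangent.embed_in_completion cot_cls_singleton by blast

lemma differential_add:
  assumes "f \<in> S2 m" "h \<in> S2 m"
  shows "differential m (\<lambda>x. f x + h x) = vadd (cotangent_module m) (differential m f) (differential m h)"
proof -
  have "cot_add {(f, UNIV)} {(h, UNIV)} = {(\<lambda>x. f x + h x, UNIV)}" by (simp add: cot_add_def)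
  then show ?thesis
    using add_cot_cls[OF singleton_family(1)[OF assms(1)] singleton_family(1)[OF assms(2)]]
      pre_cotangent.embed_add[OF cot_cls_singleton[OF assms(1)] cot_cls_singleton[OF assms(2)]]
    by (simp add: differential_eq cotangent_module_def)
qed

lemma differential_scale:
  assumes "f \<in> S2 m"
  shows "differential m (\<lambda>x. c * f x) = vscale (cotangent_module m) c (differential m f)"
proof -
  have "cot_scale c {(f, UNIV)} = {(\<lambda>x. c * f x, UNIV)}" by (simp add: cot_scale_def)
  then show ?thesis
    using scale_cot_cls[OF singleton_family(1)[OF assms], of c]
      pre_cotangent.embed_scale[OF cot_cls_singleton[OF assms] cot_cls_singleton[OF assms], of c]
    by (simp add: differential_eq cotangent_module_def)
qed

text \<open>A difference of differentials is the differential of the difference, and the embedding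
  keeps the norm. Cauchy and convergence conditions on differentials thus become conditions on
  minimal gradients in \<open>L2\<close>.\<close>

lemma dist_differential:
  assumes "f \<in> S2 m" "h \<in> S2 m"
  shows "vdist (cotangent_module m) (differential m f) (differential m h) = l2norm m (min_wug m (\<lambda>x. f x - h x))"
proof -
  let ?g = "\<lambda>x. f x - h x"
  have "vdist (cotangent_module m) (differential m f) (differential m h)
      = vnorm (cotangent_module m) (differential m (\<lambda>x. f x + -1 * h x))"
    unfolding vdist_def differential_scale[OF assms(2), symmetric]
      differential_add[OF assms(1) S2_cmult[OF assms(2)], symmetric] ..
  also have "\<dots> = vnorm (cotangent_module m) (differential m ?g)" by simp
  also have "\<dots> = vnorm (pre_cotangent m) (cot_cls {(?g, UNIV)})"
    unfolding differential_eq cotangent_module_def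
    using cot_cls_singleton[OF S2_diff[OF assms]] by (rule pre_cotangent.embed_norm) (rule cot_cls_singleton[OF assms(1)])
  also have "\<dots> = l2norm m (min_wug m ?g)"
    by (simp add: norm_cot_cls[OF singleton_family(1)[OF S2_diff[OF assms]]] singleton_family(2)[OF S2_diff[OF assms]])
  finally show ?thesis .
qed

text \<open>For fixed \<open>g\<close> the gradients of \<open>g - fs k\<close> form a Cauchy
  sequence, because two of them differ a.e. by at most the gradient of \<open>fs k - fs j\<close>.
  The lemma is applied with members of the sequence as \<open>g\<close>, where \<open>b\<close> is
  arbitrarily small.\<close>

lemma S2_minus_limit:
  assumes g: "g \<in> S2 m" and fs: "\<And>k. fs k \<in> S2 m" and f: "f \<in> borel_measurable m"
    and lim: "AE x in m. (\<lambda>k. fs k x) \<longlonglongrightarrow> f x"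
    and cauchy: "\<And>e. 0 < e \<Longrightarrow> \<exists>N. \<forall>k\<ge>N. \<forall>j\<ge>N. l2norm m (min_wug m (\<lambda>x. fs k x - fs j x)) < e"
    and bound: "\<And>k. N \<le> k \<Longrightarrow> l2norm m (min_wug m (\<lambda>x. g x - fs k x)) \<le> b"
  shows "(\<lambda>x. g x - f x) \<in> S2 m" "l2norm m (min_wug m (\<lambda>x. g x - f x)) \<le> b"
proof -
  define h where "h = (\<lambda>k. min_wug m (\<lambda>x. g x - fs k x))"
  have gS: "(\<lambda>x. g x - fs k x) \<in> S2 m" for k by (intro S2_diff g fs)
  have hL: "h k \<in> L2 m" and h0: "0 \<le> h k x" for k x
    unfolding h_def using min_wug_L2[OF gS] min_wug_nonneg[OF gS] by auto
  have hd: "l2norm m (\<lambda>x. h k x - h j x) \<le> l2norm m (min_wug m (\<lambda>x. fs k x - fs j x))" for k j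
  proof (rule l2norm_mono_AE)
    have kj: "(\<lambda>x. fs k x - fs j x) \<in> S2 m" by (intro S2_diff fs)
    show "min_wug m (\<lambda>x. fs k x - fs j x) \<in> L2 m" by (rule min_wug_L2[OF kj])
    show "(\<lambda>x. h k x - h j x) \<in> borel_measurable m" by (rule L2_measurable[OF L2_diff[OF hL hL]])
    show "AE x in m. \<bar>h k x - h j x\<bar> \<le> \<bar>min_wug m (\<lambda>x. fs k x - fs j x) x\<bar>"
      using min_wug_diff_triangle[OF g fs[of k] fs[of j]] min_wug_diff_triangle[OF g fs[of j] fs[of k]]
        min_wug_diff_commute[OF fs[of k] fs[of j]]
      by eventually_elim (auto simp: h_def abs_le_iff)
  qed
  have "\<exists>N. \<forall>k\<ge>N. \<forall>j\<ge>N. l2norm m (\<lambda>x. h k x - h j x) < e" if "0 < e" for e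
    using cauchy[OF that] hd by (meson le_less_trans)
  from L2_complete[OF hL this] obtain G where G: "G \<in> L2 m" "(\<lambda>k. l2norm m (\<lambda>x. h k x - G x)) \<longlonglongrightarrow> 0" by blast
  \<comment> \<open>A weak upper gradient has to be non-negative at every point; since all
    \<open>h k\<close> are, the absolute value does not increase the distances.\<close>
  let ?G = "\<lambda>x. \<bar>G x\<bar>"
  have GL: "?G \<in> L2 m" by (rule L2_abs[OF G(1)])
  have lim0: "(\<lambda>k. l2norm m (\<lambda>x. h k x - ?G x)) \<longlonglongrightarrow> 0"
  proof (rule tendsto_sandwich[OF _ _ tendsto_const G(2)])
    have "l2norm m (\<lambda>x. h k x - ?G x) \<le> l2norm m (\<lambda>x. h k x - G x)" for k
    proof (rule l2norm_mono_AE[OF L2_diff[OF hL G(1)] L2_measurable[OF L2_diff[OF hL GL]]], rule AE_I2)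
      fix x
      show "\<bar>h k x - \<bar>G x\<bar>\<bar> \<le> \<bar>h k x - G x\<bar>" using h0[of k x] by linarith
    qed
    then show "\<forall>\<^sub>F k in sequentially. l2norm m (\<lambda>x. h k x - ?G x) \<le> l2norm m (\<lambda>x. h k x - G x)" by simp
  qed simp
  have wug: "weak_upper_gradient m (\<lambda>x. g x - f x) ?G"
  proof (rule weak_upper_gradient_limit[OF sets_m S2_measurable[OF gS] _ _ GL _ lim0])
    show "weak_upper_gradient m (\<lambda>x. g x - fs k x) (h k)" for k
      unfolding h_def by (rule weak_upper_gradient_min_wug[OF gS])
    show "AE x in m. (\<lambda>k. g x - fs k x) \<longlonglongrightarrow> g x - f x"
      using lim by eventually_elim (intro tendsto_intros)
  qed simp
  show S: "(\<lambda>x. g x - f x) \<in> S2 m"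
    by (rule S2I[OF borel_measurable_diff[OF S2_measurable[OF g] f] wug])
  have "l2norm m (min_wug m (\<lambda>x. g x - f x)) \<le> l2norm m ?G"
    by (rule l2norm_mono_AE[OF GL L2_measurable[OF min_wug_L2[OF S]]])
       (use min_wug_le[OF S wug] in eventually_elim, simp add: min_wug_nonneg[OF S])
  also have "l2norm m ?G \<le> b"
    by (rule LIMSEQ_le_const2[OF l2norm_tendsto[OF hL GL lim0]]) (use bound in \<open>auto simp: h_def\<close>)
  finally show "l2norm m (min_wug m (\<lambda>x. g x - f x)) \<le> b" .
qed

theorem differential_closed:
  assumes fs: "\<And>n. fs n \<in> S2 m" and f: "f \<in> borel_measurable m"
    and lim: "AE x in m. (\<lambda>n. fs n x) \<longlonglongrightarrow> f x"
    and \<omega>: "\<omega> \<in> vecs (cotangent_module m)"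
    and conv: "norm_converges (cotangent_module m) (\<lambda>n. differential m (fs n)) \<omega>"
  shows "f \<in> S2 m \<and> differential m f = \<omega>"
proof -
  let ?C = "cotangent_module m"
  note dC = differential_in_cotangent[OF fs]
  have lim\<omega>: "(\<lambda>n. vdist ?C (differential m (fs n)) \<omega>) \<longlonglongrightarrow> 0"
    using conv by (simp add: norm_converges_def)
  have cauchy: "\<exists>N. \<forall>k\<ge>N. \<forall>j\<ge>N. l2norm m (min_wug m (\<lambda>x. fs k x - fs j x)) < e" if "0 < e" for e
  proof -
    have "0 < e / 2" using that by simp
    from order_tendstoD(2)[OF lim\<omega> this] obtain N where
      N: "\<And>n. N \<le> n \<Longrightarrow> vdist ?C (differential m (fs n)) \<omega> < e / 2"
      by (auto simp: eventually_sequentially)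
    have "vdist ?C (differential m (fs k)) (differential m (fs j)) < e" if "N \<le> k" "N \<le> j" for k j
      using cotangent.dist_triangle[OF dC \<omega> dC, of k j] cotangent.dist_commute[OF \<omega> dC, of j] N[OF that(1)] N[OF that(2)]
      by linarith
    then show ?thesis unfolding dist_differential[OF fs fs] by blast
  qed
  have est: "\<exists>N. \<forall>n\<ge>N. (\<lambda>x. fs n x - f x) \<in> S2 m \<and> l2norm m (min_wug m (\<lambda>x. fs n x - f x)) \<le> e" if e: "0 < e" for e
  proof -
    obtain N where N: "\<And>k j. N \<le> k \<Longrightarrow> N \<le> j \<Longrightarrow> l2norm m (min_wug m (\<lambda>x. fs k x - fs j x)) < e"
      using cauchy[OF e] by blast
    have "(\<lambda>x. fs n x - f x) \<in> S2 m \<and> l2norm m (min_wug m (\<lambda>x. fs n x - f x)) \<le> e" if "N \<le> n" for n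
      using S2_minus_limit[OF fs[of n] fs f lim cauchy less_imp_le[OF N[OF that]]] by blast
    then show ?thesis by blast
  qed
  \<comment> \<open>\<open>f\<close> is \<open>fs n\<close> minus the difference, and
    \<open>S2 m\<close> is a linear space.\<close>
  obtain n where "(\<lambda>x. fs n x - f x) \<in> S2 m" using est[of 1] by auto
  from S2_diff[OF fs[of n] this] have S: "f \<in> S2 m" by simp
  note dS = differential_in_cotangent[OF S]
  have "(\<lambda>n. vdist ?C (differential m (fs n)) (differential m f)) \<longlonglongrightarrow> 0"
  proof (rule LIMSEQ_I)
    fix e :: real assume "0 < e"
    then obtain N where N: "\<forall>n\<ge>N. l2norm m (min_wug m (\<lambda>x. fs n x - f x)) \<le> e / 2"
      using est[of "e / 2"] by auto
    show "\<exists>N. \<forall>n\<ge>N. norm (vdist ?C (differential m (fs n)) (differential m f) - 0) < e"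
      unfolding dist_differential[OF fs S]
      by (rule exI[of _ N]) (use N \<open>0 < e\<close> in \<open>auto intro: le_less_trans\<close>)
  qed
  then have sum: "(\<lambda>n. vdist ?C (differential m (fs n)) (differential m f) + vdist ?C (differential m (fs n)) \<omega>) \<longlonglongrightarrow> 0 + 0"
    by (intro tendsto_add lim\<omega>)
  \<comment> \<open>Both covectors are limits of the same sequence, hence at distance 0, and the
    completion separates points.\<close>
  have "vdist ?C (differential m f) \<omega> \<le> vdist ?C (differential m (fs n)) (differential m f) + vdist ?C (differential m (fs n)) \<omega>" for n
    using cotangent.dist_triangle[OF dS dC \<omega>, of n] cotangent.dist_commute[OF dS dC, of n] by linarith
  with LIMSEQ_le_const[OF sum] have "vdist ?C (differential m f) \<omega> \<le> 0" by fastforce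
  then have "vdist ?C (differential m f) \<omega> = 0" using cotangent.dist_nonneg[OF dS \<omega>] by simp
  then have "differential m f = \<omega>"
    using pre_cotangent.completion_dist_eq_0 dS \<omega> unfolding cotangent_module_def by blast
  with S show ?thesis by blast
qed

text \<open>The graph of the differential over \<open>W12 m\<close> is a linear subspace of the
  product and so convex. Mazur's lemma applied to it yields functions close to \<open>f\<close>
  whose own differentials are close to \<open>\<omega>\<close>.\<close>

theorem differential_weakly_closed:
  assumes fs: "\<And>n. fs n \<in> W12 m" and f: "f \<in> L2 m"
    and \<omega>: "\<omega> \<in> vecs (cotangent_module m)"
    and wf: "weakly_converges (L2_space m) fs f"
    and w\<omega>: "weakly_converges (cotangent_module m) (\<lambda>n. differential m (fs n)) \<omega>"
  shows "f \<in> W12 m \<and> differential m f = \<omega>"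
proof -
  let ?C = "cotangent_module m"
  let ?X = "prod_nspace (L2_space m) ?C"
  have fsS: "fs n \<in> S2 m" and fsL: "fs n \<in> L2 m" for n using fs by (auto simp: W12_def)
  have vecsL: "vecs (L2_space m) = L2 m" by (simp add: L2_space_def)
  have vecsX: "vecs ?X = L2 m \<times> vecs ?C" by (simp add: prod_nspace_def vecsL)
  interpret X: seminormed ?X
    by (rule seminormed_prod[OF seminormed_L2_space cotangent.seminormed_axioms])
  define Q where "Q = (\<lambda>z. \<exists>g\<in>W12 m. z = (g, differential m g))"
  have weak: "weakly_converges ?X (\<lambda>n. (fs n, differential m (fs n))) (f, \<omega>)"
    by (rule weakly_converges_prod[OF seminormed_L2_space cotangent.seminormed_axioms _ _ _ \<omega> wf w\<omega>])
       (simp_all add: vecsL fsL f differential_in_cotangent fsS)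
  have approx: "\<exists>g\<in>W12 m. l2norm m (\<lambda>x. g x - f x) + vdist ?C (differential m g) \<omega> < \<delta>" if \<delta>: "0 < \<delta>" for \<delta>
  proof -
    have "\<exists>z\<in>vecs ?X. Q z \<and> vdist ?X z (f, \<omega>) < \<delta>"
    proof (rule X.Mazur[OF _ _ _ weak _ \<delta>])
      show "(fs n, differential m (fs n)) \<in> vecs ?X" for n
        using fsL fsS differential_in_cotangent by (simp add: vecsX)
      show "Q (fs n, differential m (fs n))" for n using fs by (auto simp: Q_def)
      show "(f, \<omega>) \<in> vecs ?X" using f \<omega> by (simp add: vecsX)
      fix v w and a b :: real assume "Q v" "Q w"
      then obtain g h where gh: "g \<in> W12 m" "h \<in> W12 m" "v = (g, differential m g)" "w = (h, differential m h)"
        by (auto simp: Q_def)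
      have S: "g \<in> S2 m" "h \<in> S2 m" and L: "g \<in> L2 m" "h \<in> L2 m" using gh by (auto simp: W12_def)
      let ?k = "\<lambda>x. a * g x + b * h x"
      have "?k \<in> W12 m" using S L by (auto simp: W12_def intro: S2_add S2_cmult L2_add L2_cmult)
      moreover have "vadd ?X (vscale ?X a v) (vscale ?X b w) = (?k, differential m ?k)"
        by (simp add: prod_nspace_def gh(3,4) L2_space_def differential_add[OF S2_cmult[OF S(1)] S2_cmult[OF S(2)]]
            differential_scale[OF S(1)] differential_scale[OF S(2)])
      ultimately show "Q (vadd ?X (vscale ?X a v) (vscale ?X b w))" by (auto simp: Q_def)
    qed
    then obtain g where g: "g \<in> W12 m" "vdist ?X (g, differential m g) (f, \<omega>) < \<delta>" by (auto simp: Q_def)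
    moreover have "vdist ?X (g, differential m g) (f, \<omega>) = vdist (L2_space m) g f + vdist ?C (differential m g) \<omega>"
      by (simp add: vdist_def prod_nspace_def)
    ultimately show ?thesis by (auto simp: vdist_L2_space)
  qed
  \<comment> \<open>Approximants at scale \<open>1 / (j + 1)\<close>: convergence of the functions
    in \<open>L2\<close> then gives a.e. convergence along a subsequence, as the strong statement
    demands.\<close>
  have "\<exists>g. g \<in> W12 m \<and> l2norm m (\<lambda>x. g x - f x) + vdist ?C (differential m g) \<omega> < 1 / real (Suc j)" for j
    using approx[of "1 / real (Suc j)"] by auto
  then obtain g where g: "\<And>j. g j \<in> W12 m"
    and gb: "\<And>j. l2norm m (\<lambda>x. g j x - f x) + vdist ?C (differential m (g j)) \<omega> < 1 / real (Suc j)" by metis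
  have gS: "g j \<in> S2 m" and gL: "g j \<in> L2 m" for j using g by (auto simp: W12_def)
  have null: "(\<lambda>j. 1 / real (Suc j)) \<longlonglongrightarrow> 0" using LIMSEQ_inverse_real_of_nat by (simp add: inverse_eq_divide)
  have d0: "0 \<le> vdist ?C (differential m (g j)) \<omega>" for j
    by (rule cotangent.dist_nonneg[OF differential_in_cotangent[OF gS] \<omega>])
  have "(\<lambda>j. l2norm m (\<lambda>x. g j x - f x)) \<longlonglongrightarrow> 0"
  proof (rule tendsto_sandwich[OF _ _ tendsto_const null])
    have "l2norm m (\<lambda>x. g j x - f x) \<le> 1 / real (Suc j)" for j using gb[of j] d0[of j] by linarith
    then show "\<forall>\<^sub>F j in sequentially. l2norm m (\<lambda>x. g j x - f x) \<le> 1 / real (Suc j)" by (intro always_eventually allI)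
  qed simp
  from L2_AE_subseq[OF gL f this] obtain r where r: "strict_mono r" "AE x in m. (\<lambda>j. g (r j) x) \<longlonglongrightarrow> f x" .
  have "(\<lambda>j. vdist ?C (differential m (g j)) \<omega>) \<longlonglongrightarrow> 0"
  proof (rule tendsto_sandwich[OF _ _ tendsto_const null])
    have "vdist ?C (differential m (g j)) \<omega> \<le> 1 / real (Suc j)" for j
      using gb[of j] l2norm_nonneg[of m "\<lambda>x. g j x - f x"] by linarith
    then show "\<forall>\<^sub>F j in sequentially. vdist ?C (differential m (g j)) \<omega> \<le> 1 / real (Suc j)" by (intro always_eventually allI)
  qed (use d0 in simp)
  from LIMSEQ_subseq_LIMSEQ[OF this r(1)]
  have "norm_converges ?C (\<lambda>j. differential m (g (r j))) \<omega>" by (simp add: norm_converges_def o_def)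
  from differential_closed[OF gS L2_measurable[OF f] r(2) \<omega> this] f show ?thesis by (simp add: W12_def)
qed

end

theorem theorem2p2p9:
  fixes m :: "'a::polish_space measure"
  assumes "radon_measure m"
  shows "(\<forall>(fs :: nat \<Rightarrow> 'a \<Rightarrow> real) f \<omega>.
            (\<forall>n. fs n \<in> S2 m) \<longrightarrow>
            f \<in> borel_measurable m \<longrightarrow>
            (AE x in m. (\<lambda>n. fs n x) \<longlonglongrightarrow> f x) \<longrightarrow>
            \<omega> \<in> vecs (cotangent_module m) \<longrightarrow>
            norm_converges (cotangent_module m) (\<lambda>n. differential m (fs n)) \<omega> \<longrightarrow>
            f \<in> S2 m \<and> differential m f = \<omega>) \<and>
         (\<forall>(fs :: nat \<Rightarrow> 'a \<Rightarrow> real) f \<omega>.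
            (\<forall>n. fs n \<in> W12 m) \<longrightarrow>
            f \<in> L2 m \<longrightarrow>
            \<omega> \<in> vecs (cotangent_module m) \<longrightarrow>
            weakly_converges (L2_space m) fs f \<longrightarrow>
            weakly_converges (cotangent_module m) (\<lambda>n. differential m (fs n)) \<omega> \<longrightarrow>
            f \<in> W12 m \<and> differential m f = \<omega>)"
proof -
  interpret borel_space m
    using assms by (simp add: borel_space_def radon_measure_def)
  show ?thesis
    using differential_closed differential_weakly_closed by blast
qed

end
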